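(* Let $\gamma:\mathbb{R}\to\mathbb{R}^2$ be a monomial curve with a parameter tuple $\beta$, let $b:\mathbb{R}^2\to\mathbb{C}$ be locally integrable and let $Q\in\mathcal{R}^\gamma$. Then, there exist bounded connected sets $W_1,W_2,P\subset\mathbb{R}^2$ and absolute constants $\Lambda>\lambda>1$ so that for distinct $S_1,S_2\in\{Q,W_1,W_2,P\}$ there holds that $$|S_1|\sim|S_2|,\qquad \lambda^\beta_{c_{S_1}}S_1\cap S_2=\emptyset,\qquad S_2\subset\Lambda^\beta S_1,$$ and there exist functions $\psi_{S_1},\psi_{S_2}$ so that $$|\psi_{S_i}|\lesssim 1_{S_i},\qquad i=1,2,$$ and $$\frac1{|Q|}\int_Q|b-\langle b\rangle_Q|\lesssim\frac1{|Q|}\big|\langle[b,H_\gamma]\psi_{S_1},\psi_{S_2}\rangle\big|\lesssim\frac1{|\Lambda^\beta Q|}\int_{\Lambda^\beta Q}|b-\langle b\rangle_{\Lambda^\beta Q}|.$$ Moreover, all the constants above are independent of $Q\in\mathcal{R}^\gamma$.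
   Context: A monomial curve $\gamma:\mathbb{R}\to\mathbb{R}^2$ is given by parameters $\beta=(\beta_1,\beta_2)$ with $0<\beta_1<\beta_2$ and $\varepsilon,\delta\in\{-1,1\}^2$ with $\varepsilon_i\neq\delta_i$ for at least one $i$, through $\gamma(t)=(\varepsilon_1|t|^{\beta_1},\varepsilon_2|t|^{\beta_2})$ for $t>0$ and $\gamma(t)=(\delta_1|t|^{\beta_1},\delta_2|t|^{\beta_2})$ for $t\le 0$. The Hilbert transform along $\gamma$ is $H_\gamma f(x)=\mathrm{p.v.}\int_{\mathbb{R}}f(x-\gamma(t))\frac{dt}{t}$, the commutator is $[b,H_\gamma]f=bH_\gamma f-H_\gamma(bf)$, and $\langle f,g\rangle=\int fg$. For a set $A$, $|A|$ is its Lebesgue measure, $1_A$ its indicator function, and $\langle b\rangle_A=\frac1{|A|}\int_A b$. The notation $X\lesssim Y$ means $X\le CY$ for a constant $C>0$, and $X\sim Y$ means $X\lesssim Y$ and $Y\lesssim X$. A $\gamma$-cube is a rectangle $Q=I_1\times I_2$ parallel to the coordinate axes with $\ell(Q):=\ell(I_1)^{1/\beta_1}=\ell(I_2)^{1/\beta_2}$, where $\ell(I_j)$ is the length of $I_j$; the collection of all $\gamma$-cubes is $\mathcal{R}^\gamma$. For a bounded connected set $E\subset\mathbb{R}^2$ the centre point is $c_E=(c_{\pi_1(E)},c_{\pi_2(E)})$, where $\pi_i$ is the $i$th coordinate projection and $c_{\pi_i(E)}$ is the midpoint of the interval $\pi_i(E)$. For $\lambda>0$ and $x\in\mathbb{R}^2$,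 $\lambda^\beta x=(\lambda^{\beta_1}x_1,\lambda^{\beta_2}x_2)$, and $\lambda^\beta E=\lambda^\beta_{c_E}E=\{c_E+\lambda^\beta(x-c_E):x\in E\}$ is the centric dilation.
   Formalization: The geometric relations hold for every distinct pair, but the two-sided estimate with the functions ψ is claimed for some distinct pair S₁,S₂ (depending on b and Q); for every pair it fails, e.g. when b oscillates on Q and vanishes off Q, so pairs among W₁,W₂,P give 0. *)

theory Defs
  imports "HOL-Analysis.Analysis"
begin

definition monomial_curve :: "real \<times> real \<Rightarrow> (real \<Rightarrow> real \<times> real) \<Rightarrow> bool" where
  "monomial_curve \<beta> \<gamma> \<longleftrightarrow> 0 < fst \<beta> \<and> fst \<beta> < snd \<beta> \<and>
     (\<exists>\<epsilon> \<delta>. \<epsilon> \<in> {-1, 1} \<times> {-1, 1} \<and> \<delta> \<in> {-1, 1} \<times> {-1, 1} \<and>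
        (fst \<epsilon> \<noteq> fst \<delta> \<or> snd \<epsilon> \<noteq> snd \<delta>) \<and>
        (\<forall>t. \<gamma> t = (if t > 0
                   then (fst \<epsilon> * \<bar>t\<bar> powr fst \<beta>, snd \<epsilon> * \<bar>t\<bar> powr snd \<beta>)
                   else (fst \<delta> * \<bar>t\<bar> powr fst \<beta>, snd \<delta> * \<bar>t\<bar> powr snd \<beta>))))"

text \<open>The principal value is taken at the singularity \<open>t = 0\<close>. Both \<open>Lim\<close> and the Lebesgue integral
  are total functions in HOL, so \<open>hilbert_along \<gamma> f x\<close> is meaningful only if
  \<open>hilbert_along_exists \<gamma> f x\<close> holds. All integrals are with respect to the completed Lebesgue measure.\<close>

definition hilbert_truncated :: "(real \<Rightarrow> real \<times> real) \<Rightarrow> (real \<times> real \<Rightarrow> complex) \<Rightarrow>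
    real \<times> real \<Rightarrow> real \<Rightarrow> complex" where
  "hilbert_truncated \<gamma> f x e = (LINT t:{t. e < \<bar>t\<bar>}|lebesgue. f (x - \<gamma> t) / of_real t)"

definition hilbert_along :: "(real \<Rightarrow> real \<times> real) \<Rightarrow> (real \<times> real \<Rightarrow> complex) \<Rightarrow>
    real \<times> real \<Rightarrow> complex" where
  "hilbert_along \<gamma> f x = Lim (at_right 0) (hilbert_truncated \<gamma> f x)"

definition hilbert_along_exists :: "(real \<Rightarrow> real \<times> real) \<Rightarrow> (real \<times> real \<Rightarrow> complex) \<Rightarrow>
    real \<times> real \<Rightarrow> bool" where
  "hilbert_along_exists \<gamma> f x \<longleftrightarrow>
     (\<forall>e>0. (\<lambda>t. f (x - \<gamma> t) / of_real t) absolutely_integrable_on {t. e < \<bar>t\<bar>}) \<and>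
     (\<exists>L. (hilbert_truncated \<gamma> f x \<longlongrightarrow> L) (at_right 0))"

definition commutator :: "('a \<Rightarrow> complex) \<Rightarrow> (('a \<Rightarrow> complex) \<Rightarrow> 'a \<Rightarrow> complex) \<Rightarrow>
    ('a \<Rightarrow> complex) \<Rightarrow> 'a \<Rightarrow> complex" where
  "commutator b T f = (\<lambda>x. b x * T f x - T (\<lambda>y. b y * f y) x)"

text \<open>The pairing is bilinear: there is no complex conjugation.\<close>

definition pairing :: "(real \<times> real \<Rightarrow> complex) \<Rightarrow> (real \<times> real \<Rightarrow> complex) \<Rightarrow> complex" where
  "pairing f g = (LINT x|lebesgue. f x * g x)"

text \<open>The pairing of \<open>[b, H\<^sub>\<gamma>]f\<close> with \<open>g\<close> makes sense: almost everywhere on \<open>{g \<noteq> 0}\<close> the two principal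
  values in the commutator exist, and the resulting product is Lebesgue integrable.\<close>

definition commutator_pairing_defined :: "(real \<Rightarrow> real \<times> real) \<Rightarrow> (real \<times> real \<Rightarrow> complex) \<Rightarrow>
    (real \<times> real \<Rightarrow> complex) \<Rightarrow> (real \<times> real \<Rightarrow> complex) \<Rightarrow> bool" where
  "commutator_pairing_defined \<gamma> b f g \<longleftrightarrow>
     (AE x in lebesgue. g x \<noteq> 0 \<longrightarrow>
        hilbert_along_exists \<gamma> f x \<and> hilbert_along_exists \<gamma> (\<lambda>y. b y * f y) x) \<and>
     integrable lebesgue (\<lambda>x. commutator b (hilbert_along \<gamma>) f x * g x)"

definition locally_integrable :: "(real \<times> real \<Rightarrow> complex) \<Rightarrow> bool" where
  "locally_integrable b \<longleftrightarrow> (\<forall>K. compact K \<longrightarrow> b absolutely_integrable_on K)"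

definition average :: "(real \<times> real) set \<Rightarrow> (real \<times> real \<Rightarrow> 'b::{banach, second_countable_topology}) \<Rightarrow> 'b" where
  "average A f = (1 / measure lebesgue A) *\<^sub>R (LINT x:A|lebesgue. f x)"

text \<open>No convention on the endpoints of the two sides is imposed; they are arbitrary bounded
  nondegenerate intervals.\<close>

definition gamma_cubes :: "real \<times> real \<Rightarrow> (real \<times> real) set set" where
  "gamma_cubes \<beta> = {I\<^sub>1 \<times> I\<^sub>2 | I\<^sub>1 I\<^sub>2.
     is_interval I\<^sub>1 \<and> bounded I\<^sub>1 \<and> 0 < measure lebesgue I\<^sub>1 \<and>
     is_interval I\<^sub>2 \<and> bounded I\<^sub>2 \<and> 0 < measure lebesgue I\<^sub>2 \<and>
     measure lebesgue I\<^sub>1 powr (1 / fst \<beta>) = measure lebesgue I\<^sub>2 powr (1 / snd \<beta>)}"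

definition centre :: "(real \<times> real) set \<Rightarrow> real \<times> real" where
  "centre E = (midpoint (Inf (fst ` E)) (Sup (fst ` E)), midpoint (Inf (snd ` E)) (Sup (snd ` E)))"

definition scale :: "real \<times> real \<Rightarrow> real \<Rightarrow> real \<times> real \<Rightarrow> real \<times> real" where
  "scale \<beta> r x = (r powr fst \<beta> * fst x, r powr snd \<beta> * snd x)"

definition dilate :: "real \<times> real \<Rightarrow> real \<Rightarrow> (real \<times> real) set \<Rightarrow> (real \<times> real) set" where
  "dilate \<beta> r E = {centre E + scale \<beta> r (x - centre E) | x. x \<in> E}"

end

theory Submission
  imports Defs
begin

text \<open>Only one branch of the curve matters. Let \<open>W\<close> be a box reached from \<open>Q\<close> by
a displacement \<open>- \<gamma> t\<close>, \<open>t > 0\<close>, and \<open>P\<close> a box reached from \<open>W\<close> by another one. Since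
the branch \<open>t \<le> 0\<close> lies in another quadrant, it leads neither from \<open>Q\<close> to \<open>W\<close> nor from \<open>W\<close> to \<open>P\<close>, and
\<open>H\<^sub>\<gamma>\<close> acts from \<open>W\<close> to \<open>Q\<close> and from \<open>P\<close> to \<open>W\<close> as a positive
averaging operator \<open>A\<close> (integration of \<open>f (x - \<gamma> t)\<close> against \<open>dt / t\<close> over a compact
interval). No singularity is left, so the principal values are finite integrals. An affine change of variables
(\<open>to_frame\<close>) turns every \<open>\<gamma>\<close>-cube into a box of one fixed size around the origin and
\<open>\<gamma>\<close> into \<open>t \<mapsto> (t powr \<beta>\<^sub>1, t powr \<beta>\<^sub>2)\<close>. This is why the constants do not
depend on \<open>Q\<close>.

For \<open>F = b - \<langle>b\<rangle>\<^sub>Q\<close> the pairing with the commutator is the form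
\<open>[u, v] = \<integral> v F A u - \<integral> u F A' v\<close>, where \<open>A'\<close> is the adjoint average
(\<open>pairing_eq_comm_form\<close>). So a term \<open>\<integral> v F A u\<close>, which sees \<open>F\<close> on one box,
can be traded for \<open>\<integral> u F A' v\<close>, which sees it on the next box, at the cost of one pairing.
The lower bound (\<open>comm_form_lower_bound\<close>) goes around the loop
\<open>Q \<rightarrow> W \<rightarrow> P \<rightarrow> W \<rightarrow> Q\<close>: with \<open>h\<close> the conjugate sign of \<open>F\<close>
and the weight \<open>w = A' 1\<^sub>Q / A 1\<^sub>P\<close> on \<open>W\<close>, the integral of \<open>\<bar>F\<bar>\<close> over
\<open>Q\<close> against \<open>A 1\<^sub>W\<close> is at most the sum of four pairings plus the absolute value of
\<open>\<integral>\<^sub>Q F A g\<close>, where \<open>g = 1\<^sub>W A (h 1\<^sub>P) / A 1\<^sub>P\<close>. The weight is chosen so that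
\<open>A g = A 1\<^sub>W\<close> if \<open>h\<close> is replaced by \<open>1\<close>; a trivial estimate would therefore lose
everything that was gained.

The gain comes from curvature. The double average \<open>h \<mapsto> A g\<close> runs over \<open>\<gamma> s + \<gamma> t\<close>,
and sums of two points on the curve fill an open set (\<open>sumset_of_power_curve\<close>). Hence its kernel is at
least \<open>\<kappa> 1\<^sub>P\<^sub>0\<close> for a small box \<open>P\<^sub>0\<close> inside \<open>P\<close>, uniformly in
\<open>x \<in> Q\<close>. The part \<open>\<kappa> \<integral>\<^sub>P\<^sub>0 h\<close> of \<open>A g\<close> does not depend on
\<open>x\<close> and is annihilated by the mean-zero function \<open>F\<close> on \<open>Q\<close>; the rest is at most
\<open>A 1\<^sub>W - \<kappa> \<bar>P\<^sub>0\<bar>\<close>. Subtracting leaves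
\<open>\<kappa> \<bar>P\<^sub>0\<bar> \<integral>\<^sub>Q \<bar>F\<bar>\<close> below the sum of the four pairings, and one of them is
at least a quarter of it. That one supplies the two sets and the two functions. The upper bound is the size
estimate of the same form, with \<open>F\<close> normalised by the mean over \<open>\<Lambda>\<^sup>\<beta> Q\<close> instead
(\<open>norm_comm_form_le\<close>), because the commutator does not change when a constant is added to \<open>b\<close>.\<close>

section \<open>Bounded Borel functions\<close>


definition bounded_borel :: "('a::euclidean_space \<Rightarrow> 'b::real_normed_vector) \<Rightarrow> bool" where
  "bounded_borel f \<longleftrightarrow> f \<in> borel_measurable borel \<and> (\<exists>C. \<forall>x. norm (f x) \<le> C)"

lemma bounded_borelI:
  "f \<in> borel_measurable borel \<Longrightarrow> (\<And>x. norm (f x) \<le> C) \<Longrightarrow> bounded_borel f"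
  unfolding bounded_borel_def by blast

lemma bounded_borel_measurable [measurable_dest]:
  "bounded_borel f \<Longrightarrow> f \<in> borel_measurable borel"
  unfolding bounded_borel_def by blast

lemma bounded_borelE:
  assumes "bounded_borel f"
  obtains C where "0 \<le> C" "\<And>x. norm (f x) \<le> C"
  using assms unfolding bounded_borel_def by (meson norm_ge_zero order_trans)

lemma bounded_borel_const [intro, simp]: "bounded_borel (\<lambda>x. c)"
  by (rule bounded_borelI[where C = "norm c"]) auto

lemma bounded_borel_indicator [intro]:
  "S \<in> sets borel \<Longrightarrow> bounded_borel (\<lambda>x. indicator S x :: 'b::real_normed_algebra_1)"
  by (rule bounded_borelI[where C = 1]) (auto simp: indicator_def)

lemma bounded_borel_mult [intro]:
  fixes f g :: "'a::euclidean_space \<Rightarrow> 'b::{real_normed_algebra, second_countable_topology}"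
  assumes "bounded_borel f" "bounded_borel g"
  shows "bounded_borel (\<lambda>x. f x * g x)"
proof -
  obtain C D where "0 \<le> C" "\<And>x. norm (f x) \<le> C" "0 \<le> D" "\<And>x. norm (g x) \<le> D"
    using assms by (meson bounded_borelE)
  moreover have "(\<lambda>x. f x * g x) \<in> borel_measurable borel"
    using assms by measurable
  ultimately show ?thesis
    by (intro bounded_borelI[where C = "C * D"]) (auto intro!: norm_mult_ineq[THEN order_trans] mult_mono)
qed

lemma bounded_borel_add [intro]:
  fixes f g :: "'a::euclidean_space \<Rightarrow> 'b::{real_normed_vector, second_countable_topology}"
  assumes "bounded_borel f" "bounded_borel g"
  shows "bounded_borel (\<lambda>x. f x + g x)"
proof -
  obtain C D where "\<And>x. norm (f x) \<le> C" "\<And>x. norm (g x) \<le> D"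
    using assms by (meson bounded_borelE)
  moreover have "(\<lambda>x. f x + g x) \<in> borel_measurable borel"
    using assms by measurable
  ultimately show ?thesis
    by (intro bounded_borelI[where C = "C + D"]) (auto intro!: norm_triangle_mono)
qed

lemma bounded_borel_of_real [intro]:
  assumes "bounded_borel f"
  shows "bounded_borel (\<lambda>x. of_real (f x) :: 'b::{real_normed_algebra_1, second_countable_topology})"
proof -
  obtain C where "\<And>x. norm (f x) \<le> C"
    using assms by (meson bounded_borelE)
  moreover have "(\<lambda>x. of_real (f x) :: 'b) \<in> borel_measurable borel"
    using assms by measurable
  ultimately show ?thesis
    by (intro bounded_borelI[where C = C]) (auto simp: norm_of_real)
qed

lemma bounded_borel_Re [intro]:
  assumes "bounded_borel f"
  shows "bounded_borel (\<lambda>x. Re (f x))"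
proof -
  obtain C where "\<And>x. norm (f x) \<le> C"
    using assms by (meson bounded_borelE)
  moreover have "(\<lambda>x. Re (f x)) \<in> borel_measurable borel"
    using assms by measurable
  ultimately show ?thesis
    by (intro bounded_borelI[where C = C]) (auto intro: abs_Re_le_cmod[THEN order_trans])
qed

lemma bounded_borel_ratio:
  fixes f k :: "'a::euclidean_space \<Rightarrow> real"
  assumes "bounded_borel f" "k \<in> borel_measurable borel" "0 < d" "S \<in> sets borel" "\<And>y. y \<in> S \<Longrightarrow> d \<le> k y"
  shows "bounded_borel (\<lambda>y. indicator S y * f y / k y)"
proof -
  obtain C where C: "0 \<le> C" "\<And>x. norm (f x) \<le> C"
    using assms by (meson bounded_borelE)
  have "\<bar>indicator S y * f y / k y\<bar> \<le> C / d" for y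
    using C(1) C(2)[of y] assms(3) assms(5)[of y] by (auto simp: indicator_def intro!: frac_le)
  moreover have "(\<lambda>y. indicator S y * f y / k y) \<in> borel_measurable borel"
    using assms by measurable
  ultimately show ?thesis
    by (intro bounded_borelI[where C = "C / d"]) auto
qed

lemma integrable_bounded_borel_mult:
  fixes F k :: "'a::euclidean_space \<Rightarrow> 'b::{real_normed_field, banach, second_countable_topology}"
  assumes "integrable lborel F" "bounded_borel k"
  shows "integrable lborel (\<lambda>x. k x * F x)"
proof -
  obtain C where C: "0 \<le> C" "\<And>x. norm (k x) \<le> C"
    using assms by (meson bounded_borelE)
  have "integrable lborel (\<lambda>x. C * norm (F x))"
    using assms(1) by simp
  moreover have "(\<lambda>x. k x * F x) \<in> borel_measurable lborel"
    using assms by measurable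
  moreover have "AE x in lborel. norm (k x * F x) \<le> norm (C * norm (F x))"
    using C by (auto simp: norm_mult intro!: mult_right_mono)
  ultimately show ?thesis by (rule Bochner_Integration.integrable_bound)
qed

section \<open>Averages along a curve\<close>

lemma integral_lborel_translate:
  fixes G :: "'a::euclidean_space \<Rightarrow> 'b::{banach, second_countable_topology}"
  assumes "G \<in> borel_measurable borel"
  shows "(\<integral>x. G (x + c) \<partial>lborel) = (\<integral>x. G x \<partial>lborel)"
    and "integrable lborel (\<lambda>x. G (x + c)) \<longleftrightarrow> integrable lborel G"
  using integral_distr[of "(+) c" lborel borel G] integrable_distr_eq[of "(+) c" lborel borel G] assms
  by (auto simp: lborel_distr_plus add.commute)

definition curve_avg ::
  "real measure \<Rightarrow> (real \<Rightarrow> 'a) \<Rightarrow> ('a \<Rightarrow> 'b) \<Rightarrow> 'a::euclidean_space \<Rightarrow> 'b::{banach, second_countable_topology}"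
  where "curve_avg M g f x = (\<integral>t. f (x + g t) \<partial>M)"

locale curve_measure = finite_measure M for M :: "real measure" +
  fixes g :: "real \<Rightarrow> 'a::euclidean_space"
  assumes sets_M [measurable_cong]: "sets M = sets borel"
    and g_borel [measurable]: "g \<in> borel_measurable borel"
begin

lemma space_M: "space M = UNIV"
  using sets_eq_imp_space_eq[OF sets_M] by simp

lemma reversed: "curve_measure M (\<lambda>t. - g t)"
  unfolding curve_measure_def curve_measure_axioms_def
  using finite_measure_axioms sets_M borel_measurable_uminus[OF g_borel] by blast

lemma integrable_along:
  assumes "bounded_borel f"
  shows "integrable M (\<lambda>t. f (x + g t) :: 'b::{banach, second_countable_topology})"
proof -
  obtain C where C: "\<And>x. norm (f x) \<le> C"
    using assms by (meson bounded_borelE)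
  have [measurable]: "f \<in> borel_measurable borel" using assms by measurable
  show ?thesis by (rule integrable_const_bound[where B = C]) (auto simp: C)
qed

lemma curve_avg_measurable:
  fixes f :: "'a \<Rightarrow> 'b::{banach, second_countable_topology}"
  assumes [measurable]: "f \<in> borel_measurable borel"
  shows "curve_avg M g f \<in> borel_measurable borel"
  unfolding curve_avg_def by measurable

lemma norm_curve_avg_le:
  fixes f :: "'a \<Rightarrow> 'b::{banach, second_countable_topology}"
  assumes "bounded_borel f" "bounded_borel k" "\<And>x. norm (f x) \<le> k x"
  shows "norm (curve_avg M g f x) \<le> curve_avg M g k x"
proof -
  have "norm (curve_avg M g f x) \<le> (\<integral>t. norm (f (x + g t)) \<partial>M)"
    unfolding curve_avg_def by (rule integral_norm_bound)
  also have "\<dots> \<le> curve_avg M g k x"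
    unfolding curve_avg_def
    by (intro integral_mono integrable_norm integrable_along[OF assms(1)] integrable_along[OF assms(2)] assms(3))
  finally show ?thesis .
qed

lemma curve_avg_mono:
  fixes f k :: "'a \<Rightarrow> real"
  assumes "bounded_borel f" "bounded_borel k" "\<And>x. f x \<le> k x"
  shows "curve_avg M g f x \<le> curve_avg M g k x"
  unfolding curve_avg_def
  by (intro integral_mono integrable_along[OF assms(1)] integrable_along[OF assms(2)] assms(3))

lemma curve_avg_nonneg:
  fixes f :: "'a \<Rightarrow> real"
  assumes "\<And>x. 0 \<le> f x"
  shows "0 \<le> curve_avg M g f x"
  unfolding curve_avg_def by (simp add: assms)

lemma curve_avg_const: "curve_avg M g (\<lambda>x. c) x = measure M UNIV * (c::real)"
  unfolding curve_avg_def by (simp add: space_M)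

lemma curve_avg_le:
  fixes f :: "'a \<Rightarrow> 'b::{banach, second_countable_topology}"
  assumes "f \<in> borel_measurable borel" "\<And>x. norm (f x) \<le> C"
  shows "norm (curve_avg M g f x) \<le> measure M UNIV * C"
  using norm_curve_avg_le[OF bounded_borelI[OF assms] bounded_borel_const assms(2)]
  by (simp add: curve_avg_const)

lemma bounded_borel_curve_avg [intro]:
  fixes f :: "'a \<Rightarrow> 'b::{banach, second_countable_topology}"
  assumes "bounded_borel f"
  shows "bounded_borel (curve_avg M g f)"
proof -
  obtain C where C: "\<And>x. norm (f x) \<le> C" "f \<in> borel_measurable borel"
    using assms unfolding bounded_borel_def by blast
  then show ?thesis
    by (intro bounded_borelI[where C = "measure M UNIV * C"] curve_avg_measurable curve_avg_le)
qed

lemma curve_avg_add: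
  fixes f k :: "'a \<Rightarrow> 'b::{banach, second_countable_topology}"
  assumes "bounded_borel f" "bounded_borel k"
  shows "curve_avg M g (\<lambda>x. f x + k x) x = curve_avg M g f x + curve_avg M g k x"
  unfolding curve_avg_def
  by (intro Bochner_Integration.integral_add integrable_along[OF assms(1)] integrable_along[OF assms(2)])

lemma curve_avg_of_real:
  assumes "bounded_borel f"
  shows "curve_avg M g (\<lambda>x. of_real (f x)) x = (of_real (curve_avg M g f x) :: 'b::{real_normed_field, banach, second_countable_topology})"
  unfolding curve_avg_def by (rule integral_of_real) (rule integrable_along[OF assms])

lemma curve_avg_Re:
  assumes "bounded_borel f"
  shows "curve_avg M g (\<lambda>x. Re (f x)) x = Re (curve_avg M g f x)"
  unfolding curve_avg_def by (rule integral_Re) (rule integrable_along[OF assms])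

lemma curve_avg_cmult:
  "curve_avg M g (\<lambda>x. c * f x) x = (c :: 'b::{real_normed_field, banach, second_countable_topology}) * curve_avg M g f x"
  unfolding curve_avg_def by simp

interpretation prod: pair_sigma_finite M "lborel :: 'a measure" ..

lemma integrable_translates:
  fixes G h :: "'a \<Rightarrow> 'b::{real_normed_field, banach, second_countable_topology}"
  assumes G: "integrable lborel G" and h: "bounded_borel h"
  shows "integrable (M \<Otimes>\<^sub>M lborel) (\<lambda>(t, x). h x * G (x + g t))"
proof -
  obtain C where C: "0 \<le> C" "\<And>x. norm (h x) \<le> C"
    using h by (meson bounded_borelE)
  have [measurable]: "G \<in> borel_measurable borel" "h \<in> borel_measurable borel"
    using G h by auto
  have "integrable (M \<Otimes>\<^sub>M lborel) (\<lambda>(t, x). C * norm (G (x + g t)))"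
  proof (rule prod.Fubini_integrable)
    show "(\<lambda>(t, x). C * norm (G (x + g t))) \<in> borel_measurable (M \<Otimes>\<^sub>M lborel)"
      by measurable
    have "(\<integral>x. norm (C * norm (G (x + g t))) \<partial>lborel) = C * (\<integral>x. norm (G x) \<partial>lborel)" for t
      using integral_lborel_translate(1)[of "\<lambda>x. norm (G x)" "g t"] C(1)
      by (simp add: abs_mult)
    then show "integrable M (\<lambda>t. \<integral>x. norm (case (t, x) of (t, x) \<Rightarrow> C * norm (G (x + g t))) \<partial>lborel)"
      by simp
    have "integrable lborel (\<lambda>x. norm (G (x + g t)))" for t
      using G by (intro integrable_norm) (simp add: integral_lborel_translate)
    then show "AE t in M. integrable lborel (\<lambda>x. case (t, x) of (t, x) \<Rightarrow> C * norm (G (x + g t)))"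
      by simp
  qed
  then show ?thesis
    by (rule Bochner_Integration.integrable_bound)
      (auto simp: norm_mult C abs_mult intro!: mult_right_mono AE_I2)
qed

text \<open>Fubini and the translation invariance of Lebesgue measure.\<close>

lemma curve_avg_duality:
  fixes G h :: "'a \<Rightarrow> 'b::{real_normed_field, banach, second_countable_topology}"
  assumes G: "integrable lborel G" and h: "bounded_borel h"
  shows "integrable lborel (\<lambda>x. h x * curve_avg M g G x)"
    and "(\<integral>x. h x * curve_avg M g G x \<partial>lborel) = (\<integral>x. G x * curve_avg M (\<lambda>t. - g t) h x \<partial>lborel)"
proof -
  have [measurable]: "G \<in> borel_measurable borel" "h \<in> borel_measurable borel"
    using G h by auto
  interpret R: curve_measure M "\<lambda>t. - g t" by (rule reversed)
  have I1: "integrable (M \<Otimes>\<^sub>M lborel) (\<lambda>(t, x). h x * G (x + g t))"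
    by (rule integrable_translates[OF G h])
  have I2: "integrable (M \<Otimes>\<^sub>M lborel) (\<lambda>(t, x). h (x - g t) * G x)"
  proof (rule prod.Fubini_integrable)
    show "(\<lambda>(t, x). h (x - g t) * G x) \<in> borel_measurable (M \<Otimes>\<^sub>M lborel)"
      by measurable
    have *: "(\<integral>x. norm (h (x - g t) * G x) \<partial>lborel) = (\<integral>x. norm (h x * G (x + g t)) \<partial>lborel)" for t
      using integral_lborel_translate(1)[of "\<lambda>x. norm (h (x - g t) * G x)" "g t"] by simp
    show "integrable M (\<lambda>t. \<integral>x. norm (case (t, x) of (t, x) \<Rightarrow> h (x - g t) * G x) \<partial>lborel)"
      using prod.integrable_fst'[OF integrable_norm[OF I1]] by (simp add: *)
    have "integrable lborel (\<lambda>x. h (x - g t) * G x)" for t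
    proof (rule integrable_bounded_borel_mult[OF G])
      show "bounded_borel (\<lambda>x. h (x - g t))"
        using h by (auto simp: bounded_borel_def)
    qed
    then show "AE t in M. integrable lborel (\<lambda>x. case (t, x) of (t, x) \<Rightarrow> h (x - g t) * G x)"
      by simp
  qed
  have e1: "h x * curve_avg M g G x = (\<integral>t. h x * G (x + g t) \<partial>M)" for x
    by (simp add: curve_avg_def)
  have e2: "G x * curve_avg M (\<lambda>t. - g t) h x = (\<integral>t. h (x - g t) * G x \<partial>M)" for x
    by (simp add: curve_avg_def)
  show "integrable lborel (\<lambda>x. h x * curve_avg M g G x)"
    unfolding e1 using prod.integrable_snd[OF I1] by simp
  have "(\<integral>x. h x * curve_avg M g G x \<partial>lborel) = (\<integral>t. (\<integral>x. h x * G (x + g t) \<partial>lborel) \<partial>M)"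
    unfolding e1 using prod.Fubini_integral[OF I1] by simp
  also have "\<dots> = (\<integral>t. (\<integral>x. h (x - g t) * G x \<partial>lborel) \<partial>M)"
  proof -
    have "(\<integral>x. h x * G (x + g t) \<partial>lborel) = (\<integral>x. h (x - g t) * G x \<partial>lborel)" for t
      using integral_lborel_translate(1)[of "\<lambda>x. h (x - g t) * G x" "g t"] by simp
    then show ?thesis by simp
  qed
  also have "\<dots> = (\<integral>x. G x * curve_avg M (\<lambda>t. - g t) h x \<partial>lborel)"
    unfolding e2 using prod.Fubini_integral[OF I2] by simp
  finally show "(\<integral>x. h x * curve_avg M g G x \<partial>lborel) = (\<integral>x. G x * curve_avg M (\<lambda>t. - g t) h x \<partial>lborel)" .
qed

lemma AE_integrable_along:
  fixes G :: "'a \<Rightarrow> 'b::{real_normed_field, banach, second_countable_topology}"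
  assumes "integrable lborel G"
  shows "AE x in lborel. integrable M (\<lambda>t. G (x + g t))"
  using prod.AE_integrable_snd[OF integrable_translates[OF assms, of "\<lambda>x. 1"]] by simp

text \<open>A Lebesgue measurable \<open>b\<close> may differ from its Borel version on a null set, which a single curve could
follow. For almost every base point the curve meets a null set only in a null set of parameters.\<close>

lemma AE_along:
  assumes "AE y in lborel. R y" 
  shows "AE x in lborel. AE t in M. R (x + g t)"
proof -
  obtain N where N: "N \<in> null_sets lborel" "{y \<in> space lborel. \<not> R y} \<subseteq> N"
    using assms unfolding eventually_ae_filter by blast
  have [measurable]: "N \<in> sets borel" using N by auto
  have "AE x in lborel. x + g t \<notin> N" for t
  proof -
    have "AE x in distr lborel borel ((+) (g t)). x \<notin> N"
      unfolding lborel_distr_plus by (rule AE_not_in[OF N(1)])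
    then show ?thesis
      by (subst (asm) AE_distr_iff) (auto simp: add.commute)
  qed
  then have "AE t in M. AE x in lborel. x + g t \<notin> N"
    by simp
  then have "AE x in lborel. AE t in M. x + g t \<notin> N"
    by (subst (asm) prod.AE_commute) measurable
  then show ?thesis
    by (rule eventually_mono) (erule eventually_mono, use N(2) in auto)
qed

end

section \<open>A lower bound for the commutator form\<close>

lemma cnj_sgn_mult: "cnj (sgn z) * z = of_real (cmod z)"
proof (cases "z = 0")
  case False
  have "z * cnj z = of_real (cmod z) * of_real (cmod z)"
    using complex_norm_square[of z] by (simp add: power2_eq_square)
  with False show ?thesis by (simp add: sgn_eq field_simps)
qed simp

context curve_measure
begin

text \<open>By duality this is \<open>\<integral> v (F A u - A (F u))\<close>, the pairing of the commutator of \<open>F\<close> and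
\<open>A\<close> applied to \<open>u\<close> with \<open>v\<close>. The symmetric form lets an integral be moved from the
support of \<open>v\<close> to that of \<open>u\<close> without further justification.\<close>

definition comm_form :: "('a \<Rightarrow> complex) \<Rightarrow> ('a \<Rightarrow> complex) \<Rightarrow> ('a \<Rightarrow> complex) \<Rightarrow> complex" where
  "comm_form F u v = (\<integral>x. v x * F x * curve_avg M g u x \<partial>lborel)
     - (\<integral>x. u x * F x * curve_avg M (\<lambda>t. - g t) v x \<partial>lborel)"

text \<open>After subtraction of the minorant \<open>j\<close> the double average is still a positive functional, hence is
bounded on functions of modulus at most one by its value at the constant function.\<close>

lemma norm_two_step_average_le:
  fixes k i j :: "'a \<Rightarrow> real" and h :: "'a \<Rightarrow> complex"
  assumes k: "bounded_borel k" and i: "bounded_borel i" and j: "integrable lborel j"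
    and minor: "\<And>\<theta>. bounded_borel \<theta> \<Longrightarrow> (\<And>z. 0 \<le> \<theta> z) \<Longrightarrow>
       (\<integral>z. \<theta> z * j z \<partial>lborel) \<le> curve_avg M g (\<lambda>y. k y * curve_avg M g (\<lambda>z. i z * \<theta> z) y) x"
    and h: "bounded_borel h" "\<And>z. cmod (h z) \<le> 1"
  shows "cmod (curve_avg M g (\<lambda>y. of_real (k y) * curve_avg M g (\<lambda>z. of_real (i z) * h z) y) x
       - (\<integral>z. h z * of_real (j z) \<partial>lborel))
     \<le> curve_avg M g (\<lambda>y. k y * curve_avg M g i y) x - (\<integral>z. j z \<partial>lborel)"
proof -
  define Tc where "Tc f = curve_avg M g (\<lambda>y. of_real (k y) * curve_avg M g (\<lambda>z. of_real (i z) * f z) y) x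
       - (\<integral>z. f z * of_real (j z) \<partial>lborel)" for f :: "'a \<Rightarrow> complex"
  define Tr where "Tr f = curve_avg M g (\<lambda>y. k y * curve_avg M g (\<lambda>z. i z * f z) y) x
       - (\<integral>z. f z * j z \<partial>lborel)" for f :: "'a \<Rightarrow> real"
  have jc: "integrable lborel (\<lambda>z. of_real (j z) :: complex)"
    using j by simp
  have Re_Tc: "Re (Tc f) = Tr (\<lambda>z. Re (f z))" if f: "bounded_borel f" for f
  proof -
    have b1: "bounded_borel (\<lambda>z. of_real (i z) * f z)"
      by (intro bounded_borel_mult bounded_borel_of_real i f)
    have b2: "bounded_borel (\<lambda>y. of_real (k y) * curve_avg M g (\<lambda>z. of_real (i z) * f z) y)"
      by (intro bounded_borel_mult bounded_borel_of_real k bounded_borel_curve_avg b1)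
    have "Re (curve_avg M g (\<lambda>y. of_real (k y) * curve_avg M g (\<lambda>z. of_real (i z) * f z) y) x)
        = curve_avg M g (\<lambda>y. k y * curve_avg M g (\<lambda>z. i z * Re (f z)) y) x"
      using curve_avg_Re[OF b2, of x] curve_avg_Re[OF b1] by simp
    moreover have "Re (\<integral>z. f z * of_real (j z) \<partial>lborel) = (\<integral>z. Re (f z) * j z \<partial>lborel)"
      using integral_Re[OF integrable_bounded_borel_mult[OF jc f]] by simp
    ultimately show ?thesis by (simp add: Tc_def Tr_def)
  qed
  have Tr_add: "Tr (\<lambda>z. f z + e z) = Tr f + Tr e" if f: "bounded_borel f" "bounded_borel e" for f e
  proof -
    have "bounded_borel (\<lambda>z. i z * f z)" "bounded_borel (\<lambda>z. i z * e z)"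
      by (intro bounded_borel_mult i f)+
    moreover from this have "bounded_borel (\<lambda>y. k y * curve_avg M g (\<lambda>z. i z * f z) y)"
      "bounded_borel (\<lambda>y. k y * curve_avg M g (\<lambda>z. i z * e z) y)"
      by (auto intro!: bounded_borel_mult k bounded_borel_curve_avg)
    ultimately show ?thesis
      using integrable_bounded_borel_mult[OF j f(1)] integrable_bounded_borel_mult[OF j f(2)]
      by (simp add: Tr_def algebra_simps curve_avg_add)
  qed
  have Tr_nonneg: "0 \<le> Tr f" if "bounded_borel f" "\<And>z. 0 \<le> f z" for f
    using minor[OF that] by (simp add: Tr_def)
  obtain c where c: "cmod c = 1" "c * Tc h = of_real (cmod (Tc h))"
  proof (cases "Tc h = 0")
    case False
    then show ?thesis
      by (intro that[of "cnj (sgn (Tc h))"]) (simp_all add: norm_sgn cnj_sgn_mult)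
  qed (auto intro: that[of 1])
  have ch: "bounded_borel (\<lambda>z. c * h z)" by (intro bounded_borel_mult h) simp
  have "c * Tc h = Tc (\<lambda>z. c * h z)"
    by (simp add: Tc_def curve_avg_cmult mult.left_commute[of _ c] mult.assoc right_diff_distrib)
  moreover define r where "r = (\<lambda>z. Re (c * h z))"
  ultimately have "cmod (Tc h) = Tr r"
    using Re_Tc[OF ch] c(2) by (metis Re_complex_of_real)
  moreover have r: "bounded_borel r" "bounded_borel (\<lambda>z. 1 - r z)"
  proof -
    show "bounded_borel r"
      unfolding r_def by (rule bounded_borel_Re[OF ch])
    then have "bounded_borel (\<lambda>z. 1 + - 1 * r z)"
      by (intro bounded_borel_add bounded_borel_mult) auto
    then show "bounded_borel (\<lambda>z. 1 - r z)" by simp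
  qed
  moreover have "r z \<le> 1" for z
    using complex_Re_le_cmod[of "c * h z"] h(2)[of z] c(1) by (simp add: norm_mult r_def)
  then have "0 \<le> Tr (\<lambda>z. 1 - r z)"
    by (intro Tr_nonneg r) simp
  ultimately have "cmod (Tc h) \<le> Tr (\<lambda>z. 1)"
    using Tr_add[OF r] by simp
  then show ?thesis by (simp add: Tc_def Tr_def)
qed

lemma norm_integral_mult_le:
  fixes F k :: "'a \<Rightarrow> complex" and e :: "'a \<Rightarrow> real"
  assumes F: "integrable lborel F" and e: "bounded_borel e"
    and k: "\<And>x. cmod (k x) \<le> e x"
  shows "cmod (\<integral>x. k x * F x \<partial>lborel) \<le> (\<integral>x. e x * cmod (F x) \<partial>lborel)"
proof (cases "integrable lborel (\<lambda>x. k x * F x)")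
  case True
  have "cmod (\<integral>x. k x * F x \<partial>lborel) \<le> (\<integral>x. cmod (k x * F x) \<partial>lborel)"
    by (rule integral_norm_bound)
  also have "\<dots> \<le> (\<integral>x. e x * cmod (F x) \<partial>lborel)"
    by (rule integral_mono[OF integrable_norm[OF True] integrable_bounded_borel_mult[OF integrable_norm[OF F] e]])
      (auto simp: norm_mult intro: mult_right_mono k)
  finally show ?thesis .
next
  case False
  have "0 \<le> e x" for x using k[of x] norm_ge_zero[of "k x"] by linarith
  then show ?thesis using False by (simp add: not_integrable_integral_eq)
qed

text \<open>The four pairings are those of the loop \<open>Q \<rightarrow> W \<rightarrow> P \<rightarrow> W \<rightarrow> Q\<close>. The
assumption \<open>minor\<close> is the lower bound for the kernel of the double average; the vanishing mean of
\<open>F\<close> removes the minorant from the last integral.\<close>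

theorem comm_form_lower_bound:
  fixes F :: "'a \<Rightarrow> complex"
  assumes F: "integrable lborel F"
    and sets [measurable]: "Q \<in> sets borel" "W \<in> sets borel" "P \<in> sets borel" "P\<^sub>0 \<in> sets borel"
    and P\<^sub>0: "integrable lborel (indicator P\<^sub>0 :: 'a \<Rightarrow> real)"
    and mean: "(\<integral>x. indicator Q x * F x \<partial>lborel) = 0"
    and d: "0 < d" "\<And>y. y \<in> W \<Longrightarrow> d \<le> curve_avg M g (indicator P) y"
    and minor: "\<And>x \<theta>. x \<in> Q \<Longrightarrow> bounded_borel \<theta> \<Longrightarrow> (\<And>z. 0 \<le> \<theta> z) \<Longrightarrow>
       \<kappa> * (\<integral>z. \<theta> z * indicator P\<^sub>0 z \<partial>lborel)
       \<le> curve_avg M g (\<lambda>y. indicator W y * curve_avg M g (\<lambda>z. indicator P z * \<theta> z) y / curve_avg M g (indicator P) y) x"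
  obtains S T u v where "(S, T) \<in> {(W, Q), (P, W)}" "bounded_borel u" "bounded_borel v"
    "\<And>x. cmod (u x) \<le> max 1 (measure M UNIV / d) * indicator S x"
    "\<And>x. cmod (v x) \<le> max 1 (measure M UNIV / d) * indicator T x"
    "\<kappa> * measure lborel P\<^sub>0 * (\<integral>x. indicator Q x * cmod (F x) \<partial>lborel) \<le> 4 * cmod (comm_form F u v)"
proof -
  interpret R: curve_measure M "\<lambda>t. - g t" by (rule reversed)
  note [measurable] = borel_measurable_integrable[OF F]
  let ?A = "curve_avg M g" and ?B = "curve_avg M (\<lambda>t. - g t)"
  define iQ iW iP where defs: "iQ = (indicator Q :: 'a \<Rightarrow> real)" "iW = (indicator W :: 'a \<Rightarrow> real)" "iP = (indicator P :: 'a \<Rightarrow> real)"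
  have i [simp]: "bounded_borel iQ" "bounded_borel iW" "bounded_borel iP"
    unfolding defs by (auto intro: bounded_borel_indicator)
  define c where "c = (\<lambda>x. of_real x :: complex)"
  define DQ where "DQ = ?B iQ"
  define DP where "DP = ?A iP"
  define k where "k = (\<lambda>y. iW y * 1 / DP y)"
  (* With this weight A 1_P cancels: the integral over W against D_Q becomes one against w * A 1_P. *)
  define w where "w = (\<lambda>y. k y * DQ y)"
  define h where "h = (\<lambda>x. cnj (sgn (F x)))"
  have D: "bounded_borel DQ" "bounded_borel DP"
    unfolding DQ_def DP_def by (auto intro: R.bounded_borel_curve_avg bounded_borel_curve_avg)
  have k: "bounded_borel k"
    unfolding k_def defs(2) using D(2) d by (intro bounded_borel_ratio[of _ _ d]) (auto simp: DP_def defs)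
  have w: "bounded_borel w" unfolding w_def by (intro bounded_borel_mult k D)
  have h: "bounded_borel h"
  proof (rule bounded_borelI[where C = 1])
    have [measurable]: "cnj \<in> borel_measurable borel"
      by (intro borel_measurable_continuous_onI continuous_intros)
    show "h \<in> borel_measurable borel"
      unfolding h_def sgn_div_norm by measurable
  qed (simp add: h_def norm_sgn)
  have h1: "cmod (h x) \<le> 1" for x by (simp add: h_def norm_sgn)
  have cF: "c (cmod (F x)) = h x * F x" for x by (simp add: h_def cnj_sgn_mult c_def)
  have kDP: "k y * DP y = iW y" for y
    using d by (auto simp: k_def DP_def defs indicator_def) (metis less_irrefl not_less)+
  define m where "m = measure M UNIV"
  have m: "0 \<le> m" by (simp add: m_def)
  have i01: "0 \<le> iQ x" "iQ x \<le> 1" "0 \<le> iW x" "iW x \<le> 1" "0 \<le> iP x" "iP x \<le> 1" for x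
    by (auto simp: defs indicator_def)
  have DQ01: "0 \<le> DQ y" "DQ y \<le> m" for y
    unfolding DQ_def using R.curve_avg_nonneg[of iQ y] R.curve_avg_le[of iQ 1 y] i01
      bounded_borel_measurable[OF i(1)]
    by (auto simp: m_def abs_le_iff)
  have DPd: "0 < d" "y \<in> W \<Longrightarrow> d \<le> DP y" for y
    using d by (auto simp: DP_def defs)
  have k0: "0 \<le> k y" for y
    using d(1) DPd(2)[of y] by (auto simp: k_def defs indicator_def)
  have w01: "0 \<le> w y" "w y \<le> m / d * iW y" for y
  proof -
    show "0 \<le> w y" using k0 DQ01 by (simp add: w_def)
    show "w y \<le> m / d * iW y"
      using DQ01[of y] DPd(1) DPd(2)[of y] m
      by (auto simp: w_def k_def defs indicator_def intro: frac_le)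
  qed
  define g\<^sub>4 where "g\<^sub>4 = (\<lambda>y. c (k y) * ?A (\<lambda>z. c (iP z) * h z) y)"
  have cb: "bounded_borel (\<lambda>x. c (f x))" if "bounded_borel f" for f :: "'a \<Rightarrow> real"
    unfolding c_def by (rule bounded_borel_of_real[OF that])
  have b: "bounded_borel (\<lambda>x. c (iQ x) * h x)" "bounded_borel (\<lambda>x. c (iP x) * h x)"
    "bounded_borel (\<lambda>x. c (w x) * h x)"
    by (intro bounded_borel_mult cb i h w)+
  have g4: "bounded_borel g\<^sub>4"
    unfolding g\<^sub>4_def by (intro bounded_borel_mult cb k bounded_borel_curve_avg b)
  have A_le: "cmod (?A f x) \<le> ?A e x" if "bounded_borel f" "bounded_borel e" "\<And>x. cmod (f x) \<le> e x" for f e x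
    by (rule norm_curve_avg_le[OF that])
  have B_le: "cmod (?B f x) \<le> ?B e x" if "bounded_borel f" "bounded_borel e" "\<And>x. cmod (f x) \<le> e x" for f e x
    by (rule R.norm_curve_avg_le[OF that])
  have Ac: "?A (\<lambda>x. c (f x)) y = c (?A f y)" if "bounded_borel f" for f y
    unfolding c_def by (rule curve_avg_of_real[OF that])
  have Bc: "?B (\<lambda>x. c (f x)) y = c (?B f y)" if "bounded_borel f" for f y
    unfolding c_def by (rule R.curve_avg_of_real[OF that])
  have c_mult: "c (a * a') = c a * c a'" and norm_c [simp]: "cmod (c a) = \<bar>a\<bar>" for a a' by (auto simp: c_def)
  have intc: "(\<integral>x. c (f x) \<partial>lborel) = c (\<integral>x. f x \<partial>lborel)" for f :: "'a \<Rightarrow> real"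
    unfolding c_def by simp
  have g4_le: "cmod (g\<^sub>4 y) \<le> iW y" for y
  proof -
    have "cmod (?A (\<lambda>z. c (iP z) * h z) y) \<le> DP y"
      unfolding DP_def by (rule A_le[OF b(2) i(3)]) (use i01 h1 in \<open>auto simp: norm_mult intro: mult_left_le\<close>)
    then have "cmod (g\<^sub>4 y) \<le> k y * DP y"
      using k0[of y] by (auto simp: g\<^sub>4_def norm_mult intro: mult_left_mono)
    then show ?thesis by (simp add: kDP)
  qed
  define f\<^sub>1 where "f\<^sub>1 = comm_form F (\<lambda>x. c (iW x)) (\<lambda>x. c (iQ x) * h x)"
  define f\<^sub>2 where "f\<^sub>2 = comm_form F (\<lambda>x. c (iP x)) (\<lambda>x. c (w x) * h x)"
  define f\<^sub>3 where "f\<^sub>3 = comm_form F (\<lambda>x. c (iP x) * h x) (\<lambda>x. c (w x))"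
  define f\<^sub>4 where "f\<^sub>4 = comm_form F g\<^sub>4 (\<lambda>x. c (iQ x))"
  define a\<^sub>0 where "a\<^sub>0 = (\<integral>x. iQ x * ?A iW x * cmod (F x) \<partial>lborel)"
  define a\<^sub>1 where "a\<^sub>1 = (\<integral>x. iW x * DQ x * cmod (F x) \<partial>lborel)"
  define a\<^sub>2 where "a\<^sub>2 = (\<integral>x. iP x * ?B w x * cmod (F x) \<partial>lborel)"
  define c\<^sub>3 where "c\<^sub>3 = (\<integral>y. g\<^sub>4 y * F y * c (DQ y) \<partial>lborel)"
  define c\<^sub>4 where "c\<^sub>4 = (\<integral>x. c (iQ x) * F x * ?A g\<^sub>4 x \<partial>lborel)"
  define j where "j = (\<lambda>z. \<kappa> * indicator P\<^sub>0 z :: real)"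
  note ac = c_mult cF Ac Bc mult.commute mult.left_commute mult.assoc
  (* The four exchanges: Q to W, W to P, P back to W, W back to Q. *)
  have e1: "a\<^sub>0 \<le> cmod f\<^sub>1 + a\<^sub>1"
  proof -
    have "c a\<^sub>0 = f\<^sub>1 + (\<integral>x. (c (iW x) * ?B (\<lambda>x. c (iQ x) * h x) x) * F x \<partial>lborel)"
      unfolding f\<^sub>1_def comm_form_def a\<^sub>0_def intc[symmetric] by (simp add: ac)
    moreover have "cmod (\<integral>x. (c (iW x) * ?B (\<lambda>x. c (iQ x) * h x) x) * F x \<partial>lborel) \<le> a\<^sub>1"
      unfolding a\<^sub>1_def DQ_def
      by (rule norm_integral_mult_le[OF F])
        (use i01 h1 in \<open>auto simp: norm_mult intro!: bounded_borel_mult i R.bounded_borel_curve_avg mult_left_mono B_le b mult_left_le\<close>)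
    ultimately show ?thesis
      by (metis abs_ge_self norm_c norm_triangle_mono order_refl order_trans)
  qed
  have e2: "a\<^sub>1 \<le> cmod f\<^sub>2 + a\<^sub>2"
  proof -
    have kd: "w y * DP y = iW y * DQ y" for y
      using kDP[of y] by (simp add: w_def ac_simps)
    have "a\<^sub>1 = (\<integral>x. w x * DP x * cmod (F x) \<partial>lborel)"
      by (simp add: a\<^sub>1_def kd)
    then have "c a\<^sub>1 = f\<^sub>2 + (\<integral>x. (c (iP x) * ?B (\<lambda>x. c (w x) * h x) x) * F x \<partial>lborel)"
      unfolding f\<^sub>2_def comm_form_def intc[symmetric] by (simp add: ac DP_def flip: intc)
    moreover have "cmod (\<integral>x. (c (iP x) * ?B (\<lambda>x. c (w x) * h x) x) * F x \<partial>lborel) \<le> a\<^sub>2"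
      unfolding a\<^sub>2_def
      by (rule norm_integral_mult_le[OF F])
        (use i01 h1 w01 in \<open>auto simp: norm_mult intro!: bounded_borel_mult i R.bounded_borel_curve_avg w mult_left_mono B_le b mult_left_le\<close>)
    ultimately show ?thesis
      by (metis abs_ge_self norm_c norm_triangle_mono order_refl order_trans)
  qed
  have e3: "a\<^sub>2 \<le> cmod f\<^sub>3 + cmod c\<^sub>3"
  proof -
    have "c\<^sub>3 = (\<integral>x. c (w x) * F x * ?A (\<lambda>z. c (iP z) * h z) x \<partial>lborel)"
      by (simp add: c\<^sub>3_def g\<^sub>4_def w_def c_mult ac_simps)
    then have "c a\<^sub>2 = c\<^sub>3 - f\<^sub>3"
      unfolding f\<^sub>3_def comm_form_def a\<^sub>2_def intc[symmetric] by (simp add: ac w)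
    then show ?thesis
      by (metis abs_ge_self norm_c norm_triangle_ineq4 add.commute order_trans)
  qed
  have e4: "cmod c\<^sub>3 \<le> cmod f\<^sub>4 + cmod c\<^sub>4"
  proof -
    have "c\<^sub>3 = c\<^sub>4 - f\<^sub>4"
      unfolding f\<^sub>4_def comm_form_def c\<^sub>3_def c\<^sub>4_def DQ_def by (simp add: ac)
    then show ?thesis
      by (metis norm_triangle_ineq4 add.commute)
  qed
  have j: "integrable lborel j" using P\<^sub>0 by (simp add: j_def)
  have jint: "(\<integral>z. j z \<partial>lborel) = \<kappa> * measure lborel P\<^sub>0"
    by (simp add: j_def)
  define \<zeta> where "\<zeta> = (\<integral>z. h z * c (j z) \<partial>lborel)"
  have e5: "cmod c\<^sub>4 \<le> a\<^sub>0 - \<kappa> * measure lborel P\<^sub>0 * (\<integral>x. iQ x * cmod (F x) \<partial>lborel)"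
  proof -
    have I: "integrable lborel (\<lambda>x. c (iQ x) * F x)"
      by (intro integrable_bounded_borel_mult F cb i)
    have I2: "integrable lborel (\<lambda>x. ?A g\<^sub>4 x * (c (iQ x) * F x))"
      by (intro integrable_bounded_borel_mult I bounded_borel_curve_avg g4)
    have I3: "integrable lborel (\<lambda>x. iQ x * cmod (F x))"
      by (intro integrable_bounded_borel_mult integrable_norm F i)
    have I4: "integrable lborel (\<lambda>x. ?A iW x * (iQ x * cmod (F x)))"
      by (intro integrable_bounded_borel_mult I3 bounded_borel_curve_avg i)
    have Q0: "(\<integral>x. c (iQ x) * F x \<partial>lborel) = 0"
    proof -
      have "c (iQ x) = indicator Q x" for x by (simp add: c_def defs indicator_def)
      with mean show ?thesis by simp
    qed
    (* The constant \<zeta> can be subtracted because F has mean zero on Q. *)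
    have "c\<^sub>4 = (\<integral>x. ?A g\<^sub>4 x * (c (iQ x) * F x) - \<zeta> * (c (iQ x) * F x) \<partial>lborel)"
      using I I2 Q0 by (simp add: c\<^sub>4_def ac_simps)
    also have "\<dots> = (\<integral>x. c (iQ x) * (?A g\<^sub>4 x - \<zeta>) * F x \<partial>lborel)"
      by (simp add: algebra_simps)
    also have "cmod \<dots> \<le> (\<integral>x. iQ x * (?A iW x - \<kappa> * measure lborel P\<^sub>0) * cmod (F x) \<partial>lborel)"
    proof (rule norm_integral_mult_le[OF F])
      have "bounded_borel (\<lambda>x. iQ x * (?A iW x + - (\<kappa> * measure lborel P\<^sub>0)))"
        by (intro bounded_borel_mult bounded_borel_add i bounded_borel_curve_avg bounded_borel_const)
      then show "bounded_borel (\<lambda>x. iQ x * (?A iW x - \<kappa> * measure lborel P\<^sub>0))" by simp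
      fix x
      show "cmod (c (iQ x) * (?A g\<^sub>4 x - \<zeta>)) \<le> iQ x * (?A iW x - \<kappa> * measure lborel P\<^sub>0)"
      proof (cases "x \<in> Q")
        case True
        have "cmod (?A g\<^sub>4 x - \<zeta>) \<le> ?A (\<lambda>y. k y * ?A iP y) x - (\<integral>z. j z \<partial>lborel)"
          unfolding g\<^sub>4_def \<zeta>_def c_def
        proof (rule norm_two_step_average_le[OF k i(3) j _ h h1])
          fix \<theta> :: "'a \<Rightarrow> real"
          assume "bounded_borel \<theta>" "\<And>z. 0 \<le> \<theta> z"
          from minor[OF True this]
          show "(\<integral>z. \<theta> z * j z \<partial>lborel) \<le> ?A (\<lambda>y. k y * ?A (\<lambda>z. iP z * \<theta> z) y) x"
            by (simp add: j_def k_def DP_def defs mult.left_commute[of _ \<kappa>])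
        qed
        then show ?thesis
          using True kDP by (simp add: jint DP_def norm_mult defs)
      qed (simp add: defs c_def)
    qed
    also have "\<dots> = (\<integral>x. ?A iW x * (iQ x * cmod (F x)) - \<kappa> * measure lborel P\<^sub>0 * (iQ x * cmod (F x)) \<partial>lborel)"
      by (simp add: algebra_simps)
    also have "\<dots> = a\<^sub>0 - \<kappa> * measure lborel P\<^sub>0 * (\<integral>x. iQ x * cmod (F x) \<partial>lborel)"
      by (subst Bochner_Integration.integral_diff[OF I4 integrable_mult_right[OF I3]]) (simp only: integral_mult_right_zero, simp add: a\<^sub>0_def ac_simps)
    finally show ?thesis .
  qed
  have K: "max 1 (m / d) \<ge> 1" "max 1 (m / d) \<ge> m / d" by auto
  have total: "\<kappa> * measure lborel P\<^sub>0 * (\<integral>x. iQ x * cmod (F x) \<partial>lborel) \<le> cmod f\<^sub>1 + cmod f\<^sub>2 + cmod f\<^sub>3 + cmod f\<^sub>4"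
    using e1 e2 e3 e4 e5 by linarith
  have le: "cmod (c (i x) * z) \<le> max 1 (m / d) * i x" if "cmod z \<le> 1" "0 \<le> i x" for i :: "'a \<Rightarrow> real" and x z
    using mult_mono[OF K(1) that(1), of ] that mult_right_mono[of 1 "max 1 (m / d)" "i x"] mult_left_le[of "cmod z" "i x"]
    by (simp add: norm_mult)
  have le1: "cmod (c (i x)) \<le> max 1 (m / d) * i x" if "0 \<le> i x" for i :: "'a \<Rightarrow> real" and x
    using le[of 1 i x] that by simp
  have lew: "cmod (c (w x) * z) \<le> max 1 (m / d) * iW x" if "cmod z \<le> 1" for x z
    using w01[of x] that mult_right_mono[OF K(2) i01(3)[of x]] mult_left_le[of "cmod z" "w x"] by (simp add: norm_mult)
  have leg: "cmod (g\<^sub>4 x) \<le> max 1 (m / d) * iW x" for x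
    using g4_le[of x] mult_right_mono[OF K(1) i01(3)[of x]] by simp
  consider "\<kappa> * measure lborel P\<^sub>0 * (\<integral>x. iQ x * cmod (F x) \<partial>lborel) \<le> 4 * cmod f\<^sub>1"
    | "\<kappa> * measure lborel P\<^sub>0 * (\<integral>x. iQ x * cmod (F x) \<partial>lborel) \<le> 4 * cmod f\<^sub>2"
    | "\<kappa> * measure lborel P\<^sub>0 * (\<integral>x. iQ x * cmod (F x) \<partial>lborel) \<le> 4 * cmod f\<^sub>3"
    | "\<kappa> * measure lborel P\<^sub>0 * (\<integral>x. iQ x * cmod (F x) \<partial>lborel) \<le> 4 * cmod f\<^sub>4"
    using total by linarith
  then show ?thesis
  proof cases
    case 1
    show ?thesis
      by (rule that[of W Q "\<lambda>x. c (iW x)" "\<lambda>x. c (iQ x) * h x"], goal_cases)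
        (use 1 cb[OF i(2)] b(1) le1[OF i01(3)] le[OF h1 i01(1)] in \<open>simp_all add: f\<^sub>1_def m_def defs del: norm_c\<close>)
  next
    case 2
    show ?thesis
      by (rule that[of P W "\<lambda>x. c (iP x)" "\<lambda>x. c (w x) * h x"], goal_cases)
        (use 2 cb[OF i(3)] b(3) le1[OF i01(5)] lew[OF h1] in \<open>simp_all add: f\<^sub>2_def m_def defs del: norm_c\<close>)
  next
    case 3
    show ?thesis
      by (rule that[of P W "\<lambda>x. c (iP x) * h x" "\<lambda>x. c (w x)"], goal_cases)
        (use 3 cb[OF w] b(2) le[OF h1 i01(5)] lew[of 1] in \<open>simp_all add: f\<^sub>3_def m_def defs del: norm_c\<close>)
  next
    case 4
    show ?thesis
      by (rule that[of W Q g\<^sub>4 "\<lambda>x. c (iQ x)"], goal_cases)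
        (use 4 cb[OF i(1)] g4 leg le1[OF i01(1)] in \<open>simp_all add: f\<^sub>4_def m_def defs del: norm_c\<close>)
  qed
qed

end

section \<open>The sumset of a power curve\<close>

lemma power_sum_has_derivative:
  assumes "0 < t" "t < u"
  shows "((\<lambda>t. (u - t) powr p + t powr p) has_real_derivative
     p * (t powr (p - 1) - (u - t) powr (p - 1))) (at t within S)"
  by (rule DERIV_subset[OF _ subset_UNIV])
    (use assms in \<open>auto intro!: derivative_eq_intros simp: algebra_simps\<close>)

lemma power_sum_strict_mono:
  fixes p :: real
  assumes "1 < p" "3/2 \<le> s" "s < t" "t < 3"
  shows "(3 - s) powr p + s powr p < (3 - t) powr p + t powr p"
proof (rule DERIV_pos_imp_increasing_open[OF assms(3)])
  fix z assume "s < z" "z < t"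
  then have "(3 - z) powr (p - 1) < z powr (p - 1)"
    using assms by (intro powr_less_mono2) auto
  then show "\<exists>y. ((\<lambda>t. (3 - t) powr p + t powr p) has_real_derivative y) (at z) \<and> 0 < y"
    using power_sum_has_derivative[of z 3 p UNIV] \<open>s < z\<close> \<open>z < t\<close> assms by force
next
  show "continuous_on {s..t} (\<lambda>t. (3 - t) powr p + t powr p)"
    using assms by (auto intro!: continuous_intros)
qed

text \<open>The map \<open>(s, t) \<mapsto> (s + t, s\<^sup>p + t\<^sup>p)\<close> is a local diffeomorphism near \<open>(1, 2)\<close>,
where the two tangent directions differ. Instead of a planar change of variables, fix the first coordinate
\<open>u = s + t\<close>, which is a translation, and substitute \<open>w = (u - t)\<^sup>p + t\<^sup>p\<close>, which is
increasing in \<open>t\<close> because \<open>t > u - t\<close>, with derivative at most \<open>K\<close>.\<close>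

lemma sumset_of_power_curve:
  fixes p \<eta> :: real
  assumes p: "1 < p" and \<eta>: "0 < \<eta>" "\<eta> \<le> 1/2"
  obtains \<rho> K where "0 < \<rho>" "\<rho> \<le> 1/8" "0 < K"
    "\<And>x \<theta>. \<theta> \<in> borel_measurable borel \<Longrightarrow> \<bar>fst x\<bar> \<le> \<rho> \<Longrightarrow> \<bar>snd x\<bar> \<le> \<rho> \<Longrightarrow>
      (\<integral>\<^sup>+z. \<theta> z * indicator (cbox (3 - \<rho>, 1 + 2 powr p - \<rho>) (3 + \<rho>, 1 + 2 powr p + \<rho>)) z \<partial>lborel)
      \<le> ennreal K * (\<integral>\<^sup>+t. \<integral>\<^sup>+s. \<theta> (x + (s + t, s powr p + t powr p))
           * indicator {1 - \<eta>..1 + \<eta>} s * indicator {2 - \<eta>..2 + \<eta>} t \<partial>lborel \<partial>lborel)"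
proof -
  define h where "h = \<eta> / 2"
  have h: "0 < h" "h \<le> 1/4" using \<eta> by (auto simp: h_def)
  define v where "v = (\<lambda>u t. (u - t) powr p + t powr p)"
  define v\<^sub>0 where "v\<^sub>0 = 1 + 2 powr p"
  have v0: "v 3 2 = v\<^sub>0" by (simp add: v_def v\<^sub>0_def)
  have lo: "v 3 (2 - h) < v\<^sub>0" and hi: "v\<^sub>0 < v 3 (2 + h)"
    using power_sum_strict_mono[OF p, of "2 - h" 2] power_sum_strict_mono[OF p, of 2 "2 + h"] h
    unfolding v0[symmetric] by (auto simp: v_def)
  have incr: "v u t \<le> v u' t" if "t \<le> u" "u \<le> u'" for u u' t
    unfolding v_def using that p by (auto intro!: powr_mono2)
  (* Room 2 * \<rho> rather than \<rho> absorbs the shift by x. *)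
  have "eventually (\<lambda>r::real. v (3 + 2 * r) (2 - h) < v\<^sub>0 - 2 * r) (at_right 0)"
  proof -
    have "((\<lambda>r. v\<^sub>0 - 2 * r - v (3 + 2 * r) (2 - h)) \<longlongrightarrow> v\<^sub>0 - 2 * 0 - v (3 + 2 * 0) (2 - h)) (at_right 0)"
      using h unfolding v_def by (intro tendsto_intros) auto
    from order_tendstoD(1)[OF this, of 0] lo show ?thesis by simp
  qed
  moreover have "eventually (\<lambda>r::real. v\<^sub>0 + 2 * r < v (3 - 2 * r) (2 + h)) (at_right 0)"
  proof -
    have "((\<lambda>r. v (3 - 2 * r) (2 + h) - (v\<^sub>0 + 2 * r)) \<longlongrightarrow> v (3 - 2 * 0) (2 + h) - (v\<^sub>0 + 2 * 0)) (at_right 0)"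
      using h unfolding v_def by (intro tendsto_intros) auto
    from order_tendstoD(1)[OF this, of 0] hi show ?thesis by simp
  qed
  moreover have "eventually (\<lambda>r::real. 0 < r) (at_right 0)" "eventually (\<lambda>r::real. r < h / 2) (at_right 0)"
    using h eventually_at_right_less[of 0] eventually_at_right_field[of "\<lambda>r. r < h / 2" 0] by (auto intro!: exI[of _ "h/2"])
  ultimately have "eventually (\<lambda>r::real. v (3 + 2 * r) (2 - h) < v\<^sub>0 - 2 * r \<and> v\<^sub>0 + 2 * r < v (3 - 2 * r) (2 + h)
      \<and> 0 < r \<and> r < h / 2) (at_right 0)"
    by eventually_elim auto
  then obtain \<rho> where \<rho>: "v (3 + 2 * \<rho>) (2 - h) < v\<^sub>0 - 2 * \<rho>" "v\<^sub>0 + 2 * \<rho> < v (3 - 2 * \<rho>) (2 + h)"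
      "0 < \<rho>" "\<rho> < h / 2"
    using eventually_happens'[of "at_right (0::real)"] by (auto simp: trivial_limit_at_right_real)
  define K where "K = p * 3 powr (p - 1)"
  have K: "0 < K" using p by (simp add: K_def)
  show ?thesis
  proof (rule that[OF \<rho>(3) _ K])
    show "\<rho> \<le> 1/8" using \<rho>(4) h by simp
    fix x :: "real \<times> real" and \<theta> :: "real \<times> real \<Rightarrow> ennreal"
    assume [measurable]: "\<theta> \<in> borel_measurable borel" and x: "\<bar>fst x\<bar> \<le> \<rho>" "\<bar>snd x\<bar> \<le> \<rho>"
    let ?B = "cbox (3 - \<rho>, 1 + 2 powr p - \<rho>) (3 + \<rho>, 1 + 2 powr p + \<rho>)"
    let ?I = "indicator {3 - 2*\<rho>..3 + 2*\<rho>} :: real \<Rightarrow> ennreal" and ?J = "indicator {v\<^sub>0 - 2*\<rho>..v\<^sub>0 + 2*\<rho>} :: real \<Rightarrow> ennreal"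
    have "(\<integral>\<^sup>+z. \<theta> z * indicator ?B z \<partial>lborel) = (\<integral>\<^sup>+z. \<theta> (x + z) * indicator ?B (x + z) \<partial>lborel)"
      using nn_integral_distr[of "(+) x" lborel borel "\<lambda>z. \<theta> z * indicator ?B z"]
      by (simp add: lborel_distr_plus)
    also have "\<dots> \<le> (\<integral>\<^sup>+z. \<theta> (x + z) * (?I (fst z) * ?J (snd z)) \<partial>lborel)"
    proof (intro nn_integral_mono mult_left_mono)
      fix z :: "real \<times> real"
      show "indicator ?B (x + z) \<le> ?I (fst z) * ?J (snd z)"
        using x by (cases x; cases z) (auto simp: indicator_def v\<^sub>0_def cbox_Pair_eq)
    qed auto
    also have "\<dots> = (\<integral>\<^sup>+u. \<integral>\<^sup>+w. \<theta> (x + (u, w)) * (?I u * ?J w) \<partial>lborel \<partial>lborel)"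
    proof -
      have [measurable]: "(\<lambda>z. \<theta> (x + z)) \<in> borel_measurable (lborel \<Otimes>\<^sub>M lborel)"
        by (simp add: lborel_prod)
      have "(\<lambda>z. \<theta> (x + z) * (?I (fst z) * ?J (snd z))) \<in> borel_measurable (lborel \<Otimes>\<^sub>M lborel)"
        by measurable
      from lborel.nn_integral_fst[OF this] show ?thesis
        by (simp add: lborel_prod)
    qed
    also have "\<dots> = (\<integral>\<^sup>+u. ?I u * (\<integral>\<^sup>+w. \<theta> (x + (u, w)) * ?J w \<partial>lborel) \<partial>lborel)"
      by (subst nn_integral_cmult[symmetric]) (auto simp: ac_simps)
    also have "\<dots> \<le> (\<integral>\<^sup>+u. ?I u * (ennreal K * (\<integral>\<^sup>+t. \<theta> (x + (u, v u t)) * indicator {2 - h..2 + h} t \<partial>lborel)) \<partial>lborel)"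
    proof (intro nn_integral_mono)
      fix u :: real
      show "?I u * (\<integral>\<^sup>+w. \<theta> (x + (u, w)) * ?J w \<partial>lborel)
          \<le> ?I u * (ennreal K * (\<integral>\<^sup>+t. \<theta> (x + (u, v u t)) * indicator {2 - h..2 + h} t \<partial>lborel))"
      proof (cases "u \<in> {3 - 2*\<rho>..3 + 2*\<rho>}")
        case True
        then have u: "3 - 2*\<rho> \<le> u" "u \<le> 3 + 2*\<rho>" by auto
        have "v u (2 - h) \<le> v\<^sub>0 - 2*\<rho>" "v\<^sub>0 + 2*\<rho> \<le> v u (2 + h)"
          using incr[of "2 - h" u "3 + 2*\<rho>"] incr[of "2 + h" "3 - 2*\<rho>" u] \<rho> u h by linarith+
        then have "(\<integral>\<^sup>+w. \<theta> (x + (u, w)) * ?J w \<partial>lborel) \<le> (\<integral>\<^sup>+w. \<theta> (x + (u, w)) * indicator {v u (2 - h)..v u (2 + h)} w \<partial>lborel)"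
          by (intro nn_integral_mono mult_left_mono) (auto simp: indicator_def)
        also have "\<dots> = (\<integral>\<^sup>+t. \<theta> (x + (u, v u t)) * ennreal (p * (t powr (p - 1) - (u - t) powr (p - 1))) * indicator {2 - h..2 + h} t \<partial>lborel)"
        proof (rule nn_integral_substitution_aux)
          fix t assume t: "t \<in> {2 - h..2 + h}"
          then have "0 < t" "t < u" "u - t \<le> t" using u h \<rho> by auto
          then show "(v u has_real_derivative p * (t powr (p - 1) - (u - t) powr (p - 1))) (at t)"
            unfolding v_def by (intro power_sum_has_derivative)
          show "0 \<le> p * (t powr (p - 1) - (u - t) powr (p - 1))"
            using p \<open>u - t \<le> t\<close> \<open>t < u\<close> by (intro mult_nonneg_nonneg) (auto intro!: powr_mono2)
        next
          show "continuous_on {2 - h..2 + h} (\<lambda>t. p * (t powr (p - 1) - (u - t) powr (p - 1)))"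
            using u h \<rho> by (intro continuous_intros) auto
        qed (use h in auto)
        also have "\<dots> \<le> (\<integral>\<^sup>+t. ennreal K * (\<theta> (x + (u, v u t)) * indicator {2 - h..2 + h} t) \<partial>lborel)"
        proof (intro nn_integral_mono)
          fix t
          have "p * (t powr (p - 1) - (u - t) powr (p - 1)) \<le> K" if "t \<in> {2 - h..2 + h}"
          proof -
            have "t powr (p - 1) \<le> 3 powr (p - 1)"
              using that p h by (intro powr_mono2) auto
            then have "t powr (p - 1) - (u - t) powr (p - 1) \<le> 3 powr (p - 1)"
              using powr_ge_zero[of "u - t" "p - 1"] by linarith
            then show ?thesis unfolding K_def using p by (intro mult_left_mono) auto
          qed
          then show "\<theta> (x + (u, v u t)) * ennreal (p * (t powr (p - 1) - (u - t) powr (p - 1))) * indicator {2 - h..2 + h} t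
            \<le> ennreal K * (\<theta> (x + (u, v u t)) * indicator {2 - h..2 + h} t)"
            by (auto simp: indicator_def mult.commute[of "ennreal K"] intro!: mult_left_mono ennreal_leI)
        qed
        also have "\<dots> = ennreal K * (\<integral>\<^sup>+t. \<theta> (x + (u, v u t)) * indicator {2 - h..2 + h} t \<partial>lborel)"
          unfolding v_def by (rule nn_integral_cmult) measurable
        finally show ?thesis by (intro mult_left_mono) auto
      qed auto
    qed
    also have "\<dots> = ennreal K * (\<integral>\<^sup>+u. \<integral>\<^sup>+t. \<theta> (x + (u, v u t)) * (indicator {2 - h..2 + h} t * ?I u) \<partial>lborel \<partial>lborel)"
      unfolding v_def by (subst nn_integral_cmult[symmetric], measurable)+ (simp add: ac_simps nn_integral_cmult[symmetric])
    also have "\<dots> \<le> ennreal K * (\<integral>\<^sup>+u. \<integral>\<^sup>+t. \<theta> (x + (u, v u t)) * (indicator {1 - \<eta>..1 + \<eta>} (u - t) * indicator {2 - \<eta>..2 + \<eta>} t) \<partial>lborel \<partial>lborel)"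
      using \<rho> h by (intro mult_left_mono nn_integral_mono) (auto simp: indicator_def h_def)
    also have "\<dots> = ennreal K * (\<integral>\<^sup>+t. \<integral>\<^sup>+u. \<theta> (x + (u, v u t)) * (indicator {1 - \<eta>..1 + \<eta>} (u - t) * indicator {2 - \<eta>..2 + \<eta>} t) \<partial>lborel \<partial>lborel)"
      unfolding v_def by (subst lborel_pair.Fubini') simp_all
    also have "\<dots> = ennreal K * (\<integral>\<^sup>+t. \<integral>\<^sup>+s. \<theta> (x + (s + t, s powr p + t powr p)) * indicator {1 - \<eta>..1 + \<eta>} s * indicator {2 - \<eta>..2 + \<eta>} t \<partial>lborel \<partial>lborel)"
    proof -
      have "(\<integral>\<^sup>+u. \<theta> (x + (u, v u t)) * (indicator {1 - \<eta>..1 + \<eta>} (u - t) * indicator {2 - \<eta>..2 + \<eta>} t) \<partial>lborel)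
        = (\<integral>\<^sup>+s. \<theta> (x + (s + t, s powr p + t powr p)) * indicator {1 - \<eta>..1 + \<eta>} s * indicator {2 - \<eta>..2 + \<eta>} t \<partial>lborel)" for t
        using nn_integral_real_affine[of "\<lambda>u. \<theta> (x + (u, v u t)) * (indicator {1 - \<eta>..1 + \<eta>} (u - t) * indicator {2 - \<eta>..2 + \<eta>} t)" 1 t]
        by (simp add: v_def ac_simps)
      then show ?thesis by simp
    qed
    finally show "(\<integral>\<^sup>+z. \<theta> z * indicator ?B z \<partial>lborel) \<le> ennreal K * (\<integral>\<^sup>+t. \<integral>\<^sup>+s. \<theta> (x + (s + t, s powr p + t powr p)) * indicator {1 - \<eta>..1 + \<eta>} s * indicator {2 - \<eta>..2 + \<eta>} t \<partial>lborel \<partial>lborel)" .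
  qed
qed

section \<open>The estimate at unit scale\<close>

definition log_measure :: "real \<Rightarrow> real \<Rightarrow> real measure" where
  "log_measure a b = density lborel (\<lambda>t. ennreal (indicator {a..b} t / t))"

definition power_curve :: "real \<times> real \<Rightarrow> real \<Rightarrow> real \<times> real" where
  "power_curve \<beta> t = (t powr fst \<beta>, t powr snd \<beta>)"

lemma power_curve_measurable [measurable]: "power_curve \<beta> \<in> borel_measurable borel"
  unfolding power_curve_def borel_prod[symmetric] by measurable

lemma curve_measure_log_measure:
  assumes "0 < a"
  shows "curve_measure (log_measure a b) (power_curve \<beta>)"
proof -
  have "emeasure (log_measure a b) (space (log_measure a b)) = (\<integral>\<^sup>+t. ennreal (indicator {a..b} t / t) \<partial>lborel)"
    by (simp add: log_measure_def emeasure_density)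
  also have "\<dots> \<le> (\<integral>\<^sup>+t. ennreal (1 / a) * indicator {a..b} t \<partial>lborel)"
    using assms by (intro nn_integral_mono) (auto simp: indicator_def intro!: ennreal_leI divide_left_mono)
  also have "\<dots> = ennreal (1 / a) * emeasure lborel {a..b}"
    by (rule nn_integral_cmult_indicator) simp
  also have "\<dots> < \<infinity>"
    by (simp add: emeasure_lborel_Icc_eq ennreal_mult_less_top)
  finally have "finite_measure (log_measure a b)"
    by (intro finite_measureI) simp
  then show ?thesis
    unfolding curve_measure_def curve_measure_axioms_def by (simp add: log_measure_def)
qed

text \<open>In the variable \<open>s = t\<^sup>r\<close> the measure \<open>dt / t\<close> stays logarithmic, and for
\<open>r = \<beta>\<^sub>1\<close> the first coordinate of the curve becomes the parameter.\<close>

lemma nn_integral_log_measure: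
  fixes f :: "real \<Rightarrow> ennreal"
  assumes [measurable]: "f \<in> borel_measurable borel" and r: "0 < r" and ab: "0 < a" "a < b"
  shows "(\<integral>\<^sup>+t. f t \<partial>log_measure (a powr (1 / r)) (b powr (1 / r)))
       = (\<integral>\<^sup>+s. f (s powr (1 / r)) * ennreal (1 / (r * s)) * indicator {a..b} s \<partial>lborel)"
proof -
  define q where "q = 1 / r"
  have "(\<integral>\<^sup>+t. f t \<partial>log_measure (a powr q) (b powr q))
      = (\<integral>\<^sup>+t. ennreal (indicator {a powr q..b powr q} t / t) * f t \<partial>lborel)"
    unfolding log_measure_def by (rule nn_integral_density) measurable
  also have "\<dots> = (\<integral>\<^sup>+t. (f t * ennreal (1 / t)) * indicator {a powr q..b powr q} t \<partial>lborel)"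
    by (intro nn_integral_cong) (auto simp: indicator_def mult.commute)
  also have "\<dots> = (\<integral>\<^sup>+s. (f (s powr q) * ennreal (1 / s powr q)) * ennreal (q * s powr (q - 1)) * indicator {a..b} s \<partial>lborel)"
    using ab r by (intro nn_integral_substitution_aux)
      (auto simp: q_def intro!: derivative_eq_intros continuous_intros)
  also have "\<dots> = (\<integral>\<^sup>+s. f (s powr q) * ennreal (1 / (r * s)) * indicator {a..b} s \<partial>lborel)"
  proof (intro nn_integral_cong)
    fix s
    show "(f (s powr q) * ennreal (1 / s powr q)) * ennreal (q * s powr (q - 1)) * indicator {a..b} s
      = f (s powr q) * ennreal (1 / (r * s)) * indicator {a..b} s"
    proof (cases "s \<in> {a..b}")
      case True
      then have s: "0 < s" using ab by auto
      have "1 / s powr q * (q * s powr (q - 1)) = 1 / (r * s)"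
        using s by (simp add: powr_diff q_def)
      then have "ennreal (1 / s powr q) * ennreal (q * s powr (q - 1)) = ennreal (1 / (r * s))"
        using s r by (subst ennreal_mult[symmetric]) (auto simp: q_def)
      then show ?thesis by (simp add: mult.assoc)
    qed simp
  qed
  finally show ?thesis unfolding q_def .
qed

lemma (in curve_measure) ennreal_curve_avg:
  assumes "bounded_borel f" "\<And>x. (0::real) \<le> f x"
  shows "ennreal (curve_avg M g f x) = (\<integral>\<^sup>+t. ennreal (f (x + g t)) \<partial>M)"
  unfolding curve_avg_def
  by (rule nn_integral_eq_integral[symmetric]) (use assms integrable_along in auto)

text \<open>The range \<open>1/4 \<le> t\<^sup>r \<le> 3\<close> contains all parameters for which the curve leads from the small
box at the origin to \<open>frame_W\<close>, or from \<open>frame_W\<close> to \<open>frame_P\<close>. These boxes are centred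
at \<open>\<gamma>(t\<^sub>1)\<close> and \<open>\<gamma>(t\<^sub>1) + \<gamma>(t\<^sub>2)\<close>, where \<open>t\<^sub>1\<^sup>r = 1\<close> and
\<open>t\<^sub>2\<^sup>r = 2\<close>; two different parameters are needed for the sumset to be open.\<close>

abbreviation unit_log_measure :: "real \<Rightarrow> real measure" where
  "unit_log_measure r \<equiv> log_measure ((1/4) powr (1 / r)) (3 powr (1 / r))"

definition frame_W :: "(real \<times> real) set" where
  "frame_W = cbox (3/4, 3/4) (5/4, 5/4)"

definition frame_P :: "real \<times> real \<Rightarrow> (real \<times> real) set" where
  "frame_P \<beta> = cbox (5/2, 1/2 + 2 powr (snd \<beta> / fst \<beta>)) (7/2, 3/2 + 2 powr (snd \<beta> / fst \<beta>))"

text \<open>It remains to see that \<open>A 1\<^sub>P\<close> is bounded below on \<open>W\<close>, since \<open>P\<close> is larger than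
\<open>W\<close>, and that the sumset bounds the kernel of the double average from below.\<close>

theorem unit_scale_lower_bound:
  fixes \<beta> :: "real \<times> real"
  assumes \<beta>: "0 < fst \<beta>" "fst \<beta> < snd \<beta>"
  obtains \<rho> \<kappa> K where "0 < \<rho>" "\<rho> \<le> 1/8" "0 < \<kappa>" "1 \<le> K"
    "\<And>Q F. Q \<in> sets borel \<Longrightarrow> Q \<subseteq> cbox (-\<rho>, -\<rho>) (\<rho>, \<rho>) \<Longrightarrow> integrable lborel F \<Longrightarrow>
      (\<integral>x. indicator Q x * F x \<partial>lborel) = 0 \<Longrightarrow>
      \<exists>S T u v. (S, T) \<in> {(frame_W, Q), (frame_P \<beta>, frame_W)} \<and> bounded_borel u \<and> bounded_borel v \<and>
        (\<forall>x. cmod (u x) \<le> K * indicator S x) \<and> (\<forall>x. cmod (v x) \<le> K * indicator T x) \<and>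
        \<kappa> * (\<integral>x. indicator Q x * cmod (F x) \<partial>lborel)
          \<le> cmod (curve_measure.comm_form (unit_log_measure (fst \<beta>)) (power_curve \<beta>) F u v)"
proof -
  define M where "M = unit_log_measure (fst \<beta>)"
  define g where "g = power_curve \<beta>"
  interpret curve_measure M g
    unfolding M_def g_def by (rule curve_measure_log_measure) simp
  define p where "p = snd \<beta> / fst \<beta>"
  have p: "1 < p" using \<beta> by (simp add: p_def)
  define G where "G = (\<lambda>s::real. (s, s powr p))"
  have [measurable]: "G \<in> borel_measurable borel"
    unfolding G_def borel_prod[symmetric] by measurable
  have gG: "g (s powr (1 / fst \<beta>)) = G s" if "0 < s" for s
    using that \<beta> by (simp add: g_def power_curve_def G_def powr_powr p_def)
  let ?A = "curve_avg M g" and ?W = frame_W and ?P = "frame_P \<beta>"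
  have P_eq: "?P = cbox (5/2, 1/2 + 2 powr p) (7/2, 3/2 + 2 powr p)" by (simp add: frame_P_def p_def)
  have [measurable]: "?W \<in> sets borel" "?P \<in> sets borel" by (auto simp: frame_W_def frame_P_def)
  define c where "c = 1 / (3 * fst \<beta>)"
  have c: "0 < c" using \<beta> by (simp add: c_def)
  have c_le: "c \<le> 1 / (fst \<beta> * s)" if "0 < s" "s \<le> 3" for s
    using that \<beta> by (simp add: c_def field_simps)
  have along: "(\<integral>\<^sup>+t. f (g t) \<partial>M) = (\<integral>\<^sup>+s. f (G s) * ennreal (1 / (fst \<beta> * s)) * indicator {1/4..3} s \<partial>lborel)"
    if [measurable]: "f \<in> borel_measurable borel" for f :: "real \<times> real \<Rightarrow> ennreal"
  proof -
    have "(\<integral>\<^sup>+t. f (g t) \<partial>M) = (\<integral>\<^sup>+s. f (g (s powr (1 / fst \<beta>))) * ennreal (1 / (fst \<beta> * s)) * indicator {1/4..3} s \<partial>lborel)"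
      unfolding M_def by (rule nn_integral_log_measure) (use \<beta> in \<open>auto simp: g_def\<close>)
    also have "\<dots> = (\<integral>\<^sup>+s. f (G s) * ennreal (1 / (fst \<beta> * s)) * indicator {1/4..3} s \<partial>lborel)"
      by (intro nn_integral_cong) (auto simp: indicator_def gG)
    finally show ?thesis .
  qed
  have along_ge: "ennreal c * (\<integral>\<^sup>+s. f (G s) * indicator {\<alpha>..\<omega>} s \<partial>lborel) \<le> (\<integral>\<^sup>+t. f (g t) \<partial>M)"
    if [measurable]: "f \<in> borel_measurable borel" and "1/4 \<le> \<alpha>" "\<omega> \<le> 3" for f :: "real \<times> real \<Rightarrow> ennreal" and \<alpha> \<omega>
  proof -
    have "ennreal c * (\<integral>\<^sup>+s. f (G s) * indicator {\<alpha>..\<omega>} s \<partial>lborel) = (\<integral>\<^sup>+s. f (G s) * (ennreal c * indicator {\<alpha>..\<omega>} s) \<partial>lborel)"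
      by (subst nn_integral_cmult[symmetric]) (auto simp: ac_simps)
    also have "\<dots> \<le> (\<integral>\<^sup>+s. f (G s) * (ennreal (1 / (fst \<beta> * s)) * indicator {1/4..3} s) \<partial>lborel)"
      using that c_le by (intro nn_integral_mono mult_left_mono) (auto simp: indicator_def intro!: ennreal_leI)
    finally show ?thesis by (simp add: along mult.assoc)
  qed
  (* For parameters this close to 1 and 2 the curve moves Q into W and W into P. *)
  obtain \<eta> where \<eta>: "0 < \<eta>" "\<eta> \<le> 1/8" "\<And>s. \<bar>s - 1\<bar> \<le> \<eta> \<Longrightarrow> \<bar>s powr p - 1\<bar> \<le> 1/8"
      "\<And>s. \<bar>s - 2\<bar> \<le> \<eta> \<Longrightarrow> \<bar>s powr p - 2 powr p\<bar> \<le> 1/4"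
  proof -
    have C: "isCont (\<lambda>s. s powr p) a" if "0 < a" for a :: real
      using that by (auto intro!: continuous_intros)
    obtain e1 where "0 < e1" "\<And>s. \<bar>s - 1\<bar> < e1 \<Longrightarrow> \<bar>s powr p - 1 powr p\<bar> < 1/8"
      using C[of 1, unfolded continuous_at_eps_delta dist_real_def, rule_format, of "1/8"] by auto
    moreover obtain e2 where "0 < e2" "\<And>s. \<bar>s - 2\<bar> < e2 \<Longrightarrow> \<bar>s powr p - 2 powr p\<bar> < 1/4"
      using C[of 2, unfolded continuous_at_eps_delta dist_real_def, rule_format, of "1/4"] by auto
    ultimately  show ?thesis by (intro that[of "min (1/8) (min (e1 / 2) (e2 / 2))"]) (auto intro!: less_imp_le)
  qed
  obtain \<rho> K where \<rho>: "0 < \<rho>" "\<rho> \<le> 1/8" "0 < K" and sumset: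
    "\<And>x \<theta>. \<theta> \<in> borel_measurable borel \<Longrightarrow> \<bar>fst x\<bar> \<le> \<rho> \<Longrightarrow> \<bar>snd x\<bar> \<le> \<rho> \<Longrightarrow>
      (\<integral>\<^sup>+z. \<theta> z * indicator (cbox (3 - \<rho>, 1 + 2 powr p - \<rho>) (3 + \<rho>, 1 + 2 powr p + \<rho>)) z \<partial>lborel)
      \<le> ennreal K * (\<integral>\<^sup>+t. \<integral>\<^sup>+s. \<theta> (x + (s + t, s powr p + t powr p))
           * indicator {1 - \<eta>..1 + \<eta>} s * indicator {2 - \<eta>..2 + \<eta>} t \<partial>lborel \<partial>lborel)"
    by (rule sumset_of_power_curve[OF p \<eta>(1)]) (use \<eta>(2) in \<open>simp, blast\<close>)
  define m where "m = measure M UNIV"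
  define d where "d = 2 * c * \<eta>"
  have d: "0 < d" using c \<eta> by (simp add: d_def)
  have bW: "bounded_borel (indicator ?W :: _ \<Rightarrow> real)" and bP: "bounded_borel (indicator ?P :: _ \<Rightarrow> real)"
    by (auto intro: bounded_borel_indicator)
  have DP: "d \<le> ?A (indicator ?P) y" if y: "y \<in> ?W" for y
  proof -
    have "ennreal d = ennreal c * (\<integral>\<^sup>+s. indicator {2 - \<eta>..2 + \<eta>} s \<partial>lborel)"
      using c \<eta> by (simp add: d_def ennreal_mult[symmetric] mult.commute)
    also have "\<dots> \<le> ennreal c * (\<integral>\<^sup>+s. ennreal (indicator ?P (y + G s)) * indicator {2 - \<eta>..2 + \<eta>} s \<partial>lborel)"
    proof (intro mult_left_mono nn_integral_mono)
      fix s
      show "indicator {2 - \<eta>..2 + \<eta>} s \<le> ennreal (indicator ?P (y + G s)) * indicator {2 - \<eta>..2 + \<eta>} s"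
      proof (cases "\<bar>s - 2\<bar> \<le> \<eta>")
        case True
        then have "y + G s \<in> ?P"
          using \<eta>(2) \<eta>(4)[OF True] y unfolding abs_le_iff P_eq frame_W_def G_def by (cases y) (auto simp: cbox_Pair_eq)
        then show ?thesis by simp
      qed (auto simp: indicator_def abs_le_iff)
    qed auto
    also have "\<dots> \<le> (\<integral>\<^sup>+t. ennreal (indicator ?P (y + g t)) \<partial>M)"
      using \<eta> by (intro along_ge) auto
    also have "\<dots> = ennreal (?A (indicator ?P) y)"
      by (rule ennreal_curve_avg[OF bP, symmetric]) simp
    finally show ?thesis
      by (subst (asm) ennreal_le_iff) (auto intro: curve_avg_nonneg)
  qed
  have DP_le: "?A (indicator ?P) y \<le> m" for y
    using curve_avg_le[of "indicator ?P :: _ \<Rightarrow> real" 1 y] by (auto simp: m_def indicator_def abs_le_iff)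
  have m: "0 < m"
    using DP[of "(1, 1)"] DP_le[of "(1, 1)"] d by (simp add: frame_W_def cbox_Pair_eq)
  let ?P\<^sub>0 = "cbox (3 - \<rho>, 1 + 2 powr p - \<rho>) (3 + \<rho>, 1 + 2 powr p + \<rho>)"
  have P0: "?P\<^sub>0 \<subseteq> ?P" using \<rho> by (auto simp: P_eq cbox_Pair_eq)
  have int_P0: "integrable lborel (indicator ?P\<^sub>0 :: _ \<Rightarrow> real)"
    using emeasure_lborel_cbox_finite by (intro integrable_real_indicator) auto
  define \<kappa> where "\<kappa> = c * c / (K * m)"
  have \<kappa>: "0 < \<kappa>" using c \<rho>(3) m by (simp add: \<kappa>_def)
  have minor: "\<kappa> * (\<integral>z. \<theta> z * indicator ?P\<^sub>0 z \<partial>lborel)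
       \<le> ?A (\<lambda>y. indicator ?W y * ?A (\<lambda>z. indicator ?P z * \<theta> z) y / ?A (indicator ?P) y) x"
    if x: "\<bar>fst x\<bar> \<le> \<rho>" "\<bar>snd x\<bar> \<le> \<rho>" and \<theta>: "bounded_borel \<theta>" "\<And>z. 0 \<le> \<theta> z" for x \<theta>
  proof -
    have [measurable]: "\<theta> \<in> borel_measurable borel" using \<theta>(1) by auto
    define f where "f = (\<lambda>z. indicator ?P z * \<theta> z)"
    have f: "bounded_borel f" "0 \<le> f z" for z
      using \<theta> unfolding f_def by (auto intro!: bounded_borel_mult bP)
    have [measurable]: "f \<in> borel_measurable borel" using f(1) by auto
    define X where "X = (\<integral>z. \<theta> z * indicator ?P\<^sub>0 z \<partial>lborel)"
    define Y where "Y = ?A (\<lambda>y. indicator ?W y * ?A f y) x"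
    have Wf: "bounded_borel (\<lambda>y. indicator ?W y * ?A f y)" "0 \<le> indicator ?W y * ?A f y" for y
      by (auto intro!: bounded_borel_mult bW bounded_borel_curve_avg f curve_avg_nonneg mult_nonneg_nonneg)
    have X0: "0 \<le> X" and Y0: "0 \<le> Y"
      unfolding X_def Y_def using \<theta> Wf by (auto intro!: integral_nonneg_AE curve_avg_nonneg)
    have "integrable lborel (\<lambda>z. \<theta> z * indicator ?P\<^sub>0 z)"
      by (intro integrable_bounded_borel_mult \<theta> int_P0)
    then have "ennreal X = (\<integral>\<^sup>+z. ennreal (\<theta> z * indicator ?P\<^sub>0 z) \<partial>lborel)"
      unfolding X_def using \<theta> by (intro nn_integral_eq_integral[symmetric]) auto
    also have "\<dots> = (\<integral>\<^sup>+z. ennreal (f z) * indicator ?P\<^sub>0 z \<partial>lborel)"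
      using P0 by (intro nn_integral_cong) (auto simp: f_def indicator_def)
    also have "\<dots> \<le> ennreal K * (\<integral>\<^sup>+t. \<integral>\<^sup>+s. ennreal (f (x + (s + t, s powr p + t powr p)))
           * indicator {1 - \<eta>..1 + \<eta>} s * indicator {2 - \<eta>..2 + \<eta>} t \<partial>lborel \<partial>lborel)"
      by (rule sumset[OF _ x]) measurable
    also have "\<dots> = ennreal K * (\<integral>\<^sup>+s. \<integral>\<^sup>+t. ennreal (f (x + G s + G t))
           * indicator {1 - \<eta>..1 + \<eta>} s * indicator {2 - \<eta>..2 + \<eta>} t \<partial>lborel \<partial>lborel)"
      by (subst lborel_pair.Fubini') (auto simp: G_def add.assoc)
    finally have XK: "ennreal X \<le> ennreal K * (\<integral>\<^sup>+s. \<integral>\<^sup>+t. ennreal (f (x + G s + G t))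
           * indicator {1 - \<eta>..1 + \<eta>} s * indicator {2 - \<eta>..2 + \<eta>} t \<partial>lborel \<partial>lborel)" .
    have "ennreal (c * c) * (\<integral>\<^sup>+s. \<integral>\<^sup>+t. ennreal (f (x + G s + G t))
           * indicator {1 - \<eta>..1 + \<eta>} s * indicator {2 - \<eta>..2 + \<eta>} t \<partial>lborel \<partial>lborel)
         = ennreal c * (\<integral>\<^sup>+s. ennreal c * (\<integral>\<^sup>+t. ennreal (f (x + G s + G t)) * indicator {2 - \<eta>..2 + \<eta>} t \<partial>lborel)
            * indicator {1 - \<eta>..1 + \<eta>} s \<partial>lborel)"
    proof -
      have "(\<integral>\<^sup>+s. ennreal c * (\<integral>\<^sup>+t. ennreal (f (x + G s + G t)) * indicator {2 - \<eta>..2 + \<eta>} t \<partial>lborel)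
            * indicator {1 - \<eta>..1 + \<eta>} s \<partial>lborel)
        = ennreal c * (\<integral>\<^sup>+s. (\<integral>\<^sup>+t. ennreal (f (x + G s + G t)) * indicator {2 - \<eta>..2 + \<eta>} t \<partial>lborel)
            * indicator {1 - \<eta>..1 + \<eta>} s \<partial>lborel)"
        unfolding mult.assoc by (rule nn_integral_cmult) measurable
      also have "\<dots> = ennreal c * (\<integral>\<^sup>+s. \<integral>\<^sup>+t. ennreal (f (x + G s + G t))
           * indicator {1 - \<eta>..1 + \<eta>} s * indicator {2 - \<eta>..2 + \<eta>} t \<partial>lborel \<partial>lborel)"
        by (subst nn_integral_multc[symmetric]) (auto simp: ac_simps)
      finally show ?thesis using c by (simp add: ennreal_mult mult.assoc)
    qed
    also have "\<dots> \<le> ennreal c * (\<integral>\<^sup>+s. ennreal (indicator ?W (x + G s) * ?A f (x + G s)) * indicator {1 - \<eta>..1 + \<eta>} s \<partial>lborel)"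
    proof (intro mult_left_mono nn_integral_mono)
      fix s
      show "ennreal c * (\<integral>\<^sup>+t. ennreal (f (x + G s + G t)) * indicator {2 - \<eta>..2 + \<eta>} t \<partial>lborel) * indicator {1 - \<eta>..1 + \<eta>} s
        \<le> ennreal (indicator ?W (x + G s) * ?A f (x + G s)) * indicator {1 - \<eta>..1 + \<eta>} s"
      proof (cases "\<bar>s - 1\<bar> \<le> \<eta>")
        case True
        then have "x + G s \<in> ?W"
          using \<eta>(2) \<eta>(3)[OF True] x \<rho>(2) unfolding abs_le_iff frame_W_def G_def by (cases x) (auto simp: cbox_Pair_eq)
        moreover have "ennreal c * (\<integral>\<^sup>+t. ennreal (f (x + G s + G t)) * indicator {2 - \<eta>..2 + \<eta>} t \<partial>lborel) \<le> ennreal (?A f (x + G s))"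
          unfolding ennreal_curve_avg[OF f] using \<eta> by (intro along_ge) auto
        ultimately show ?thesis by (intro mult_right_mono) auto
      qed (auto simp: indicator_def abs_le_iff)
    qed auto
    also have "\<dots> \<le> ennreal Y"
      unfolding Y_def ennreal_curve_avg[OF Wf] using \<eta> curve_avg_measurable[of f] by (intro along_ge) auto
    finally have "ennreal K * (ennreal (c * c) * (\<integral>\<^sup>+s. \<integral>\<^sup>+t. ennreal (f (x + G s + G t))
           * indicator {1 - \<eta>..1 + \<eta>} s * indicator {2 - \<eta>..2 + \<eta>} t \<partial>lborel \<partial>lborel)) \<le> ennreal K * ennreal Y"
      by (rule mult_left_mono) simp
    with mult_left_mono[OF XK, of "ennreal (c * c)"] have "ennreal (c * c) * ennreal X \<le> ennreal K * ennreal Y"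
      by (simp add: mult.left_commute)
    then have XY: "c * c * X \<le> K * Y"
      using X0 Y0 c \<rho>(3) by (simp add: ennreal_mult[symmetric] ennreal_le_iff)
    have "?A (\<lambda>y. (1 / m) * (indicator ?W y * ?A f y)) x \<le> ?A (\<lambda>y. indicator ?W y * ?A f y / ?A (indicator ?P) y) x"
    proof (rule curve_avg_mono)
      show "bounded_borel (\<lambda>y. (1 / m) * (indicator ?W y * ?A f y))"
        by (intro bounded_borel_mult Wf bounded_borel_const)
      show "bounded_borel (\<lambda>y. indicator ?W y * ?A f y / ?A (indicator ?P) y)"
        by (rule bounded_borel_ratio[of _ _ d]) (auto intro: bounded_borel_curve_avg f curve_avg_measurable DP d)
      fix y
      show "(1 / m) * (indicator ?W y * ?A f y) \<le> indicator ?W y * ?A f y / ?A (indicator ?P) y"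
        using DP[of y] DP_le[of y] d m Wf(2)[of y]
        by (cases "y \<in> ?W") (auto intro!: divide_left_mono)
    qed
    then have "Y / m \<le> ?A (\<lambda>y. indicator ?W y * ?A f y / ?A (indicator ?P) y) x"
      by (subst (asm) curve_avg_cmult) (simp add: Y_def)
    moreover have "\<kappa> * X \<le> Y / m"
      using XY m \<rho>(3) by (simp add: \<kappa>_def field_simps)
    ultimately show ?thesis by (simp add: X_def f_def)
  qed
  have vol: "measure lborel ?P\<^sub>0 = 4 * \<rho> * \<rho>"
    using \<rho>(1) by (simp add: content_Pair)
  show ?thesis
  proof (rule that[of \<rho> "\<kappa> * (4 * \<rho> * \<rho>) / 4" "max 1 (m / d)"])
    fix Q :: "(real \<times> real) set" and F :: "real \<times> real \<Rightarrow> complex"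
    assume Q [measurable]: "Q \<in> sets borel" and Qs: "Q \<subseteq> cbox (-\<rho>, -\<rho>) (\<rho>, \<rho>)"
      and F: "integrable lborel F" "(\<integral>x. indicator Q x * F x \<partial>lborel) = 0"
    have x: "\<bar>fst x\<bar> \<le> \<rho>" "\<bar>snd x\<bar> \<le> \<rho>" if "x \<in> Q" for x
      using that Qs by (cases x; force simp: cbox_Pair_eq)+
    show "\<exists>S T u v. (S, T) \<in> {(?W, Q), (?P, ?W)} \<and> bounded_borel u \<and> bounded_borel v \<and>
        (\<forall>x. cmod (u x) \<le> max 1 (m / d) * indicator S x) \<and> (\<forall>x. cmod (v x) \<le> max 1 (m / d) * indicator T x) \<and>
        \<kappa> * (4 * \<rho> * \<rho>) / 4 * (\<integral>x. indicator Q x * cmod (F x) \<partial>lborel)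
          \<le> cmod (curve_measure.comm_form (unit_log_measure (fst \<beta>)) (power_curve \<beta>) F u v)"
    proof -
      obtain S T u v where "(S, T) \<in> {(?W, Q), (?P, ?W)}" "bounded_borel u" "bounded_borel v"
        "\<And>x. cmod (u x) \<le> max 1 (m / d) * indicator S x" "\<And>x. cmod (v x) \<le> max 1 (m / d) * indicator T x"
        "\<kappa> * measure lborel ?P\<^sub>0 * (\<integral>x. indicator Q x * cmod (F x) \<partial>lborel) \<le> 4 * cmod (comm_form F u v)"
        unfolding m_def
      proof (rule comm_form_lower_bound[OF F(1) Q _ _ _ int_P0 F(2) d DP])
        fix y :: "real \<times> real" and \<theta> :: "real \<times> real \<Rightarrow> real"
        assume "y \<in> Q" "bounded_borel \<theta>" "\<And>z. 0 \<le> \<theta> z"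
        then show "\<kappa> * (\<integral>z. \<theta> z * indicator ?P\<^sub>0 z \<partial>lborel)
          \<le> ?A (\<lambda>y. indicator ?W y * ?A (\<lambda>z. indicator ?P z * \<theta> z) y / ?A (indicator ?P) y) y"
          by (intro minor x)
      qed auto
      then show ?thesis
        unfolding vol M_def[symmetric] g_def[symmetric]
        by (intro exI[of _ S] exI[of _ T] exI[of _ u] exI[of _ v] conjI allI) (assumption | simp)+
    qed
  qed (use \<rho> \<kappa> in auto)
qed

section \<open>The Hilbert transform in rescaled coordinates\<close>

lemma lebesgue_integral_of_AE_eq:
  fixes H h :: "'a::euclidean_space \<Rightarrow> 'b::euclidean_space"
  assumes h: "integrable lborel h" and eq: "AE x in lborel. H x = h x"
  shows "integrable lebesgue H" "(\<integral>x. H x \<partial>lebesgue) = (\<integral>x. h x \<partial>lborel)"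
proof -
  have [measurable]: "h \<in> borel_measurable borel" using h by auto
  have AE: "AE x in lebesgue. h x = H x" using AE_completion[OF eq] by eventually_elim simp
  have hl: "integrable lebesgue h" using h by (simp add: integrable_completion)
  have H: "H \<in> borel_measurable lebesgue"
    by (rule borel_measurable_AE[OF _ AE]) (use hl in auto)
  show "integrable lebesgue H"
    by (rule integrable_cong_AE_imp[OF hl H]) (use AE in eventually_elim, simp)
  have "(\<integral>x. H x \<partial>lebesgue) = (\<integral>x. h x \<partial>lebesgue)"
    by (rule integral_cong_AE[OF H]) (use hl AE in \<open>auto elim: eventually_mono\<close>)
  then show "(\<integral>x. H x \<partial>lebesgue) = (\<integral>x. h x \<partial>lborel)"
    by (simp add: integral_completion)
qed

lemma ex_borel_AE_eq:
  fixes f :: "'a::euclidean_space \<Rightarrow> complex"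
  assumes "f \<in> borel_measurable lebesgue"
  obtains h where "h \<in> borel_measurable borel" "AE x in lborel. f x = h x"
proof -
  have "(\<lambda>x. Re (f x)) \<in> borel_measurable lebesgue" "(\<lambda>x. Im (f x)) \<in> borel_measurable lebesgue"
    using assms by measurable
  then obtain r i where [measurable]: "r \<in> borel_measurable lborel" "i \<in> borel_measurable lborel"
    and AE: "AE x in lborel. Re (f x) = r x" "AE x in lborel. Im (f x) = i x"
    using completion_ex_borel_measurable_real by metis
  show ?thesis
  proof (rule that[of "\<lambda>x. of_real (r x) + \<i> * of_real (i x)"])
    show "(\<lambda>x. of_real (r x) + \<i> * of_real (i x)) \<in> borel_measurable borel"
      by measurable
    show "AE x in lborel. f x = of_real (r x) + \<i> * of_real (i x)"
      using AE by eventually_elim (auto simp: complex_eq_iff)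
  qed
qed

text \<open>The assumption \<open>backward\<close> says that the branch \<open>t \<le> 0\<close> stays out of the open quadrant that
contains the other branch. The reflection by \<open>\<epsilon>\<close> in \<open>to_frame\<close>, together with
a change of sign, lets the displacement \<open>- \<gamma> t\<close>, \<open>t > 0\<close>, point into the positive quadrant.\<close>

locale curve_frame =
  fixes \<beta> :: "real \<times> real" and \<gamma> :: "real \<Rightarrow> real \<times> real" and \<epsilon> c :: "real \<times> real" and L :: real
  assumes \<beta>: "0 < fst \<beta>" "fst \<beta> < snd \<beta>" and \<epsilon>: "\<epsilon> \<in> {-1, 1} \<times> {-1, 1}" and L: "0 < L"
    and forward: "\<And>t. 0 < t \<Longrightarrow> \<gamma> t = (fst \<epsilon> * t powr fst \<beta>, snd \<epsilon> * t powr snd \<beta>)"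
    and backward: "\<And>t. t \<le> 0 \<Longrightarrow> fst \<epsilon> * fst (\<gamma> t) \<le> 0 \<or> snd \<epsilon> * snd (\<gamma> t) \<le> 0"
begin

definition from_frame :: "real \<times> real \<Rightarrow> real \<times> real" where
  "from_frame u = (fst c - fst \<epsilon> * L powr fst \<beta> * fst u, snd c - snd \<epsilon> * L powr snd \<beta> * snd u)"

definition to_frame :: "real \<times> real \<Rightarrow> real \<times> real" where
  "to_frame x = (fst \<epsilon> * (fst c - fst x) / L powr fst \<beta>, snd \<epsilon> * (snd c - snd x) / L powr snd \<beta>)"

definition jac :: real where
  "jac = L powr fst \<beta> * L powr snd \<beta>"

lemma eps_cases: "fst \<epsilon> = 1 \<or> fst \<epsilon> = -1" "snd \<epsilon> = 1 \<or> snd \<epsilon> = -1"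
  using \<epsilon> by auto

lemma eps_sq: "fst \<epsilon> * fst \<epsilon> = 1" "snd \<epsilon> * snd \<epsilon> = 1" "fst \<epsilon> * (fst \<epsilon> * a) = a" "snd \<epsilon> * (snd \<epsilon> * a) = a"
  using eps_cases by auto

lemma jac_pos: "0 < jac" using L by (simp add: jac_def)

lemma to_from_frame [simp]: "to_frame (from_frame u) = u"
  using L by (simp add: to_frame_def from_frame_def eps_sq mult.assoc)

lemma from_to_frame [simp]: "from_frame (to_frame x) = x"
  using L by (simp add: to_frame_def from_frame_def eps_sq mult.assoc prod_eq_iff)

lemma from_frame_measurable [measurable]: "from_frame \<in> borel_measurable borel"
  and to_frame_measurable [measurable]: "to_frame \<in> borel_measurable borel"
  unfolding from_frame_def to_frame_def by (intro borel_measurable_continuous_onI continuous_intros; use L in force)+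

lemma to_frame_curve:
  assumes "0 < t"
  shows "to_frame (x - \<gamma> (L * t)) = to_frame x + power_curve \<beta> t"
  using assms L by (simp add: to_frame_def forward power_curve_def powr_mult prod_eq_iff field_simps eps_sq)

lemma to_frame_translate:
  "fst (to_frame (x - \<gamma> t)) = fst (to_frame x) + fst \<epsilon> * fst (\<gamma> t) / L powr fst \<beta>"
  "snd (to_frame (x - \<gamma> t)) = snd (to_frame x) + snd \<epsilon> * snd (\<gamma> t) / L powr snd \<beta>"
  by (simp_all add: to_frame_def algebra_simps add_divide_distrib diff_divide_distrib)

lemma lborel_frame: "lborel = density (distr lborel borel from_frame) (\<lambda>_. ennreal jac)"
proof -
  define k where "k = (\<lambda>j::real \<times> real. if j = (1, 0) then - fst \<epsilon> * L powr fst \<beta> else - snd \<epsilon> * L powr snd \<beta>)"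
  have B: "Basis = {(1, 0), (0, 1) :: real \<times> real}"
    by (auto simp: Basis_prod_def)
  have "k j \<noteq> 0" for j
    using L eps_cases by (auto simp: k_def)
  then have "lborel = density (distr lborel borel (\<lambda>x. c + (\<Sum>j\<in>Basis. (k j * (x \<bullet> j)) *\<^sub>R j))) (\<lambda>_. (\<Prod>j\<in>Basis. \<bar>k j\<bar>))"
    by (intro lborel_affine_euclidean)
  moreover have "(\<lambda>x. c + (\<Sum>j\<in>Basis. (k j * (x \<bullet> j)) *\<^sub>R j)) = from_frame"
    by (auto simp: fun_eq_iff B k_def from_frame_def prod_eq_iff)
  moreover have "(\<Prod>j\<in>Basis. \<bar>k j\<bar>) = jac"
    using eps_cases by (auto simp: B k_def jac_def abs_mult)
  ultimately show ?thesis by simp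
qed

lemma AE_to_frame:
  assumes "AE y in lborel. R y"
  shows "AE x in lborel. R (to_frame x)"
proof -
  obtain N where N: "N \<in> null_sets lborel" "{y \<in> space lborel. \<not> R y} \<subseteq> N"
    using assms unfolding eventually_ae_filter by blast
  have [measurable]: "N \<in> sets borel" using N by auto
  have "AE y in lborel. to_frame (from_frame y) \<notin> N"
    using AE_not_in[OF N(1)] by simp
  then have "AE x in distr lborel borel from_frame. to_frame x \<notin> N"
    by (subst AE_distr_iff) measurable
  then have "AE x in lborel. to_frame x \<notin> N"
    by (subst lborel_frame, subst AE_density) auto
  then show ?thesis
    by (rule eventually_mono) (use N(2) in auto)
qed

lemma integral_frame:
  fixes h :: "real \<times> real \<Rightarrow> 'b::{banach, second_countable_topology}"
  assumes [measurable]: "h \<in> borel_measurable borel"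
  shows "integrable lborel (\<lambda>x. h (to_frame x)) \<longleftrightarrow> integrable lborel h"
    and "(\<integral>x. h (to_frame x) \<partial>lborel) = jac *\<^sub>R (\<integral>y. h y \<partial>lborel)"
proof -
  have "(\<lambda>x. h (to_frame x)) \<in> borel_measurable borel" by measurable
  then have m: "(\<lambda>x. h (to_frame x)) \<in> borel_measurable (distr lborel borel from_frame)" by simp
  have j: "(\<lambda>_. jac) \<in> borel_measurable (distr lborel borel from_frame)" "AE x in distr lborel borel from_frame. 0 \<le> jac"
    using jac_pos by auto
  show "(\<integral>x. h (to_frame x) \<partial>lborel) = jac *\<^sub>R (\<integral>y. h y \<partial>lborel)"
    by (subst lborel_frame, subst integral_density[OF m j]) (simp add: integral_distr)
  have "integrable lborel (\<lambda>x. jac *\<^sub>R h x) \<longleftrightarrow> integrable lborel h"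
    using integrable_scaleR_right[of jac lborel h] integrable_scaleR_right[of "1 / jac" lborel "\<lambda>x. jac *\<^sub>R h x"] jac_pos
    by auto
  then show "integrable lborel (\<lambda>x. h (to_frame x)) \<longleftrightarrow> integrable lborel h"
    by (subst lborel_frame, subst integrable_density[OF m j]) (simp add: integrable_distr_eq)
qed

abbreviation M where "M \<equiv> unit_log_measure (fst \<beta>)"
abbreviation g where "g \<equiv> power_curve \<beta>"

sublocale curve_measure M g
  by (rule curve_measure_log_measure) simp

text \<open>If a displacement \<open>- \<gamma> t\<close> leads from \<open>y\<close> to a point of \<open>S\<close>, then \<open>t > 0\<close> and
\<open>t / L\<close> lies in the support of the logarithmic measure.\<close>

definition ahead :: "(real \<times> real) set \<Rightarrow> real \<times> real \<Rightarrow> bool" where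
  "ahead S y \<longleftrightarrow> (\<forall>z\<in>S. fst z - fst y \<in> {1/4..3} \<and> snd y < snd z)"

text \<open>The integrand vanishes near \<open>t = 0\<close>, so the truncations are eventually constant. The function
\<open>G\<close> is a Borel version of \<open>f\<close> in the rescaled coordinates; the dilation by \<open>L\<close> leaves
\<open>dt / t\<close> invariant.\<close>

lemma hilbert_along_frame:
  assumes S: "ahead S y" and f0: "\<And>x. to_frame x \<notin> S \<Longrightarrow> f x = 0"
    and N: "N \<in> sets borel" "AE t in M. y + g t \<notin> N" "\<And>z. z \<notin> N \<Longrightarrow> f (from_frame z) = G z"
    and G [measurable]: "G \<in> borel_measurable borel" "integrable M (\<lambda>t. G (y + g t))"
  shows "hilbert_along_exists \<gamma> f (from_frame y)" "hilbert_along \<gamma> f (from_frame y) = curve_avg M g G y"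
proof -
  note [measurable] = N(1)
  define a b where ab: "a = (1/4) powr (1 / fst \<beta>)" "b = 3 powr (1 / fst \<beta>)"
  have a: "0 < a" by (simp add: ab)
  have M: "M = density lborel (\<lambda>t. ennreal (indicator {a..b} t / t))"
    by (simp add: log_measure_def ab)
  define x where "x = from_frame y"
  have y: "y = to_frame x" by (simp add: x_def)
  define k where "k = (\<lambda>t. f (x - \<gamma> t) / of_real t)"
  define e\<^sub>0 where "e\<^sub>0 = (\<lambda>s. (indicator {a..b} s / s) *\<^sub>R G (y + g s))"
  define k\<^sub>0 where "k\<^sub>0 = (\<lambda>t. (1 / L) *\<^sub>R e\<^sub>0 (0 + (1 / L) * t))"
  have e_meas [measurable]: "e\<^sub>0 \<in> borel_measurable borel"
    unfolding e\<^sub>0_def by measurable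
  have e: "integrable lborel e\<^sub>0" "(\<integral>s. e\<^sub>0 s \<partial>lborel) = curve_avg M g G y"
  proof -
    have pos: "AE s in lborel. 0 \<le> indicator {a..b} s / s"
      using a by (auto simp: indicator_def)
    have m: "(\<lambda>t. G (y + g t)) \<in> borel_measurable lborel" "(\<lambda>s. indicator {a..b} s / s) \<in> borel_measurable lborel"
      by measurable
    show "integrable lborel e\<^sub>0" using G(2) unfolding M e\<^sub>0_def integrable_density[OF m pos] .
    show "(\<integral>s. e\<^sub>0 s \<partial>lborel) = curve_avg M g G y"
      unfolding curve_avg_def M e\<^sub>0_def integral_density[OF m pos] ..
  qed
  have k0: "integrable lborel k\<^sub>0" "(\<integral>t. k\<^sub>0 t \<partial>lborel) = curve_avg M g G y"
    using lborel_integrable_real_affine[OF e(1), of "1 / L" 0] lborel_integral_real_affine[of "1 / L" e\<^sub>0 0] L e(2)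
    by (simp_all add: k\<^sub>0_def)
  have out: "k t = 0" if "t \<notin> {L * a..L * b}" for t
  proof -
    have "to_frame (x - \<gamma> t) \<notin> S"
    proof
      assume "to_frame (x - \<gamma> t) \<in> S"
      with S have d: "fst \<epsilon> * fst (\<gamma> t) / L powr fst \<beta> \<in> {1/4..3}" "0 < snd \<epsilon> * snd (\<gamma> t) / L powr snd \<beta>"
        unfolding ahead_def y by (auto simp: to_frame_translate)
      then have "0 < fst \<epsilon> * fst (\<gamma> t) / L powr fst \<beta>" "0 < snd \<epsilon> * snd (\<gamma> t) / L powr snd \<beta>"
        unfolding atLeastAtMost_iff by linarith+
      then have "0 < fst \<epsilon> * fst (\<gamma> t)" "0 < snd \<epsilon> * snd (\<gamma> t)"
        using L by (simp_all only: zero_less_divide_iff powr_gt_zero) auto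
      then have t: "0 < t" using backward[of t] by force
      define s where "s = t / L"
      have s: "0 < s" "t = L * s" using t L by (auto simp: s_def)
      have "fst \<epsilon> * fst (\<gamma> t) / L powr fst \<beta> = s powr fst \<beta>"
        using t L by (simp add: forward eps_sq s_def powr_divide)
      with d have d': "1/4 \<le> s powr fst \<beta>" "s powr fst \<beta> \<le> 3" by auto
      have "(s powr fst \<beta>) powr (1 / fst \<beta>) = s" using s \<beta> by (simp add: powr_powr)
      then have "a \<le> s" "s \<le> b"
        using powr_mono2[OF _ _ d'(1), of "1 / fst \<beta>"] powr_mono2[OF _ _ d'(2), of "1 / fst \<beta>"] \<beta> by (auto simp: ab)
      with that s L show False by simp
    qed
    then show ?thesis by (simp add: k_def f0)
  qed
  have AE1: "AE s in lborel. s \<in> {a..b} \<longrightarrow> y + g s \<notin> N"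
  proof -
    have "AE s in density lborel (\<lambda>t. ennreal (indicator {a..b} t / t)). y + g s \<notin> N"
      using N(2) by (simp only: M)
    then have "AE s in lborel. 0 < ennreal (indicator {a..b} s / s) \<longrightarrow> y + g s \<notin> N"
      by (subst (asm) AE_density) auto
    then show ?thesis by eventually_elim (use a in auto)
  qed
  have "AE t in lborel. 0 + (1 / L) * t \<in> {a..b} \<longrightarrow> y + g (0 + (1 / L) * t) \<notin> N"
    by (rule AE_borel_affine[OF _ _ AE1]) (use L in auto)
  then have AE2: "AE t in lborel. k t = k\<^sub>0 t"
  proof eventually_elim
    case (elim t)
    show ?case
    proof (cases "t \<in> {L * a..L * b}")
      case True
      then have t: "t / L \<in> {a..b}" using L by (auto simp: field_simps)
      have "0 < t" using True mult_pos_pos[OF L a] unfolding atLeastAtMost_iff by linarith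
      have "x - \<gamma> t = from_frame (y + g (t / L))"
        using to_frame_curve[of "t / L" x] \<open>0 < t\<close> L by (simp add: y) (metis from_to_frame)
      then have "f (x - \<gamma> t) = G (y + g (t / L))"
        using elim t N(3) by simp
      then show ?thesis using t L by (simp add: k_def k\<^sub>0_def e\<^sub>0_def scaleR_conv_of_real)
    next
      case False
      then have "t / L \<notin> {a..b}" using L by (auto simp: field_simps)
      then show ?thesis using out[OF False] by (simp add: k\<^sub>0_def e\<^sub>0_def)
    qed
  qed
  have abs_int: "set_integrable lebesgue {t. e < \<bar>t\<bar>} k" for e :: real
    unfolding set_integrable_def
  proof (rule lebesgue_integral_of_AE_eq(1))
    have [measurable]: "{t. e < \<bar>t\<bar>} \<in> sets borel" by measurable
    show "integrable lborel (\<lambda>t. indicator {t. e < \<bar>t\<bar>} t *\<^sub>R k\<^sub>0 t)"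
      using k0(1) by (intro integrable_mult_indicator) auto
    show "AE t in lborel. indicator {t. e < \<bar>t\<bar>} t *\<^sub>R k t = indicator {t. e < \<bar>t\<bar>} t *\<^sub>R k\<^sub>0 t"
      using AE2 by eventually_elim simp
  qed
  have trunc: "hilbert_truncated \<gamma> f x e = curve_avg M g G y" if "e < L * a" for e
  proof -
    have "indicator {t. e < \<bar>t\<bar>} t *\<^sub>R k t = k t" for t
    proof (cases "e < \<bar>t\<bar>")
      case False
      with that have "t < L * a" by linarith
      then show ?thesis using out[of t] by simp
    qed simp
    then have "hilbert_truncated \<gamma> f x e = (\<integral>t. k t \<partial>lebesgue)"
      unfolding hilbert_truncated_def set_lebesgue_integral_def k_def[symmetric] by simp
    also have "\<dots> = curve_avg M g G y"
      using lebesgue_integral_of_AE_eq(2)[OF k0(1) AE2] k0(2) by simp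
    finally show ?thesis .
  qed
  have "eventually (\<lambda>e. hilbert_truncated \<gamma> f x e = curve_avg M g G y) (at_right 0)"
    using order_tendstoD(2)[OF tendsto_ident_at mult_pos_pos[OF L a]]
    by (rule eventually_mono) (rule trunc)
  then have lim: "(hilbert_truncated \<gamma> f x \<longlongrightarrow> curve_avg M g G y) (at_right 0)"
    by (rule tendsto_eventually)
  show "hilbert_along \<gamma> f (from_frame y) = curve_avg M g G y"
    unfolding hilbert_along_def x_def[symmetric]
    by (rule tendsto_Lim[OF _ lim]) (simp add: trivial_limit_at_right_real)
  show "hilbert_along_exists \<gamma> f (from_frame y)"
    unfolding hilbert_along_exists_def x_def[symmetric] using lim abs_int by (auto simp: k_def)
qed

text \<open>The constant \<open>k\<close> is free because constants commute with \<open>H\<^sub>\<gamma>\<close>; it will be a mean of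
\<open>b\<close>, over \<open>Q\<close> for the lower bound and over \<open>\<Lambda>\<^sup>\<beta> Q\<close> for the upper bound.\<close>

theorem pairing_eq_comm_form:
  assumes ahead: "\<And>y. y \<in> T \<Longrightarrow> ahead S y"
    and u: "bounded_borel u" "\<And>z. z \<notin> S \<Longrightarrow> u z = 0"
    and v: "bounded_borel v" "\<And>z. z \<notin> T \<Longrightarrow> v z = 0"
    and F: "integrable lborel F" "AE z in lborel. z \<in> S \<union> T \<longrightarrow> b (from_frame z) = F z + k"
  shows "commutator_pairing_defined \<gamma> b (\<lambda>x. u (to_frame x)) (\<lambda>x. v (to_frame x))"
    and "pairing (commutator b (hilbert_along \<gamma>) (\<lambda>x. u (to_frame x))) (\<lambda>x. v (to_frame x))
      = of_real jac * comm_form F u v"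
proof -
  have [measurable]: "u \<in> borel_measurable borel" "v \<in> borel_measurable borel" "F \<in> borel_measurable borel"
    using u v F by auto
  obtain N where N: "N \<in> null_sets lborel" "{z \<in> space lborel. \<not> (z \<in> S \<union> T \<longrightarrow> b (from_frame z) = F z + k)} \<subseteq> N"
    using F(2) unfolding eventually_ae_filter by blast
  have N_borel: "N \<in> sets borel" using N(1) by auto
  have bF: "b (from_frame z) = F z + k" if "z \<notin> N" "z \<in> S \<union> T" for z
    using that N(2) by auto
  define \<psi> \<phi> where "\<psi> = (\<lambda>x. u (to_frame x))" "\<phi> = (\<lambda>x. v (to_frame x))"
  define G where "G = (\<lambda>z. u z * F z)"
  have G: "integrable lborel G" unfolding G_def by (rule integrable_bounded_borel_mult[OF F(1) u(1)])
  have [measurable]: "G \<in> borel_measurable borel" using G by auto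
  define X where "X = (\<lambda>y. v y * F y * curve_avg M g u y - v y * curve_avg M g G y)"
  have Xi: "integrable lborel (\<lambda>y. v y * F y * curve_avg M g u y)" "integrable lborel (\<lambda>y. v y * curve_avg M g G y)"
  proof -
    have "integrable lborel (\<lambda>y. (v y * curve_avg M g u y) * F y)"
      by (intro integrable_bounded_borel_mult F bounded_borel_mult v bounded_borel_curve_avg u)
    then show "integrable lborel (\<lambda>y. v y * F y * curve_avg M g u y)" by (simp add: ac_simps)
    show "integrable lborel (\<lambda>y. v y * curve_avg M g G y)"
      by (rule curve_avg_duality(1)[OF G v(1)])
  qed
  have X_int: "integrable lborel X" unfolding X_def using Xi by simp
  have [measurable]: "X \<in> borel_measurable borel" using X_int by auto
  have "(\<integral>y. X y \<partial>lborel) = (\<integral>y. v y * F y * curve_avg M g u y \<partial>lborel) - (\<integral>y. G y * curve_avg M (\<lambda>t. - g t) v y \<partial>lborel)"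
    unfolding X_def using Xi curve_avg_duality(2)[OF G v(1)] by simp
  then have X_form: "(\<integral>y. X y \<partial>lborel) = comm_form F u v"
    by (simp add: comm_form_def G_def)
  have point: "hilbert_along_exists \<gamma> \<psi> x \<and> hilbert_along_exists \<gamma> (\<lambda>y. b y * \<psi> y) x \<and>
      commutator b (hilbert_along \<gamma>) \<psi> x * \<phi> x = X y"
    if y: "y = to_frame x" "y \<in> T" "y \<notin> N" "AE t in M. y + g t \<notin> N" "integrable M (\<lambda>t. G (y + g t))" for x y
  proof -
    have x: "x = from_frame y" by (simp add: y(1))
    note ah = ahead[OF y(2)]
    have int_u: "integrable M (\<lambda>t. u (y + g t))" by (rule integrable_along[OF u(1)])
    have h1: "hilbert_along_exists \<gamma> \<psi> x" "hilbert_along \<gamma> \<psi> x = curve_avg M g u y"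
      unfolding x by (rule hilbert_along_frame[OF ah, of _ "{}" u]; use u int_u in \<open>simp add: \<psi>_\<phi>_def\<close>)+
    have Gk: "integrable M (\<lambda>t. G (y + g t) + k * u (y + g t))"
      using y(5) int_u by simp
    have bu: "b (from_frame z) * \<psi> (from_frame z) = G z + k * u z" if "z \<notin> N" for z
      using bF[OF that] u(2)[of z] by (cases "z \<in> S") (auto simp: \<psi>_\<phi>_def G_def algebra_simps)
    have h2: "hilbert_along_exists \<gamma> (\<lambda>y. b y * \<psi> y) x"
      "hilbert_along \<gamma> (\<lambda>y. b y * \<psi> y) x = curve_avg M g (\<lambda>z. G z + k * u z) y"
      unfolding x by (rule hilbert_along_frame[OF ah _ N_borel y(4) bu _ Gk]; use u(2) in \<open>simp add: \<psi>_\<phi>_def\<close>)+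
    have "curve_avg M g (\<lambda>z. G z + k * u z) y = curve_avg M g G y + k * curve_avg M g u y"
      unfolding curve_avg_def using y(5) int_u by simp
    moreover have "b x = F y + k" unfolding x by (rule bF[OF y(3)]) (use y(2) in simp)
    ultimately have "commutator b (hilbert_along \<gamma>) \<psi> x * \<phi> x = X y"
      unfolding commutator_def h1 h2 by (simp add: X_def \<psi>_\<phi>_def y(1) algebra_simps)
    with h1(1) h2(1) show ?thesis by blast
  qed
  have AE: "AE y in lborel. y \<notin> N \<and> (AE t in M. y + g t \<notin> N) \<and> integrable M (\<lambda>t. G (y + g t))"
    using AE_not_in[OF N(1)] AE_along[OF AE_not_in[OF N(1)]] AE_integrable_along[OF G] by eventually_elim blast
  have AEx: "AE x in lborel. (\<phi> x \<noteq> 0 \<longrightarrow> hilbert_along_exists \<gamma> \<psi> x \<and> hilbert_along_exists \<gamma> (\<lambda>y. b y * \<psi> y) x) \<and>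
      commutator b (hilbert_along \<gamma>) \<psi> x * \<phi> x = X (to_frame x)"
    using AE_to_frame[OF AE]
  proof eventually_elim
    case (elim x)
    show ?case
    proof (cases "to_frame x \<in> T")
      case True
      then show ?thesis using point[OF refl True] elim by blast
    next
      case False
      then show ?thesis using v(2)[OF False] by (simp add: \<psi>_\<phi>_def X_def)
    qed
  qed
  have XI: "integrable lborel (\<lambda>x. X (to_frame x))" using X_int by (simp add: integral_frame(1))
  have eq: "AE x in lborel. commutator b (hilbert_along \<gamma>) \<psi> x * \<phi> x = X (to_frame x)"
    using AEx by eventually_elim blast
  note L = lebesgue_integral_of_AE_eq[OF XI eq]
  have "AE x in lebesgue. \<phi> x \<noteq> 0 \<longrightarrow> hilbert_along_exists \<gamma> \<psi> x \<and> hilbert_along_exists \<gamma> (\<lambda>y. b y * \<psi> y) x"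
    using AE_completion[OF AEx] by eventually_elim blast
  with L(1) show "commutator_pairing_defined \<gamma> b (\<lambda>x. u (to_frame x)) (\<lambda>x. v (to_frame x))"
    unfolding commutator_pairing_defined_def \<psi>_\<phi>_def by blast
  show "pairing (commutator b (hilbert_along \<gamma>) (\<lambda>x. u (to_frame x))) (\<lambda>x. v (to_frame x))
      = of_real jac * comm_form F u v"
    using L(2) unfolding pairing_def \<psi>_\<phi>_def[symmetric] by (simp add: integral_frame(2) X_form scaleR_conv_of_real)
qed

end

section \<open>Box-like sets\<close>

text \<open>A \<open>\<gamma>\<close>-cube may contain any part of its boundary. Everything that matters about it, namely centre,
measure and dilates, is already determined by lying between an open box and its closure.\<close>

definition boxlike :: "(real \<times> real) set \<Rightarrow> real \<times> real \<Rightarrow> real \<times> real \<Rightarrow> bool" where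
  "boxlike S m h \<longleftrightarrow> 0 < fst h \<and> 0 < snd h \<and> box (m - h) (m + h) \<subseteq> S \<and> S \<subseteq> cbox (m - h) (m + h)"

lemma mem_centred_box:
  "x \<in> box (m - h) (m + h) \<longleftrightarrow> \<bar>fst x - fst m\<bar> < fst h \<and> \<bar>snd x - snd m\<bar> < snd h"
  "x \<in> cbox (m - h) (m + h) \<longleftrightarrow> \<bar>fst x - fst m\<bar> \<le> fst h \<and> \<bar>snd x - snd m\<bar> \<le> snd h"
  for x m h :: "real \<times> real"
  by (cases x; cases m; cases h; auto simp: box_def cbox_Pair_eq Basis_prod_def abs_le_iff abs_less_iff)+

lemma boxlike_cbox: "0 < fst h \<Longrightarrow> 0 < snd h \<Longrightarrow> boxlike (cbox (m - h) (m + h)) m h"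
  by (simp add: boxlike_def box_subset_cbox)

lemma Inf_Sup_between:
  fixes I :: "real set"
  assumes "a < b" "{a<..<b} \<subseteq> I" "I \<subseteq> {a..b}"
  shows "Inf I = a" "Sup I = b"
proof -
  have ne: "I \<noteq> {}" using assms dense[of a b] by auto
  have bd: "bdd_below I" "bdd_above I" using assms(3) by (auto intro: bdd_below_mono bdd_above_mono)
  show "Inf I = a"
  proof (rule antisym)
    show "Inf I \<le> a"
      using cInf_superset_mono[of "{a<..<b}" I] assms bd dense[of a b] by auto
    show "a \<le> Inf I" using assms(3) by (intro cInf_greatest ne) auto
  qed
  show "Sup I = b"
  proof (rule antisym)
    show "b \<le> Sup I"
      using cSup_subset_mono[of "{a<..<b}" I] assms bd dense[of a b] by auto
    show "Sup I \<le> b" using assms(3) by (intro cSup_least ne) auto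
  qed
qed

lemma boxlike_centre:
  assumes "boxlike S m h"
  shows "centre S = m"
proof -
  have h: "0 < fst h" "0 < snd h"
    and sub: "box (m - h) (m + h) \<subseteq> S" "S \<subseteq> cbox (m - h) (m + h)" using assms by (auto simp: boxlike_def)
  have "{fst m - fst h<..<fst m + fst h} \<subseteq> fst ` S"
  proof
    fix t assume "t \<in> {fst m - fst h<..<fst m + fst h}"
    then have "(t, snd m) \<in> S" using h by (intro subsetD[OF sub(1)]) (auto simp: mem_centred_box abs_less_iff)
    then show "t \<in> fst ` S" by force
  qed
  moreover have "fst ` S \<subseteq> {fst m - fst h..fst m + fst h}"
    using sub(2) by (force simp: mem_centred_box[abs_def] abs_le_iff subset_iff)
  moreover have "{snd m - snd h<..<snd m + snd h} \<subseteq> snd ` S"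
  proof
    fix t assume "t \<in> {snd m - snd h<..<snd m + snd h}"
    then have "(fst m, t) \<in> S" using h by (intro subsetD[OF sub(1)]) (auto simp: mem_centred_box abs_less_iff)
    then show "t \<in> snd ` S" by force
  qed
  moreover have "snd ` S \<subseteq> {snd m - snd h..snd m + snd h}"
    using sub(2) by (force simp: mem_centred_box[abs_def] abs_le_iff subset_iff)
  ultimately show ?thesis
    using Inf_Sup_between[of "fst m - fst h" "fst m + fst h" "fst ` S"]
      Inf_Sup_between[of "snd m - snd h" "snd m + snd h" "snd ` S"] h
    by (auto simp: centre_def midpoint_def)
qed

lemma boxlike_bounded: "boxlike S m h \<Longrightarrow> bounded S"
  unfolding boxlike_def using bounded_cbox bounded_subset by blast

lemma boxlike_measure:
  assumes "boxlike S m h"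
  shows "measure lebesgue S = 4 * fst h * snd h"
proof -
  have h: "0 < fst h" "0 < snd h" 
    and sub: "box (m - h) (m + h) \<subseteq> S" "S \<subseteq> cbox (m - h) (m + h)" using assms by (auto simp: boxlike_def)
  have "negligible (cbox (m - h) (m + h) - box (m - h) (m + h))"
    by (rule negligible_frontier_interval)
  then have n: "negligible (S - cbox (m - h) (m + h) \<union> (cbox (m - h) (m + h) - S))"
    by (rule negligible_subset) (use sub in auto)
  have "measure lebesgue S = measure lebesgue (cbox (m - h) (m + h))"
    using measure_negligible_symdiff[OF lmeasurable_cbox, of "m - h" "m + h" S] n by (simp add: Un_commute)
  also have "\<dots> = 4 * fst h * snd h"
    using h by (cases m; cases h) (simp add: content_Pair)
  finally show ?thesis .
qed

lemma dilate_eq_vimage: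
  assumes "0 < r"
  shows "dilate \<beta> r S = {y. centre S + scale \<beta> (1 / r) (y - centre S) \<in> S}"
proof -
  have inv: "scale \<beta> (1 / r) (scale \<beta> r x) = x" "scale \<beta> r (scale \<beta> (1 / r) x) = x" for x
    using assms by (simp_all add: scale_def prod_eq_iff powr_divide)
  show ?thesis
  proof (intro equalityI subsetI)
    fix y assume "y \<in> dilate \<beta> r S"
    then show "y \<in> {y. centre S + scale \<beta> (1 / r) (y - centre S) \<in> S}" by (auto simp: dilate_def inv)
  next
    fix y assume "y \<in> {y. centre S + scale \<beta> (1 / r) (y - centre S) \<in> S}"
    then show "y \<in> dilate \<beta> r S"
      unfolding dilate_def by (intro CollectI exI[of _ "centre S + scale \<beta> (1 / r) (y - centre S)"]) (auto simp: inv)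
  qed
qed

lemma dilate_borel:
  assumes "0 < r" "S \<in> sets borel"
  shows "dilate \<beta> r S \<in> sets borel"
proof -
  have "(\<lambda>y. centre S + scale \<beta> (1 / r) (y - centre S)) \<in> borel_measurable borel"
    unfolding scale_def by (intro borel_measurable_continuous_onI continuous_intros)
  from measurable_sets[OF this assms(2)] show ?thesis
    by (simp add: dilate_eq_vimage[OF assms(1)] vimage_def)
qed

lemma boxlike_dilate:
  assumes S: "boxlike S m h" and r: "0 < r"
  shows "boxlike (dilate \<beta> r S) m (scale \<beta> r h)"
proof -
  have m: "centre S = m" by (rule boxlike_centre[OF S])
  have eq: "\<bar>fst (m + scale \<beta> (1 / r) (y - m)) - fst m\<bar> = \<bar>fst y - fst m\<bar> / r powr fst \<beta>"
    "\<bar>snd (m + scale \<beta> (1 / r) (y - m)) - snd m\<bar> = \<bar>snd y - snd m\<bar> / r powr snd \<beta>" for y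
    using r by (simp_all add: scale_def powr_divide abs_mult)
  have pos: "0 < r powr fst \<beta>" "0 < r powr snd \<beta>" using r by auto
  have "box (m - scale \<beta> r h) (m + scale \<beta> r h) \<subseteq> dilate \<beta> r S"
  proof
    fix y assume "y \<in> box (m - scale \<beta> r h) (m + scale \<beta> r h)"
    then have "m + scale \<beta> (1 / r) (y - m) \<in> box (m - h) (m + h)"
      using pos unfolding mem_centred_box eq by (simp add: scale_def divide_less_eq mult.commute)
    then show "y \<in> dilate \<beta> r S" using S by (auto simp: dilate_eq_vimage[OF r] m boxlike_def)
  qed
  moreover have "dilate \<beta> r S \<subseteq> cbox (m - scale \<beta> r h) (m + scale \<beta> r h)"
  proof
    fix y assume "y \<in> dilate \<beta> r S"
    then have "m + scale \<beta> (1 / r) (y - m) \<in> cbox (m - h) (m + h)"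
      using S by (auto simp: dilate_eq_vimage[OF r] m boxlike_def)
    then show "y \<in> cbox (m - scale \<beta> r h) (m + scale \<beta> r h)"
      using pos unfolding mem_centred_box eq by (simp add: scale_def divide_le_eq mult.commute)
  qed
  ultimately show ?thesis
    using S pos by (simp add: boxlike_def scale_def)
qed

lemma boxlike_disjoint:
  assumes "boxlike S m h" "boxlike S' m' h'" "fst h + fst h' < \<bar>fst m - fst m'\<bar>"
  shows "S \<inter> S' = {}"
proof -
  have False if "x \<in> S" "x \<in> S'" for x
  proof -
    have "\<bar>fst x - fst m\<bar> \<le> fst h" "\<bar>fst x - fst m'\<bar> \<le> fst h'"
      using that assms(1,2) mem_centred_box(2) unfolding boxlike_def by blast+
    then show False using assms(3) by linarith
  qed
  then show ?thesis by blast
qed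

lemma boxlike_subset:
  assumes "boxlike S m h" "boxlike S' m' h'"
    "\<bar>fst m - fst m'\<bar> + fst h' < fst h" "\<bar>snd m - snd m'\<bar> + snd h' < snd h"
  shows "S' \<subseteq> S"
proof
  fix x assume "x \<in> S'"
  then have "x \<in> cbox (m' - h') (m' + h')" using assms(2) by (auto simp: boxlike_def)
  then have "x \<in> box (m - h) (m + h)" using assms(3,4) unfolding mem_centred_box by linarith
  then show "x \<in> S" using assms(1) by (auto simp: boxlike_def)
qed

section \<open>Geometry and oscillation in rescaled coordinates\<close>

context curve_frame
begin

lemma boxlike_from_frame:
  assumes "boxlike X m h"
  shows "boxlike (from_frame ` X) (from_frame m) (scale \<beta> L h)"
proof -
  have pos: "0 < L powr fst \<beta>" "0 < L powr snd \<beta>" using L by auto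
  have ae: "\<bar>fst \<epsilon>\<bar> = 1" "\<bar>snd \<epsilon>\<bar> = 1" using eps_cases by auto
  have d: "\<bar>fst x - fst (from_frame m)\<bar> = L powr fst \<beta> * \<bar>fst (to_frame x) - fst m\<bar>"
    "\<bar>snd x - snd (from_frame m)\<bar> = L powr snd \<beta> * \<bar>snd (to_frame x) - snd m\<bar>" for x
  proof -
    have *: "fst (from_frame (to_frame x)) - fst (from_frame m) = - (fst \<epsilon> * (L powr fst \<beta> * (fst (to_frame x) - fst m)))"
      "snd (from_frame (to_frame x)) - snd (from_frame m) = - (snd \<epsilon> * (L powr snd \<beta> * (snd (to_frame x) - snd m)))"
      unfolding from_frame_def by (simp_all add: algebra_simps)
    show "\<bar>fst x - fst (from_frame m)\<bar> = L powr fst \<beta> * \<bar>fst (to_frame x) - fst m\<bar>"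
      "\<bar>snd x - snd (from_frame m)\<bar> = L powr snd \<beta> * \<bar>snd (to_frame x) - snd m\<bar>"
      using * by (simp_all add: abs_mult ae)
  qed
  have im: "from_frame ` X = {x. to_frame x \<in> X}"
  proof (intro equalityI subsetI)
    fix x assume "x \<in> {x. to_frame x \<in> X}"
    then show "x \<in> from_frame ` X" by (intro image_eqI[where x = "to_frame x"]) auto
  qed auto
  show ?thesis
    unfolding boxlike_def im
  proof (intro conjI subsetI)
    fix x assume "x \<in> box (from_frame m - scale \<beta> L h) (from_frame m + scale \<beta> L h)"
    then have "to_frame x \<in> box (m - h) (m + h)"
      using pos unfolding mem_centred_box d by (simp add: scale_def)
    then show "x \<in> {x. to_frame x \<in> X}" using assms by (auto simp: boxlike_def)
  next
    fix x assume "x \<in> {x. to_frame x \<in> X}"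
    then have "to_frame x \<in> cbox (m - h) (m + h)" using assms by (auto simp: boxlike_def)
    then show "x \<in> cbox (from_frame m - scale \<beta> L h) (from_frame m + scale \<beta> L h)"
      using pos unfolding mem_centred_box d by (simp add: scale_def)
  qed (use assms pos in \<open>auto simp: boxlike_def scale_def\<close>)
qed

lemma from_frame_dist:
  "\<bar>fst (from_frame m) - fst (from_frame m')\<bar> = L powr fst \<beta> * \<bar>fst m - fst m'\<bar>"
  "\<bar>snd (from_frame m) - snd (from_frame m')\<bar> = L powr snd \<beta> * \<bar>snd m - snd m'\<bar>"
proof -
  have ae: "\<bar>fst \<epsilon>\<bar> = 1" "\<bar>snd \<epsilon>\<bar> = 1" using eps_cases by auto
  have *: "fst (from_frame m) - fst (from_frame m') = - (fst \<epsilon> * (L powr fst \<beta> * (fst m - fst m')))"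
      "snd (from_frame m) - snd (from_frame m') = - (snd \<epsilon> * (L powr snd \<beta> * (snd m - snd m')))"
      unfolding from_frame_def by (simp_all add: algebra_simps)
  show "\<bar>fst (from_frame m) - fst (from_frame m')\<bar> = L powr fst \<beta> * \<bar>fst m - fst m'\<bar>"
    "\<bar>snd (from_frame m) - snd (from_frame m')\<bar> = L powr snd \<beta> * \<bar>snd m - snd m'\<bar>"
    unfolding * by (simp_all add: abs_mult ae)
qed

lemma AE_from_frame:
  assumes "AE x in lborel. R x"
  shows "AE y in lborel. R (from_frame y)"
proof -
  obtain N where N: "N \<in> null_sets lborel" "{x \<in> space lborel. \<not> R x} \<subseteq> N"
    using assms unfolding eventually_ae_filter by blast
  have [measurable]: "N \<in> sets borel" using N by auto
  have "AE x in density (distr lborel borel from_frame) (\<lambda>_. ennreal jac). x \<notin> N"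
    unfolding lborel_frame[symmetric] by (rule AE_not_in[OF N(1)])
  then have "AE x in distr lborel borel from_frame. x \<notin> N"
    using jac_pos by (subst (asm) AE_density) auto
  then have "AE y in lborel. from_frame y \<notin> N"
    by (subst (asm) AE_distr_iff) auto
  then show ?thesis
    by (rule eventually_mono) (use N(2) in auto)
qed

text \<open>The functions \<open>F k\<close> are Borel versions of \<open>b - k\<close> in the rescaled coordinates, cut off to the
set \<open>D\<close> so that they are integrable.\<close>

lemma oscillation_in_frame:
  assumes b: "locally_integrable b" and D: "D \<in> sets borel" "bounded D"
  obtains F where "\<And>k. integrable lborel (F k)"
    "\<And>k. AE z in lborel. from_frame z \<in> D \<longrightarrow> b (from_frame z) = F k z + k"
    "\<And>k E. E \<in> sets borel \<Longrightarrow> E \<subseteq> D \<Longrightarrow> (LINT x:E|lebesgue. b x - k) = jac *\<^sub>R (\<integral>z. indicator (from_frame -` E) z * F k z \<partial>lborel)"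
    "\<And>k E. E \<in> sets borel \<Longrightarrow> E \<subseteq> D \<Longrightarrow> (LINT x:E|lebesgue. cmod (b x - k)) = jac * (\<integral>z. indicator (from_frame -` E) z * cmod (F k z) \<partial>lborel)"
proof -
  have pre [measurable]: "from_frame -` E \<in> sets borel" if "E \<in> sets borel" for E
    using measurable_sets[OF from_frame_measurable that] by simp
  obtain r where r: "D \<subseteq> cball 0 r" using D(2) by (auto simp: bounded_iff subset_iff)
  have "set_integrable lebesgue (cball 0 r) b"
    using b by (auto simp: locally_integrable_def)
  then have "set_integrable lebesgue D b"
    by (rule set_integrable_subset) (use D r in auto)
  then have i: "integrable lebesgue (\<lambda>x. indicator D x *\<^sub>R b x)"
    by (simp add: set_integrable_def)
  obtain b' where b': "b' \<in> borel_measurable borel" "AE x in lborel. indicator D x *\<^sub>R b x = b' x"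
    by (rule ex_borel_AE_eq[OF borel_measurable_integrable[OF i]])
  note [measurable] = b'(1)
  have "integrable lebesgue b'"
  proof (rule integrable_cong_AE_imp[OF i])
    show "b' \<in> borel_measurable lebesgue" by (rule measurable_completion) (use b'(1) in simp)
    show "AE x in lebesgue. indicator D x *\<^sub>R b x = b' x"
      by (rule AE_completion[OF b'(2)])
  qed
  then have "integrable lborel b'" by (simp add: integrable_completion)
  define f where "f = (\<lambda>z. b' (from_frame z))"
  have [measurable]: "f \<in> borel_measurable borel" unfolding f_def by measurable
  have f: "integrable lborel f"
    using integral_frame(1)[of f] \<open>integrable lborel b'\<close> by (simp add: f_def)
  define D' where "D' = from_frame -` D"
  have D' [measurable]: "D' \<in> sets borel" unfolding D'_def using D(1) by measurable
  define F where "F = (\<lambda>k z. indicator D' z * (f z - k))"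
  have F: "integrable lborel (F k)" for k
  proof -
    have "integrable lborel (indicator D :: _ \<Rightarrow> real)"
      using D emeasure_bounded_finite[OF D(2)] by (intro integrable_real_indicator) auto
    moreover have "indicator D' (to_frame x) = (indicator D x :: real)" for x
      by (auto simp: D'_def indicator_def)
    ultimately have "integrable lborel (indicator D' :: _ \<Rightarrow> real)"
      using integral_frame(1)[of "indicator D' :: _ \<Rightarrow> real"] by simp
    then have "integrable lborel (\<lambda>z. k * of_real (indicator D' z))"
      by (intro integrable_mult_right integrable_of_real)
    moreover have "integrable lborel (\<lambda>z. indicator D' z * f z)"
      by (intro integrable_bounded_borel_mult f bounded_borel_indicator D')
    ultimately have "integrable lborel (\<lambda>z. indicator D' z * f z - k * of_real (indicator D' z))"
      by (rule Bochner_Integration.integrable_diff[rotated])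
    moreover have "indicator D' z * f z - k * of_real (indicator D' z) = F k z" for z
      by (simp add: F_def indicator_def)
    ultimately show ?thesis by simp
  qed
  show ?thesis
  proof (rule that[of F])
    show "integrable lborel (F k)" for k by (rule F)
    have eq: "AE z in lborel. from_frame z \<in> D \<longrightarrow> b (from_frame z) = f z"
      using AE_from_frame[OF b'(2)] by eventually_elim (auto simp: f_def)
    show "AE z in lborel. from_frame z \<in> D \<longrightarrow> b (from_frame z) = F k z + k" for k
      using eq by eventually_elim (auto simp: F_def D'_def)
    fix k E assume E: "E \<in> sets borel" "E \<subseteq> D"
    have [measurable]: "from_frame -` E \<in> sets borel" by (rule pre[OF E(1)])
    have [measurable]: "F k \<in> borel_measurable borel" using F[of k] by auto
    have EF: "AE x in lborel. x \<in> E \<longrightarrow> b x - k = F k (to_frame x)"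
      using b'(2) by eventually_elim (use E(2) in \<open>auto simp: F_def D'_def f_def\<close>)
    let ?h = "\<lambda>z. indicator (from_frame -` E) z * F k z"
    have h: "integrable lborel ?h"
      by (intro integrable_bounded_borel_mult F bounded_borel_indicator) measurable
    have "AE x in lborel. indicator E x *\<^sub>R (b x - k) = ?h (to_frame x)"
      using EF by eventually_elim (auto simp: indicator_def)
    from lebesgue_integral_of_AE_eq(2)[OF _ this] h integral_frame[of ?h]
    show "(LINT x:E|lebesgue. b x - k) = jac *\<^sub>R (\<integral>z. ?h z \<partial>lborel)"
      unfolding set_lebesgue_integral_def by simp
    let ?h' = "\<lambda>z. indicator (from_frame -` E) z * cmod (F k z)"
    have h': "integrable lborel ?h'"
      by (intro integrable_bounded_borel_mult integrable_norm F bounded_borel_indicator) measurable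
    have "AE x in lborel. indicator E x *\<^sub>R cmod (b x - k) = ?h' (to_frame x)"
      using EF by eventually_elim (auto simp: indicator_def)
    from lebesgue_integral_of_AE_eq(2)[OF _ this] h' integral_frame[of ?h']
    show "(LINT x:E|lebesgue. cmod (b x - k)) = jac * (\<integral>z. ?h' z \<partial>lborel)"
      unfolding set_lebesgue_integral_def by simp
  qed
qed

lemma norm_comm_form_le:
  assumes u: "bounded_borel u" "\<And>x. cmod (u x) \<le> K * indicator S x"
    and v: "bounded_borel v" "\<And>x. cmod (v x) \<le> K * indicator T x"
    and F: "integrable lborel F" and D: "D \<in> sets borel" "S \<subseteq> D" "T \<subseteq> D" and K: "0 \<le> K"
  shows "cmod (comm_form F u v) \<le> 2 * (measure M UNIV * K * K) * (\<integral>z. indicator D z * cmod (F z) \<partial>lborel)"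
proof -
  interpret R: curve_measure M "\<lambda>t. - g t" by (rule reversed)
  have le: "cmod (u x) \<le> K * indicator D x" "cmod (v x) \<le> K * indicator D x" "cmod (u x) \<le> K" "cmod (v x) \<le> K" for x
    using u(2)[of x] v(2)[of x] D(2,3) K by (cases "x \<in> S"; cases "x \<in> T"; force simp: indicator_def)+
  have e: "bounded_borel (\<lambda>x. measure M UNIV * K * K * indicator D x)"
    by (intro bounded_borel_mult bounded_borel_const bounded_borel_indicator D)
  have A: "cmod (curve_avg M g u x) \<le> measure M UNIV * K" "cmod (curve_avg M (\<lambda>t. - g t) v x) \<le> measure M UNIV * K" for x
    using curve_avg_le[of u K x] R.curve_avg_le[of v K x] le u v by auto
  have "cmod (\<integral>x. (v x * curve_avg M g u x) * F x \<partial>lborel) \<le> (\<integral>x. measure M UNIV * K * K * indicator D x * cmod (F x) \<partial>lborel)"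
    by (rule norm_integral_mult_le[OF F e])
      (use mult_mono[OF le(2) A(1)] K in \<open>auto simp: norm_mult ac_simps\<close>)
  moreover have "cmod (\<integral>x. (u x * curve_avg M (\<lambda>t. - g t) v x) * F x \<partial>lborel) \<le> (\<integral>x. measure M UNIV * K * K * indicator D x * cmod (F x) \<partial>lborel)"
    by (rule norm_integral_mult_le[OF F e])
      (use mult_mono[OF le(1) A(2)] K in \<open>auto simp: norm_mult ac_simps\<close>)
  moreover have "comm_form F u v = (\<integral>x. (v x * curve_avg M g u x) * F x \<partial>lborel) - (\<integral>x. (u x * curve_avg M (\<lambda>t. - g t) v x) * F x \<partial>lborel)"
    by (simp add: comm_form_def ac_simps)
  moreover have "(\<integral>x. measure M UNIV * K * K * indicator D x * cmod (F x) \<partial>lborel) = measure M UNIV * K * K * (\<integral>z. indicator D z * cmod (F z) \<partial>lborel)"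
    by (simp add: mult.assoc)
  ultimately show ?thesis
    using norm_triangle_ineq4[of "(\<integral>x. (v x * curve_avg M g u x) * F x \<partial>lborel)" "(\<integral>x. (u x * curve_avg M (\<lambda>t. - g t) v x) * F x \<partial>lborel)"]
    by simp
qed

end

section \<open>The two-sided estimate\<close>

lemma bounded_interval_between:
  fixes I :: "real set"
  assumes I: "is_interval I" "bounded I" "0 < measure lebesgue I"
  obtains a b where "a < b" "{a<..<b} \<subseteq> I" "I \<subseteq> {a..b}" "measure lebesgue I = b - a"
proof -
  have ne: "I \<noteq> {}" using I(3) by auto
  have bd: "bdd_below I" "bdd_above I" using I(2) by (auto intro: bounded_imp_bdd_below bounded_imp_bdd_above)
  define a b where "a = Inf I" "b = Sup I"
  have sub: "I \<subseteq> {a..b}" using bd by (auto simp: a_b_def intro: cInf_lower cSup_upper)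
  have inner: "{a<..<b} \<subseteq> I"
  proof
    fix t assume "t \<in> {a<..<b}"
    then obtain x y where "x \<in> I" "x < t" "y \<in> I" "t < y"
      using cInf_less_iff[OF ne bd(1), of t] less_cSup_iff[OF ne bd(2), of t] by (auto simp: a_b_def)
    then show "t \<in> I" using I(1) by (meson is_interval_1 less_imp_le)
  qed
  have Ib: "I \<in> sets borel" by (rule real_interval_borel_measurable[OF I(1)])
  then have Il: "I \<in> lmeasurable" using bounded_set_imp_lmeasurable[OF I(2)] by auto
  have "a \<le> b" using ne sub by auto
  have 1: "measure lebesgue I \<le> measure lebesgue {a..b}"
    by (rule measure_mono_fmeasurable[OF sub]) (use Il in auto)
  moreover have 2: "measure lebesgue {a<..<b} \<le> measure lebesgue I"
    by (rule measure_mono_fmeasurable[OF inner]) (use Il in auto)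
  ultimately have m: "measure lebesgue I = b - a" using \<open>a \<le> b\<close> by simp
  with I(3) have "a < b" by simp
  then show ?thesis using that inner sub m by blast
qed

lemma gamma_cube_boxlike:
  assumes Q: "Q \<in> gamma_cubes \<beta>" and \<beta>: "0 < fst \<beta>" "0 < snd \<beta>"
  obtains c l where "0 < l" "boxlike Q c (l powr fst \<beta> / 2, l powr snd \<beta> / 2)" "Q \<in> sets borel"
proof -
  obtain I J where IJ: "Q = I \<times> J" "is_interval I" "bounded I" "0 < measure lebesgue I"
     "is_interval J" "bounded J" "0 < measure lebesgue J"
     "measure lebesgue I powr (1 / fst \<beta>) = measure lebesgue J powr (1 / snd \<beta>)"
    using Q by (auto simp: gamma_cubes_def)
  obtain a b where ab: "a < b" "{a<..<b} \<subseteq> I" "I \<subseteq> {a..b}" "measure lebesgue I = b - a"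
    by (rule bounded_interval_between[OF IJ(2-4)])
  obtain a' b' where ab': "a' < b'" "{a'<..<b'} \<subseteq> J" "J \<subseteq> {a'..b'}" "measure lebesgue J = b' - a'"
    by (rule bounded_interval_between[OF IJ(5-7)])
  define l where "l = (b - a) powr (1 / fst \<beta>)"
  have l': "l = (b' - a') powr (1 / snd \<beta>)"
    using IJ(8) unfolding ab(4) ab'(4) l_def .
  have l: "l powr fst \<beta> = b - a" "l powr snd \<beta> = b' - a'"
    using \<beta> ab(1) ab'(1) by (simp add: l_def powr_powr) (use \<beta> ab'(1) in \<open>simp add: l' powr_powr\<close>)
  have h: "x \<in> box (((a + b) / 2, (a' + b') / 2) - ((b - a) / 2, (b' - a') / 2)) (((a + b) / 2, (a' + b') / 2) + ((b - a) / 2, (b' - a') / 2))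
      \<longleftrightarrow> fst x \<in> {a<..<b} \<and> snd x \<in> {a'<..<b'}"
    "x \<in> cbox (((a + b) / 2, (a' + b') / 2) - ((b - a) / 2, (b' - a') / 2)) (((a + b) / 2, (a' + b') / 2) + ((b - a) / 2, (b' - a') / 2))
      \<longleftrightarrow> fst x \<in> {a..b} \<and> snd x \<in> {a'..b'}" for x
    unfolding mem_centred_box fst_conv snd_conv abs_less_iff abs_le_iff by (auto simp: field_simps)
  have "boxlike Q ((a + b) / 2, (a' + b') / 2) ((b - a) / 2, (b' - a') / 2)"
    unfolding boxlike_def
  proof (intro conjI subsetI)
    fix x assume "x \<in> box (((a + b) / 2, (a' + b') / 2) - ((b - a) / 2, (b' - a') / 2)) (((a + b) / 2, (a' + b') / 2) + ((b - a) / 2, (b' - a') / 2))"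
    then show "x \<in> Q" unfolding h IJ(1) using ab(2) ab'(2) by (cases x) auto
  next
    fix x assume "x \<in> Q"
    then show "x \<in> cbox (((a + b) / 2, (a' + b') / 2) - ((b - a) / 2, (b' - a') / 2)) (((a + b) / 2, (a' + b') / 2) + ((b - a) / 2, (b' - a') / 2))"
      unfolding h IJ(1) using ab(3) ab'(3) by (cases x) auto
  qed (use ab(1) ab'(1) in auto)
  moreover have "Q \<in> sets borel"
    unfolding IJ(1) borel_prod[symmetric]
    by (intro pair_measureI real_interval_borel_measurable IJ)
  moreover have "0 < l" using ab(1) by (simp add: l_def)
  ultimately show ?thesis using that[of l "((a + b) / 2, (a' + b') / 2)"] by (simp add: l)
qed

lemma integral_minus_average:
  assumes b: "locally_integrable b" and Q: "Q \<in> sets borel" "bounded Q" "0 < measure lebesgue Q"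
  shows "(LINT x:Q|lebesgue. b x - average Q b) = 0"
proof -
  obtain r where r: "Q \<subseteq> cball 0 r" using Q(2) by (auto simp: bounded_iff subset_iff)
  have "set_integrable lebesgue (cball 0 r) b"
    using b by (auto simp: locally_integrable_def)
  then have i: "set_integrable lebesgue Q b"
    by (rule set_integrable_subset) (use Q r in auto)
  have Ql: "Q \<in> lmeasurable" using bounded_set_imp_lmeasurable[OF Q(2)] Q(1) by auto
  then have e: "Q \<in> sets lebesgue" "emeasure lebesgue Q < \<infinity>" by (auto simp: fmeasurable_def)
  have c: "set_integrable lebesgue Q (\<lambda>x. k)" for k :: complex
    using e by (auto simp: set_integrable_def intro!: integrable_scaleR_left integrable_real_indicator)
  have "(LINT x:Q|lebesgue. k) = measure lebesgue Q *\<^sub>R k" for k :: complex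
    using e by (simp add: set_lebesgue_integral_def)
  then show ?thesis
    using Q(3) by (subst set_integral_diff(2)[OF i c]) (simp add: average_def)
qed

context curve_frame
begin

text \<open>Both bounds concern the same pair of functions. The lower one uses the normalisation of \<open>b\<close> by its mean
over \<open>Q\<close>, the upper one the mean over \<open>D\<close>.\<close>

lemma commutator_sandwich:
  assumes b: "locally_integrable b" and \<kappa>: "0 < \<kappa>" and K: "0 \<le> K"
    and unit: "\<And>F. integrable lborel F \<Longrightarrow> (\<integral>x. indicator (from_frame -` Q) x * F x \<partial>lborel) = 0 \<Longrightarrow>
      \<exists>S T u v. (S, T) \<in> {(W, from_frame -` Q), (P, W)} \<and> bounded_borel u \<and> bounded_borel v \<and>
        (\<forall>x. cmod (u x) \<le> K * indicator S x) \<and> (\<forall>x. cmod (v x) \<le> K * indicator T x) \<and>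
        \<kappa> * (\<integral>x. indicator (from_frame -` Q) x * cmod (F x) \<partial>lborel) \<le> cmod (comm_form F u v)"
    and Q: "Q \<in> sets borel" "0 < measure lebesgue Q"
    and D: "D \<in> sets borel" "bounded D" "Q \<subseteq> D" "from_frame ` W \<subseteq> D" "from_frame ` P \<subseteq> D"
    and ahead: "\<And>y. from_frame y \<in> Q \<Longrightarrow> ahead W y" "\<And>y. y \<in> W \<Longrightarrow> ahead P y"
  obtains S T \<psi> \<phi> where "(S, T) \<in> {(from_frame ` W, Q), (from_frame ` P, from_frame ` W)}"
    "\<psi> \<in> borel_measurable lebesgue" "\<phi> \<in> borel_measurable lebesgue"
    "\<And>x. cmod (\<psi> x) \<le> K * indicator S x" "\<And>x. cmod (\<phi> x) \<le> K * indicator T x"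
    "commutator_pairing_defined \<gamma> b \<psi> \<phi>"
    "average Q (\<lambda>x. cmod (b x - average Q b))
       \<le> 1 / \<kappa> * (1 / measure lebesgue Q * cmod (pairing (commutator b (hilbert_along \<gamma>) \<psi>) \<phi>))"
    "1 / measure lebesgue Q * cmod (pairing (commutator b (hilbert_along \<gamma>) \<psi>) \<phi>)
       \<le> 2 * (measure M UNIV * K * K) * (measure lebesgue D / measure lebesgue Q)
          * average D (\<lambda>x. cmod (b x - average D b))"
proof -
  obtain F where F: "\<And>k. integrable lborel (F k)"
    "\<And>k. AE z in lborel. from_frame z \<in> D \<longrightarrow> b (from_frame z) = F k z + k"
    "\<And>k E. E \<in> sets borel \<Longrightarrow> E \<subseteq> D \<Longrightarrow> (LINT x:E|lebesgue. b x - k) = jac *\<^sub>R (\<integral>z. indicator (from_frame -` E) z * F k z \<partial>lborel)"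
    "\<And>k E. E \<in> sets borel \<Longrightarrow> E \<subseteq> D \<Longrightarrow> (LINT x:E|lebesgue. cmod (b x - k)) = jac * (\<integral>z. indicator (from_frame -` E) z * cmod (F k z) \<partial>lborel)"
    by (rule oscillation_in_frame[OF b D(1,2)]) blast
  define k where "k = average Q b"
  define k' where "k' = average D b"
  have bQ: "bounded Q" using D(2,3) bounded_subset by blast
  have "(\<integral>z. indicator (from_frame -` Q) z * F k z \<partial>lborel) = 0"
    using F(3)[OF Q(1) D(3), of k] integral_minus_average[OF b Q(1) bQ Q(2)] jac_pos by (simp add: k_def)
  then obtain S T u v where ST: "(S, T) \<in> {(W, from_frame -` Q), (P, W)}" and u: "bounded_borel u" and v: "bounded_borel v"
      and uS: "\<And>x. cmod (u x) \<le> K * indicator S x" and vT: "\<And>x. cmod (v x) \<le> K * indicator T x"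
      and lower: "\<kappa> * (\<integral>x. indicator (from_frame -` Q) x * cmod (F k x) \<partial>lborel) \<le> cmod (comm_form (F k) u v)"
    using unit[OF F(1)[of k]] by blast
  have ahead_ST: "ahead S y" if "y \<in> T" for y using ST that ahead by blast
  have u0: "u z = 0" if "z \<notin> S" for z using uS[of z] that by simp
  have v0: "v z = 0" if "z \<notin> T" for z using vT[of z] that by simp
  have sub: "S \<subseteq> from_frame -` D" "T \<subseteq> from_frame -` D" using ST D(3-5) by auto
  have AE: "AE z in lborel. z \<in> S \<union> T \<longrightarrow> b (from_frame z) = F r z + r" for r
    using F(2)[of r] by eventually_elim (use sub in auto)
  let ?\<psi> = "\<lambda>x. u (to_frame x)" and ?\<phi> = "\<lambda>x. v (to_frame x)"
  let ?p = "cmod (pairing (commutator b (hilbert_along \<gamma>) ?\<psi>) ?\<phi>)"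
  have pair: "?p = jac * cmod (comm_form (F r) u v)" for r
    using pairing_eq_comm_form(2)[OF ahead_ST u u0 v v0 F(1) AE, of r] jac_pos by (simp add: norm_mult)
  have im: "from_frame ` (from_frame -` Q) = Q"
    by (rule surj_image_vimage_eq) (rule surjI, rule from_to_frame)
  have ind: "indicator (from_frame ` X) x = (indicator X (to_frame x) :: real)" for X x
  proof -
    have "x \<in> from_frame ` X \<longleftrightarrow> to_frame x \<in> X"
      by (auto intro: image_eqI[where x = "to_frame x"])
    then show ?thesis by (simp add: indicator_def)
  qed
  have Q_D: "Q \<in> sets borel" "Q \<subseteq> D" by (fact Q(1), fact D(3))
  have D_meas: "0 < measure lebesgue D"
  proof -
    have "Q \<in> lmeasurable" "D \<in> lmeasurable"
      by (auto intro!: bounded_set_imp_lmeasurable bQ D(1,2) Q(1))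
    then have "measure lebesgue Q \<le> measure lebesgue D"
      using D(3) by (intro measure_mono_fmeasurable) auto
    with Q(2) show ?thesis by linarith
  qed
  show ?thesis
  proof (rule that[of "from_frame ` S" "from_frame ` T" ?\<psi> ?\<phi>])
    show "(from_frame ` S, from_frame ` T) \<in> {(from_frame ` W, Q), (from_frame ` P, from_frame ` W)}"
      using ST im by auto
    have "?\<psi> \<in> borel_measurable lborel" "?\<phi> \<in> borel_measurable lborel"
      using measurable_compose[OF to_frame_measurable bounded_borel_measurable[OF u]]
        measurable_compose[OF to_frame_measurable bounded_borel_measurable[OF v]] by simp_all
    then show "?\<psi> \<in> borel_measurable lebesgue" "?\<phi> \<in> borel_measurable lebesgue"
      by (auto intro: measurable_completion)
    show "cmod (u (to_frame x)) \<le> K * indicator (from_frame ` S) x" for x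
      unfolding ind by (rule uS)
    show "cmod (v (to_frame x)) \<le> K * indicator (from_frame ` T) x" for x
      unfolding ind by (rule vT)
    show "commutator_pairing_defined \<gamma> b ?\<psi> ?\<phi>"
      by (rule pairing_eq_comm_form(1)[OF ahead_ST u u0 v v0 F(1) AE])
    have "average Q (\<lambda>x. cmod (b x - k)) = 1 / measure lebesgue Q * (jac * (\<integral>x. indicator (from_frame -` Q) x * cmod (F k x) \<partial>lborel))"
      unfolding average_def F(4)[OF Q_D] by simp
    also have "\<dots> \<le> 1 / measure lebesgue Q * (jac * (cmod (comm_form (F k) u v) / \<kappa>))"
      using lower \<kappa> jac_pos Q(2) by (intro mult_left_mono) (auto simp: field_simps)
    also have "\<dots> = 1 / \<kappa> * (1 / measure lebesgue Q * ?p)"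
      unfolding pair[of k] by simp
    finally show "average Q (\<lambda>x. cmod (b x - average Q b)) \<le> 1 / \<kappa> * (1 / measure lebesgue Q * ?p)"
      unfolding k_def .
    have "?p \<le> jac * (2 * (measure M UNIV * K * K) * (\<integral>z. indicator (from_frame -` D) z * cmod (F k' z) \<partial>lborel))"
      unfolding pair[of k'] using jac_pos measurable_sets[OF from_frame_measurable D(1)]
      by (intro mult_left_mono norm_comm_form_le[OF u uS v vT F(1) _ sub K]) auto
    also have "\<dots> = 2 * (measure M UNIV * K * K) * (LINT x:D|lebesgue. cmod (b x - k'))"
      unfolding F(4)[OF D(1) order_refl] by simp
    also have "(LINT x:D|lebesgue. cmod (b x - k')) = measure lebesgue D * average D (\<lambda>x. cmod (b x - k'))"
      using D_meas by (simp add: average_def)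
    finally show "1 / measure lebesgue Q * ?p \<le> 2 * (measure M UNIV * K * K) * (measure lebesgue D / measure lebesgue Q)
          * average D (\<lambda>x. cmod (b x - average D b))"
      using Q(2) by (simp add: k'_def field_simps)
  qed
qed

end

theorem theorem1p18:
  fixes \<beta> :: "real \<times> real" and \<gamma> :: "real \<Rightarrow> real \<times> real"
  assumes "monomial_curve \<beta> \<gamma>"
  shows "\<exists>\<Lambda> lam C :: real. 1 < lam \<and> lam < \<Lambda> \<and> 0 < C \<and>
    (\<forall>b Q. locally_integrable b \<longrightarrow> Q \<in> gamma_cubes \<beta> \<longrightarrow>
      (\<exists>W\<^sub>1 W\<^sub>2 P :: (real \<times> real) set.
        (\<forall>W\<in>{W\<^sub>1, W\<^sub>2, P}. bounded W \<and> connected W) \<and>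
        distinct [Q, W\<^sub>1, W\<^sub>2, P] \<and>
        (\<forall>S\<^sub>1\<in>{Q, W\<^sub>1, W\<^sub>2, P}. \<forall>S\<^sub>2\<in>{Q, W\<^sub>1, W\<^sub>2, P}. S\<^sub>1 \<noteq> S\<^sub>2 \<longrightarrow>
          measure lebesgue S\<^sub>1 \<le> C * measure lebesgue S\<^sub>2 \<and>
          measure lebesgue S\<^sub>2 \<le> C * measure lebesgue S\<^sub>1 \<and>
          dilate \<beta> lam S\<^sub>1 \<inter> S\<^sub>2 = {} \<and>
          S\<^sub>2 \<subseteq> dilate \<beta> \<Lambda> S\<^sub>1) \<and>
        (\<exists>S\<^sub>1\<in>{Q, W\<^sub>1, W\<^sub>2, P}. \<exists>S\<^sub>2\<in>{Q, W\<^sub>1, W\<^sub>2, P}. S\<^sub>1 \<noteq> S\<^sub>2 \<and>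
          (\<exists>\<psi>\<^sub>1 \<psi>\<^sub>2 :: real \<times> real \<Rightarrow> complex.
            \<psi>\<^sub>1 \<in> borel_measurable lebesgue \<and> \<psi>\<^sub>2 \<in> borel_measurable lebesgue \<and>
            (\<forall>x. cmod (\<psi>\<^sub>1 x) \<le> C * indicator S\<^sub>1 x) \<and>
            (\<forall>x. cmod (\<psi>\<^sub>2 x) \<le> C * indicator S\<^sub>2 x) \<and>
            commutator_pairing_defined \<gamma> b \<psi>\<^sub>1 \<psi>\<^sub>2 \<and>
            average Q (\<lambda>x. cmod (b x - average Q b))
              \<le> C * (1 / measure lebesgue Q *
                      cmod (pairing (commutator b (hilbert_along \<gamma>) \<psi>\<^sub>1) \<psi>\<^sub>2)) \<and>
            1 / measure lebesgue Q * cmod (pairing (commutator b (hilbert_along \<gamma>) \<psi>\<^sub>1) \<psi>\<^sub>2)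
              \<le> C * average (dilate \<beta> \<Lambda> Q)
                       (\<lambda>x. cmod (b x - average (dilate \<beta> \<Lambda> Q) b))))))"
proof -
  obtain \<epsilon> \<delta> where \<beta>: "0 < fst \<beta>" "fst \<beta> < snd \<beta>" and \<epsilon>: "\<epsilon> \<in> {-1, 1} \<times> {-1, 1}" and \<delta>: "\<delta> \<in> {-1, 1} \<times> {-1, 1}"
    and ne: "fst \<epsilon> \<noteq> fst \<delta> \<or> snd \<epsilon> \<noteq> snd \<delta>"
    and \<gamma>: "\<And>t. \<gamma> t = (if t > 0
                   then (fst \<epsilon> * \<bar>t\<bar> powr fst \<beta>, snd \<epsilon> * \<bar>t\<bar> powr snd \<beta>)
                   else (fst \<delta> * \<bar>t\<bar> powr fst \<beta>, snd \<delta> * \<bar>t\<bar> powr snd \<beta>))"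
    using assms unfolding monomial_curve_def by blast
  have forward: "\<gamma> t = (fst \<epsilon> * t powr fst \<beta>, snd \<epsilon> * t powr snd \<beta>)" if "0 < t" for t
    using that by (simp add: \<gamma>)
  have opposite: "fst \<epsilon> * fst \<delta> = -1 \<or> snd \<epsilon> * snd \<delta> = -1"
    using ne \<epsilon> \<delta> by auto
  have backward: "fst \<epsilon> * fst (\<gamma> t) \<le> 0 \<or> snd \<epsilon> * snd (\<gamma> t) \<le> 0" if "t \<le> 0" for t
  proof -
    have "fst \<epsilon> * fst (\<gamma> t) = (fst \<epsilon> * fst \<delta>) * \<bar>t\<bar> powr fst \<beta>" "snd \<epsilon> * snd (\<gamma> t) = (snd \<epsilon> * snd \<delta>) * \<bar>t\<bar> powr snd \<beta>"
      using that by (auto simp: \<gamma>)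
    with opposite show ?thesis by (elim disjE) simp_all
  qed
  obtain \<rho> \<kappa> K where \<rho>: "0 < \<rho>" "\<rho> \<le> 1/8" and \<kappa>: "0 < \<kappa>" and K: "1 \<le> K" and unit:
    "\<And>Q F. Q \<in> sets borel \<Longrightarrow> Q \<subseteq> cbox (-\<rho>, -\<rho>) (\<rho>, \<rho>) \<Longrightarrow> integrable lborel F \<Longrightarrow>
      (\<integral>x. indicator Q x * F x \<partial>lborel) = 0 \<Longrightarrow>
      \<exists>S T u v. (S, T) \<in> {(frame_W, Q), (frame_P \<beta>, frame_W)} \<and> bounded_borel u \<and> bounded_borel v \<and>
        (\<forall>x. cmod (u x) \<le> K * indicator S x) \<and> (\<forall>x. cmod (v x) \<le> K * indicator T x) \<and>
        \<kappa> * (\<integral>x. indicator Q x * cmod (F x) \<partial>lborel)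
          \<le> cmod (curve_measure.comm_form (unit_log_measure (fst \<beta>)) (power_curve \<beta>) F u v)"
    by (rule unit_scale_lower_bound[OF \<beta>]) blast
  define p where "p = snd \<beta> / fst \<beta>"
  have p: "1 < p" using \<beta> by (simp add: p_def)
  define v where "v = (2::real) powr p"
  have v: "2 < v" using powr_less_mono[OF p, of 2] by (simp add: v_def)
  (* Q becomes a box with half sides \<rho> and \<rho>' once its side parameter is scaled to q. *)
  define q where "q = (2 * \<rho>) powr (1 / fst \<beta>)"
  have q: "0 < q" "q powr fst \<beta> = 2 * \<rho>" using \<rho> \<beta> by (simp_all add: q_def powr_powr)
  define \<rho>' where "\<rho>' = q powr snd \<beta> / 2"
  have \<rho>': "0 < \<rho>'" "\<rho>' \<le> \<rho>"
  proof -
    show "0 < \<rho>'" using q by (simp add: \<rho>'_def)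
    have "q \<le> 1" using \<rho> \<beta> by (simp add: q_def powr_le1)
    then have "q powr snd \<beta> \<le> q powr fst \<beta>" using q(1) \<beta> by (intro powr_mono') auto
    then show "\<rho>' \<le> \<rho>" by (simp add: \<rho>'_def q(2))
  qed
  (* In the first coordinate the boxes, enlarged by 9/8, are still disjoint; that is enough. *)
  define lam where "lam = (9/8 :: real) powr (1 / fst \<beta>)"
  have lam: "1 < lam" "lam powr fst \<beta> = 9/8" using \<beta> by (simp_all add: lam_def powr_powr gr_one_powr)
  (* The first coordinates of the centres differ by at most 5, the second ones by at most 1 + v, and half
     sides are at most 1/2; the smallest half side is \<rho>'. *)
  define X where "X = (6 + v) / \<rho>' + 2"
  have X: "2 \<le> X" "6 + v < X * \<rho>'" using \<rho>' v by (simp_all add: X_def field_simps)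
  define \<Lambda> where "\<Lambda> = X powr (1 / fst \<beta>)"
  have "lam < \<Lambda>" unfolding lam_def \<Lambda>_def using X(1) \<beta> by (intro powr_less_mono2) auto
  have \<Lambda>: "1 < \<Lambda>" "\<Lambda> powr fst \<beta> = X" "X \<le> \<Lambda> powr snd \<beta>"
  proof -
    show "1 < \<Lambda>" using lam \<open>lam < \<Lambda>\<close> by linarith
    show "\<Lambda> powr fst \<beta> = X" using X(1) \<beta> by (simp add: \<Lambda>_def powr_powr)
    moreover have "\<Lambda> powr fst \<beta> \<le> \<Lambda> powr snd \<beta>" using \<open>1 < \<Lambda>\<close> \<beta> by (intro powr_mono) auto
    ultimately show "X \<le> \<Lambda> powr snd \<beta>" by simp
  qed
  define m where "m = measure (unit_log_measure (fst \<beta>)) UNIV"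
  define C\<^sub>1 where "C\<^sub>1 = 2 * (m * K * K) * (\<Lambda> powr fst \<beta> * \<Lambda> powr snd \<beta>)"
  define C where "C = K + 1 / \<kappa> + C\<^sub>1 + 1 / (4 * \<rho> * \<rho>')"
  have C1: "0 \<le> C\<^sub>1" using K by (simp add: C\<^sub>1_def m_def)
  have C: "K \<le> C" "1 / \<kappa> \<le> C" "C\<^sub>1 \<le> C" "1 / (4 * \<rho> * \<rho>') \<le> C" "0 < C"
  proof -
    have "0 < 1 / \<kappa>" "0 < 1 / (4 * \<rho> * \<rho>')" using \<kappa> \<rho> \<rho>' by auto
    then show "K \<le> C" "1 / \<kappa> \<le> C" "C\<^sub>1 \<le> C" "1 / (4 * \<rho> * \<rho>') \<le> C" "0 < C"
      using K C1 unfolding C_def by linarith+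
  qed
  show ?thesis
  proof (rule exI[of _ \<Lambda>], rule exI[of _ lam], rule exI[of _ C], intro conjI allI impI)
    show "1 < lam" "lam < \<Lambda>" "0 < C" by fact+
  next
    fix b :: "real \<times> real \<Rightarrow> complex" and Q :: "(real \<times> real) set"
    assume b: "locally_integrable b" and "Q \<in> gamma_cubes \<beta>"
    then obtain c l where l: "0 < l" and Qbox: "boxlike Q c (l powr fst \<beta> / 2, l powr snd \<beta> / 2)" and Q: "Q \<in> sets borel"
      by (rule_tac gamma_cube_boxlike) (use \<beta> in auto)
    define L where "L = l / q"
    interpret curve_frame \<beta> \<gamma> \<epsilon> c L
      by unfold_locales (use \<beta> \<epsilon> l q forward backward in \<open>auto simp: L_def\<close>)
    have c: "from_frame 0 = c" by (simp add: from_frame_def)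
    have Lh: "scale \<beta> L (\<rho>, \<rho>') = (l powr fst \<beta> / 2, l powr snd \<beta> / 2)"
      using q l \<rho> by (simp add: scale_def L_def powr_divide \<rho>'_def)
    (* W_2 is put beyond P in the first coordinate, the one that separates the boxes. *)
    define V where "V = cbox ((5::real, 1 + v) - (1/2, 1/2)) ((5, 1 + v) + (1/2, 1/2))"
    define W\<^sub>1 W\<^sub>2 P where W_P_def: "W\<^sub>1 = from_frame ` frame_W" "W\<^sub>2 = from_frame ` V" "P = from_frame ` frame_P \<beta>"
    (* Each set with the centre and the half sides that it has in the rescaled coordinates. *)
    define dat :: "((real \<times> real) set \<times> (real \<times> real) \<times> (real \<times> real)) set" where
      "dat = {(Q, (0, 0), (\<rho>, \<rho>')), (W\<^sub>1, (1, 1), (1/4, 1/4)), (W\<^sub>2, (5, 1 + v), (1/2, 1/2)), (P, (3, 1 + v), (1/2, 1/2))}"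
    have W_eq: "frame_W = cbox ((1, 1) - (1/4, 1/4)) ((1, 1) + (1/4, 1/4))"
      by (simp add: frame_W_def)
    have P_eq: "frame_P \<beta> = cbox ((3, 1 + v) - (1/2, 1/2)) ((3, 1 + v) + (1/2, 1/2))"
      by (simp add: frame_P_def v_def p_def)
    have boxes: "boxlike S (from_frame m) (scale \<beta> L h)" if "(S, m, h) \<in> dat" for S m h
    proof -
      have "boxlike W\<^sub>1 (from_frame (1, 1)) (scale \<beta> L (1/4, 1/4))" "boxlike W\<^sub>2 (from_frame (5, 1 + v)) (scale \<beta> L (1/2, 1/2))"
        "boxlike P (from_frame (3, 1 + v)) (scale \<beta> L (1/2, 1/2))"
        unfolding W_P_def W_eq P_eq V_def by (intro boxlike_from_frame boxlike_cbox; simp)+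
      moreover have "boxlike Q (from_frame (0, 0)) (scale \<beta> L (\<rho>, \<rho>'))"
        using Qbox c Lh by (simp add: zero_prod_def)
      ultimately show ?thesis using that by (auto simp: dat_def)
    qed
    have sizes: "\<rho> \<le> fst h \<and> fst h \<le> 1/2 \<and> \<rho>' \<le> snd h \<and> snd h \<le> 1/2 \<and> 0 \<le> fst m \<and> fst m \<le> 5 \<and> 0 \<le> snd m \<and> snd m \<le> 1 + v"
      if "(S, m, h) \<in> dat" for S m h
      using that \<rho> \<rho>' v by (auto simp: dat_def)
    have apart: "9/8 * fst h + fst h' < \<bar>fst m - fst m'\<bar>" if "(S, m, h) \<in> dat" "(S', m', h') \<in> dat" "S \<noteq> S'" for S m h S' m' h'
      using that \<rho> by (auto simp: dat_def)
    have dat_ex: "\<exists>m h. (S, m, h) \<in> dat" if "S \<in> {Q, W\<^sub>1, W\<^sub>2, P}" for S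
      using that unfolding dat_def by blast
    have Lpos: "0 < L powr fst \<beta>" "0 < L powr snd \<beta>" using L by auto
    have different: "S \<noteq> S'" if "(S, m, h) \<in> dat" "(S', m', h') \<in> dat" "m \<noteq> m'" for S m h S' m' h'
    proof
      assume "S = S'"
      then have "from_frame m = from_frame m'"
        using boxlike_centre[OF boxes[OF that(1)]] boxlike_centre[OF boxes[OF that(2)]] by simp
      then show False using that(3) by (metis to_from_frame)
    qed
    have dist: "distinct [Q, W\<^sub>1, W\<^sub>2, P]"
    proof -
      have "(Q, (0, 0), (\<rho>, \<rho>')) \<in> dat" "(W\<^sub>1, (1, 1), (1/4, 1/4)) \<in> dat" "(W\<^sub>2, (5, 1 + v), (1/2, 1/2)) \<in> dat" "(P, (3, 1 + v), (1/2, 1/2)) \<in> dat"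
        by (simp_all add: dat_def)
      note d = different[OF this(1) this(2)] different[OF this(1) this(3)] different[OF this(1) this(4)]
        different[OF this(2) this(3)] different[OF this(2) this(4)] different[OF this(3) this(4)]
      show ?thesis using d by simp
    qed
    have meas: "measure lebesgue S = 4 * (jac * (fst h * snd h))" if "(S, m, h) \<in> dat" for S m h
      using boxlike_measure[OF boxes[OF that]] by (simp add: scale_def jac_def)
    have measure_le: "measure lebesgue S \<le> C * measure lebesgue S'" if "(S, m, h) \<in> dat" "(S', m', h') \<in> dat" for S m h S' m' h'
    proof -
      have "fst h * snd h \<le> 1/2 * (1/2)" "\<rho> * \<rho>' \<le> fst h' * snd h'"
        using sizes[OF that(1)] sizes[OF that(2)] \<rho> \<rho>' by (intro mult_mono; auto)+
      moreover from this(2) have "1 / (4 * \<rho> * \<rho>') * (\<rho> * \<rho>') \<le> 1 / (4 * \<rho> * \<rho>') * (fst h' * snd h')"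
        using \<rho>(1) \<rho>'(1) by (intro mult_left_mono) auto
      moreover have "1 / (4 * \<rho> * \<rho>') * (\<rho> * \<rho>') = 1/4"
        using \<rho>(1) \<rho>'(1) by simp
      ultimately have "fst h * snd h \<le> 1 / (4 * \<rho> * \<rho>') * (fst h' * snd h')"
        by linarith
      also have "\<dots> \<le> C * (fst h' * snd h')"
        using sizes[OF that(2)] \<rho> \<rho>' C(4) by (intro mult_right_mono) auto
      finally show ?thesis
        using jac_pos by (simp add: meas[OF that(1)] meas[OF that(2)] mult.left_commute[of C])
    qed
    have dilated_disjoint: "dilate \<beta> lam S \<inter> S' = {}" if "(S, m, h) \<in> dat" "(S', m', h') \<in> dat" "S \<noteq> S'" for S m h S' m' h'
    proof (rule boxlike_disjoint[OF boxlike_dilate[OF boxes[OF that(1)]] boxes[OF that(2)]])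
      have "L powr fst \<beta> * (9/8 * fst h + fst h') < L powr fst \<beta> * \<bar>fst m - fst m'\<bar>"
        using apart[OF that] Lpos by (intro mult_strict_left_mono)
      then show "fst (scale \<beta> lam (scale \<beta> L h)) + fst (scale \<beta> L h') < \<bar>fst (from_frame m) - fst (from_frame m')\<bar>"
        by (simp add: from_frame_dist scale_def lam algebra_simps)
    qed (use lam in simp)
    have dilated_covers: "S' \<subseteq> dilate \<beta> \<Lambda> S" if "(S, m, h) \<in> dat" "(S', m', h') \<in> dat" for S m h S' m' h'
    proof (rule boxlike_subset[OF boxlike_dilate[OF boxes[OF that(1)]] boxes[OF that(2)]])
      have s: "X * \<rho>' \<le> \<Lambda> powr fst \<beta> * fst h" "X * \<rho>' \<le> \<Lambda> powr snd \<beta> * snd h"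
        using sizes[OF that(1)] \<rho> \<rho>' X \<Lambda> by (intro mult_mono; simp)+
      have "\<bar>fst m - fst m'\<bar> + fst h' < \<Lambda> powr fst \<beta> * fst h" "\<bar>snd m - snd m'\<bar> + snd h' < \<Lambda> powr snd \<beta> * snd h"
        using s sizes[OF that(1)] sizes[OF that(2)] X(2) v by linarith+
      then have "L powr fst \<beta> * (\<bar>fst m - fst m'\<bar> + fst h') < L powr fst \<beta> * (\<Lambda> powr fst \<beta> * fst h)"
        "L powr snd \<beta> * (\<bar>snd m - snd m'\<bar> + snd h') < L powr snd \<beta> * (\<Lambda> powr snd \<beta> * snd h)"
        using Lpos by (simp_all only: mult_less_cancel_left_pos)
      then show "\<bar>fst (from_frame m) - fst (from_frame m')\<bar> + fst (scale \<beta> L h') < fst (scale \<beta> \<Lambda> (scale \<beta> L h))"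
        "\<bar>snd (from_frame m) - snd (from_frame m')\<bar> + snd (scale \<beta> L h') < snd (scale \<beta> \<Lambda> (scale \<beta> L h))"
        by (simp_all add: from_frame_dist scale_def algebra_simps)
    qed (use \<Lambda> in simp)
    have geometry: "\<forall>S\<^sub>1\<in>{Q, W\<^sub>1, W\<^sub>2, P}. \<forall>S\<^sub>2\<in>{Q, W\<^sub>1, W\<^sub>2, P}. S\<^sub>1 \<noteq> S\<^sub>2 \<longrightarrow>
          measure lebesgue S\<^sub>1 \<le> C * measure lebesgue S\<^sub>2 \<and>
          measure lebesgue S\<^sub>2 \<le> C * measure lebesgue S\<^sub>1 \<and>
          dilate \<beta> lam S\<^sub>1 \<inter> S\<^sub>2 = {} \<and>
          S\<^sub>2 \<subseteq> dilate \<beta> \<Lambda> S\<^sub>1"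
      using dat_ex measure_le dilated_disjoint dilated_covers by meson
    have shape: "\<forall>W\<in>{W\<^sub>1, W\<^sub>2, P}. bounded W \<and> connected W"
    proof -
      have "continuous_on U from_frame" for U
        unfolding from_frame_def by (intro continuous_intros)
      then have "connected (from_frame ` cbox x y)" for x y
        by (intro connected_continuous_image convex_connected convex_box) 
      then have "connected W\<^sub>1" "connected W\<^sub>2" "connected P"
        unfolding W_P_def W_eq P_eq V_def by auto
      moreover have "bounded W" if "W \<in> {W\<^sub>1, W\<^sub>2, P}" for W
        using boxlike_bounded[OF boxes] dat_ex[of W] that by blast
      ultimately show ?thesis by blast
    qed
    let ?D = "dilate \<beta> \<Lambda> Q"
    have datQ: "(Q, (0, 0), (\<rho>, \<rho>')) \<in> dat" and datW: "(W\<^sub>1, (1, 1), (1/4, 1/4)) \<in> dat" and datP: "(P, (3, 1 + v), (1/2, 1/2)) \<in> dat"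
      by (simp_all add: dat_def)
    have Qpos: "0 < measure lebesgue Q"
      using meas[OF datQ] jac_pos \<rho> \<rho>' by simp
    have Q_frame: "\<bar>fst y\<bar> \<le> \<rho>" "\<bar>snd y\<bar> \<le> \<rho>" if "from_frame y \<in> Q" for y
    proof -
      have "from_frame y \<in> cbox (from_frame (0, 0) - scale \<beta> L (\<rho>, \<rho>')) (from_frame (0, 0) + scale \<beta> L (\<rho>, \<rho>'))"
        using that boxes[OF datQ] unfolding boxlike_def by blast
      then show "\<bar>fst y\<bar> \<le> \<rho>" "\<bar>snd y\<bar> \<le> \<rho>"
        using Lpos \<rho>'(2) unfolding mem_centred_box from_frame_dist by (simp_all add: scale_def)
    qed
    have Q'_borel: "from_frame -` Q \<in> sets borel"
      using measurable_sets[OF from_frame_measurable Q] by simp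
    have Q'_small: "from_frame -` Q \<subseteq> cbox (-\<rho>, -\<rho>) (\<rho>, \<rho>)"
    proof
      fix y assume "y \<in> from_frame -` Q"
      then show "y \<in> cbox (-\<rho>, -\<rho>) (\<rho>, \<rho>)" using Q_frame[of y] by (cases y) (auto simp: cbox_Pair_eq)
    qed
    have ahead_Q: "ahead frame_W y" if "from_frame y \<in> Q" for y
      using Q_frame[OF that] \<rho>(2) unfolding ahead_def frame_W_def abs_le_iff by (cases y) (auto simp: cbox_Pair_eq)
    have ahead_W: "ahead (frame_P \<beta>) y" if "y \<in> frame_W" for y
      using that v unfolding ahead_def W_eq P_eq by (cases y) (auto simp: cbox_Pair_eq)
    have unit_Q: "\<exists>S T u v. (S, T) \<in> {(frame_W, from_frame -` Q), (frame_P \<beta>, frame_W)} \<and> bounded_borel u \<and> bounded_borel v \<and>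
        (\<forall>x. cmod (u x) \<le> K * indicator S x) \<and> (\<forall>x. cmod (v x) \<le> K * indicator T x) \<and>
        \<kappa> * (\<integral>x. indicator (from_frame -` Q) x * cmod (F x) \<partial>lborel) \<le> cmod (comm_form F u v)"
      if "integrable lborel F" "(\<integral>x. indicator (from_frame -` Q) x * F x \<partial>lborel) = 0" for F
      using unit[OF Q'_borel Q'_small that] .
    have D: "?D \<in> sets borel" "bounded ?D" "Q \<subseteq> ?D" "from_frame ` frame_W \<subseteq> ?D" "from_frame ` frame_P \<beta> \<subseteq> ?D"
      using dilate_borel[OF _ Q, of \<Lambda> \<beta>] \<Lambda>(1) boxlike_bounded[OF boxlike_dilate[OF boxes[OF datQ], of \<Lambda> \<beta>]]
        dilated_covers[OF datQ datQ] dilated_covers[OF datQ datW] dilated_covers[OF datQ datP] unfolding W_P_def by auto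
    have ratio: "measure lebesgue ?D / measure lebesgue Q = \<Lambda> powr fst \<beta> * \<Lambda> powr snd \<beta>"
      using boxlike_measure[OF boxlike_dilate[OF boxes[OF datQ], of \<Lambda> \<beta>]] boxlike_measure[OF boxes[OF datQ]] \<Lambda>(1) Lpos \<rho>(1) \<rho>'(1)
      by (simp add: scale_def)
    have K0: "0 \<le> K" using K by simp
    obtain S T \<psi> \<phi> where ST: "(S, T) \<in> {(from_frame ` frame_W, Q), (from_frame ` frame_P \<beta>, from_frame ` frame_W)}"
      and \<psi>: "\<psi> \<in> borel_measurable lebesgue" "\<phi> \<in> borel_measurable lebesgue"
      and le: "\<And>x. cmod (\<psi> x) \<le> K * indicator S x" "\<And>x. cmod (\<phi> x) \<le> K * indicator T x"
      and defined: "commutator_pairing_defined \<gamma> b \<psi> \<phi>"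
      and lower: "average Q (\<lambda>x. cmod (b x - average Q b))
         \<le> 1 / \<kappa> * (1 / measure lebesgue Q * cmod (pairing (commutator b (hilbert_along \<gamma>) \<psi>) \<phi>))"
      and upper: "1 / measure lebesgue Q * cmod (pairing (commutator b (hilbert_along \<gamma>) \<psi>) \<phi>)
         \<le> 2 * (measure M UNIV * K * K) * (measure lebesgue ?D / measure lebesgue Q)
            * average ?D (\<lambda>x. cmod (b x - average ?D b))"
      by (rule commutator_sandwich[OF b \<kappa> K0 _ Q Qpos D])
        (erule (1) unit_Q, erule ahead_Q, erule ahead_W, rule that)
    let ?R = "cmod (pairing (commutator b (hilbert_along \<gamma>) \<psi>) \<phi>)"
    have "S = W\<^sub>1 \<and> T = Q \<or> S = P \<and> T = W\<^sub>1"
      using ST unfolding W_P_def by blast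
    moreover have "W\<^sub>1 \<noteq> Q" "P \<noteq> W\<^sub>1"
      using dist by auto
    ultimately have ST_in: "S \<in> {Q, W\<^sub>1, W\<^sub>2, P}" "T \<in> {Q, W\<^sub>1, W\<^sub>2, P}" "S \<noteq> T"
      by blast+
    have le_C: "cmod (\<psi> x) \<le> C * indicator S x" "cmod (\<phi> x) \<le> C * indicator T x" for x
      by (rule order_trans[OF le(1)], rule mult_right_mono[OF C(1)], simp)
        (rule order_trans[OF le(2)], rule mult_right_mono[OF C(1)], simp)
    have "1 / \<kappa> * (1 / measure lebesgue Q * ?R) \<le> C * (1 / measure lebesgue Q * ?R)"
      using C(2) Qpos by (intro mult_right_mono) auto
    with lower have lower_C: "average Q (\<lambda>x. cmod (b x - average Q b)) \<le> C * (1 / measure lebesgue Q * ?R)"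
      by linarith
    have "0 \<le> average ?D (\<lambda>x. cmod (b x - average ?D b))"
      by (auto simp: average_def set_lebesgue_integral_def intro!: mult_nonneg_nonneg integral_nonneg_AE)
    then have "C\<^sub>1 * average ?D (\<lambda>x. cmod (b x - average ?D b)) \<le> C * average ?D (\<lambda>x. cmod (b x - average ?D b))"
      using C(3) by (intro mult_right_mono)
    with upper have upper_C: "1 / measure lebesgue Q * ?R \<le> C * average ?D (\<lambda>x. cmod (b x - average ?D b))"
      unfolding ratio C\<^sub>1_def m_def by linarith
    show "\<exists>W\<^sub>1 W\<^sub>2 P :: (real \<times> real) set.
        (\<forall>W\<in>{W\<^sub>1, W\<^sub>2, P}. bounded W \<and> connected W) \<and>
        distinct [Q, W\<^sub>1, W\<^sub>2, P] \<and>
        (\<forall>S\<^sub>1\<in>{Q, W\<^sub>1, W\<^sub>2, P}. \<forall>S\<^sub>2\<in>{Q, W\<^sub>1, W\<^sub>2, P}. S\<^sub>1 \<noteq> S\<^sub>2 \<longrightarrow>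
          measure lebesgue S\<^sub>1 \<le> C * measure lebesgue S\<^sub>2 \<and>
          measure lebesgue S\<^sub>2 \<le> C * measure lebesgue S\<^sub>1 \<and>
          dilate \<beta> lam S\<^sub>1 \<inter> S\<^sub>2 = {} \<and>
          S\<^sub>2 \<subseteq> dilate \<beta> \<Lambda> S\<^sub>1) \<and>
        (\<exists>S\<^sub>1\<in>{Q, W\<^sub>1, W\<^sub>2, P}. \<exists>S\<^sub>2\<in>{Q, W\<^sub>1, W\<^sub>2, P}. S\<^sub>1 \<noteq> S\<^sub>2 \<and>
          (\<exists>\<psi>\<^sub>1 \<psi>\<^sub>2 :: real \<times> real \<Rightarrow> complex.
            \<psi>\<^sub>1 \<in> borel_measurable lebesgue \<and> \<psi>\<^sub>2 \<in> borel_measurable lebesgue \<and>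
            (\<forall>x. cmod (\<psi>\<^sub>1 x) \<le> C * indicator S\<^sub>1 x) \<and>
            (\<forall>x. cmod (\<psi>\<^sub>2 x) \<le> C * indicator S\<^sub>2 x) \<and>
            commutator_pairing_defined \<gamma> b \<psi>\<^sub>1 \<psi>\<^sub>2 \<and>
            average Q (\<lambda>x. cmod (b x - average Q b))
              \<le> C * (1 / measure lebesgue Q *
                      cmod (pairing (commutator b (hilbert_along \<gamma>) \<psi>\<^sub>1) \<psi>\<^sub>2)) \<and>
            1 / measure lebesgue Q * cmod (pairing (commutator b (hilbert_along \<gamma>) \<psi>\<^sub>1) \<psi>\<^sub>2)
              \<le> C * average (dilate \<beta> \<Lambda> Q)
                       (\<lambda>x. cmod (b x - average (dilate \<beta> \<Lambda> Q) b))))"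
      by (rule exI[of _ W\<^sub>1], rule exI[of _ W\<^sub>2], rule exI[of _ P], intro conjI shape dist geometry,
          rule bexI[OF _ ST_in(1)], rule bexI[OF _ ST_in(2)], intro conjI ST_in(3),
          rule exI[of _ \<psi>], rule exI[of _ \<phi>], intro conjI allI \<psi> le_C defined lower_C upper_C)
  qed
qed

end
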